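(* Let $G=(V,E)$ be a finite undirected connected graph with $V=\{1,\dots,N\}$. All generators, the polynomial families $K_n,M_n,C_n,H_n,L_n^{(2k-1)}$ and the notions of duality and self-duality are as defined in the context. Then the following relations hold. (i) Self-duality. (a) Symmetric exclusion process. For $j\in\{\tfrac12,1,\tfrac32,\dots\}$ and every $p\in(0,1)$, SEP($j$), which has stationary product measure with Binomial$(2j,p)$ marginals, is self-dual with self-duality function $$D(\mathbf x,\mathbf n)=\prod_{i=1}^N \frac{K_{n_i}(x_i)}{\binom{2j}{n_i}},\qquad \mathbf x,\mathbf n\in\{0,1,\dots,2j\}^N,$$ where $K_n$ are the Krawtchouk polynomials with parameters $2j,p$. (b) Symmetric inclusion process. For $k>0$ and every $p\in(0,1)$, SIP($k$), which has stationary product measure with Negative Binomial$(2k,p)$ marginals, is self-dual with self-duality function $$D(\mathbf x,\mathbf n)=\prod_{i=1}^N \frac{\Gamma(2k)}{\Gamma(2k+n_i)}\,M_{n_i}(x_i),\qquad \mathbf x,\mathbf n\in\mathbb N_0^N,$$ where $M_n$ are the Meixner polynomials with parameters $2k,p$. (c) Independent random walkers. For every $\lambda>0$, IRW, which has stationary product measure with Poisson$(\lambda)$ marginals, is self-dual with self-duality function $$D(\mathbf x,\mathbf n)=\prod_{i=1}^N C_{n_i}(x_i),\qquad \mathbf x,\mathbf n\in\mathbb N_0^N,$$ where $C_n$ are the Charlier polynomials with parameter $\lambda$. (ii) Duality. (a) Brownian momentum process. BMP, which has stationary product measures with Gaussian$(0,\sigma^2)$ marginals ($\sigma^2>0$),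 is dual to the inclusion process with parameter $k=\tfrac14$, SIP($\tfrac14$), with duality function $$D(\mathbf x,\mathbf n)=\prod_{i=1}^N \frac{1}{(2n_i-1)!!}\,H_{2n_i}(x_i),\qquad \mathbf x\in\mathbb R^N,\ \mathbf n\in\mathbb N_0^N,$$ where $H_n$ are the Hermite polynomials. (b) Brownian energy process. For $k>0$, BEP($k$), which has stationary product measures with Gamma$(2k,\theta)$ marginals ($\theta>0$), is dual to SIP($k$) with duality function $$D(\mathbf x,\mathbf n)=\prod_{i=1}^N \frac{n_i!\,\Gamma(2k)}{\Gamma(2k+n_i)}\,L_{n_i}^{(2k-1)}(x_i),\qquad \mathbf x\in[0,\infty)^N,\ \mathbf n\in\mathbb N_0^N,$$ where $L_n^{(2k-1)}$ are the generalized Laguerre polynomials. (c) Kipnis-Marchioro-Presutti process. For $k>0$, KMP($k$), which has stationary product measures with Gamma$(2k,\theta)$ marginals ($\theta>0$), is dual to the dual-KMP($k$) process with duality function $$D(\mathbf x,\mathbf n)=\prod_{i=1}^N \frac{n_i!\,\Gamma(2k)}{\Gamma(2k+n_i)}\,L_{n_i}^{(2k-1)}(x_i),\qquad \mathbf x\in[0,\infty)^N,\ \mathbf n\in\mathbb N_0^N.$$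
   Context: **Duality.** Let $L$ and $L^{dual}$ be generators of two Markov processes with state spaces $\Omega$ and $\Omega^{dual}$. The process with generator $L$ is dual to the process with generator $L^{dual}$, with duality function $D:\Omega\times\Omega^{dual}\to\mathbb R$, if $$[L\,D(\cdot,n)](x)=[L^{dual}D(x,\cdot)](n)\qquad\text{for all }x\in\Omega,\ n\in\Omega^{dual},$$ where $L$ acts on $D$ as a function of the first variable and $L^{dual}$ acts on $D$ as a function of the second variable. If $L^{dual}=L$, the process is called self-dual with self-duality function $D$. Duality is understood throughout in this generator sense. **Generators.** In all sums, each edge $\{i,l\}\in E$ is counted once, with $1\le i<l\le N$. For $\mathbf x=(x_1,\dots,x_N)$ with integer entries, $\mathbf x^{i,l}$ is the configuration obtained from $\mathbf x$ by moving one particle from $i$ to $l$ (decrease $x_i$ by 1, increase $x_l$ by 1); terms whose rate is zero are read as zero. $\mathbb N_0=\{0,1,2,\dots\}$. - SEP($j$), on $\{0,1,\dots,2j\}^N$: $$L^{SEP(j)}f(\mathbf x)=\sum_{i<l,\,(i,l)\in E} x_i(2j-x_l)[f(\mathbf x^{i,l})-f(\mathbf x)]+(2j-x_i)x_l[f(\mathbf x^{l,i})-f(\mathbf x)].$$ - SIP($k$), on $\mathbb N_0^N$: $$L^{SIP(k)}f(\mathbf x)=\sum_{i<l,\,(i,l)\in E} x_i(2k+x_l)[f(\mathbf x^{i,l})-f(\mathbf x)]+x_l(2k+x_i)[f(\mathbf x^{l,i})-f(\mathbf x)].$$ - IRW, on $\mathbb N_0^N$: $$L^{IRW}f(\mathbf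 x)=\sum_{i<l,\,(i,l)\in E} x_i[f(\mathbf x^{i,l})-f(\mathbf x)]+x_l[f(\mathbf x^{l,i})-f(\mathbf x)].$$ - BMP, on $\mathbb R^N$: $$L^{BMP}f(\mathbf x)=\sum_{i<l,\,(i,l)\in E}\Big(x_i\frac{\partial}{\partial x_l}-x_l\frac{\partial}{\partial x_i}\Big)^2 f(\mathbf x)$$ (square of the differential operator). - BEP($k$), on $[0,\infty)^N$: $$L^{BEP(k)}f(\mathbf x)=\sum_{i<l,\,(i,l)\in E}\Big[x_ix_l\Big(\frac{\partial}{\partial x_i}-\frac{\partial}{\partial x_l}\Big)^2-2k(x_i-x_l)\Big(\frac{\partial}{\partial x_i}-\frac{\partial}{\partial x_l}\Big)\Big]f(\mathbf x)$$ (square of the differential operator). - KMP($k$), on $[0,\infty)^N$: $$L^{KMP(k)}f(\mathbf x)=\sum_{i<l,\,(i,l)\in E}\int_0^1\big[f(\mathbf x^{(i,l;p)})-f(\mathbf x)\big]\nu_{2k}(p)\,dp,\qquad \nu_{2k}(p)=\frac{\Gamma(4k)}{\Gamma(2k)^2}\,p^{2k-1}(1-p)^{2k-1},$$ where $\mathbf x^{(i,l;p)}$ is obtained from $\mathbf x$ by replacing $x_i$ with $p(x_i+x_l)$ and $x_l$ with $(1-p)(x_i+x_l)$. - dual-KMP($k$), on $\mathbb N_0^N$: $$L^{\text{dual-}KMP(k)}f(\mathbf n)=\sum_{i<l,\,(i,l)\in E}\ \sum_{r=0}^{n_i+n_l}\big[f(\mathbf n^{(i,l;r)})-f(\mathbf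 n)\big]\mu_{2k}(r\mid n_i+n_l),\qquad \mu_{2k}(r\mid C)=\frac{\binom{2k+r-1}{r}\binom{2k+C-r-1}{C-r}}{\binom{4k+C-1}{C}},$$ where $\mathbf n^{(i,l;r)}$ is obtained from $\mathbf n$ by replacing $n_i$ with $r$ and $n_l$ with $n_i+n_l-r$, and $\binom{a+m-1}{m}=\frac{\Gamma(a+m)}{m!\,\Gamma(a)}$ for real $a>0$. **Distributions.** Binomial$(2j,p)$: mass $\binom{2j}{x}p^x(1-p)^{2j-x}$ on $\{0,\dots,2j\}$. Negative Binomial$(2k,p)$: mass $\binom{2k+x-1}{x}p^x(1-p)^{2k}$ on $\mathbb N_0$. Poisson$(\lambda)$: mass $e^{-\lambda}\lambda^x/x!$ on $\mathbb N_0$. Gaussian$(0,\sigma^2)$: centered normal law with variance $\sigma^2$. Gamma$(2k,\theta)$: density $x^{2k-1}e^{-x/\theta}/(\Gamma(2k)\theta^{2k})$ on $(0,\infty)$. **Polynomials.** Each family below starts with the constant polynomial $1$ at $n=0$ (with the index $-1$ polynomial equal to $0$) and is determined by its three-term recurrence. - Krawtchouk (parameters $2j,p$; $0\le n\le 2j$): $xK_n(x)=(n+1)K_{n+1}(x)+(n+2jp-2np)K_n(x)+p(1-p)(2j-n+1)K_{n-1}(x)$. They are orthogonal with respect to Binomial$(2j,p)$, with squared norm $\binom{2j}{n}p^n(1-p)^n$. - Meixner (parameters $2k,p$): $xM_n(x)=\frac{p}{p-1}M_{n+1}(x)+\frac{n+pn+2kp}{1-p}M_n(x)+\frac{n(n-1+2k)}{p-1}M_{n-1}(x)$.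 They are orthogonal with respect to Negative Binomial$(2k,p)$, with squared norm $\frac{n!\,\Gamma(2k+n)}{p^n\Gamma(2k)}$. - Charlier (parameter $\lambda$): $xC_n(x)=-\lambda C_{n+1}(x)+(n+\lambda)C_n(x)-nC_{n-1}(x)$. They are orthogonal with respect to Poisson$(\lambda)$, with squared norm $n!\lambda^{-n}$. - Hermite: $H_{n+1}(x)-2xH_n(x)+2nH_{n-1}(x)=0$. They are orthogonal with respect to $e^{-x^2}/\sqrt\pi$ (the Gaussian with mean $0$ and variance $1/2$), with squared norm $2^n n!$. - Generalized Laguerre: $xL_n^{(2k-1)}(x)=-(n+1)L_{n+1}^{(2k-1)}(x)+(2n+2k)L_n^{(2k-1)}(x)-(n+2k-1)L_{n-1}^{(2k-1)}(x)$. They are orthogonal with respect to Gamma$(2k,1)$, with squared norm $\frac{\Gamma(n+2k)}{n!\,\Gamma(2k)}$. Convention: $(-1)!!=1$.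
   Formalization: In (ii)(a), BMP is proved dual to SIP(1/4) run at speed 4 (generator 4·L^SIP(1/4)), because the identity as written is off by a factor 4 (N=2, n=(1,0)). Stationarity is meant in the generator sense: Lf has integral 0 for suitable test functions f. *)

theory Defs
  imports "HOL-Probability.Probability" "Graph_Theory.Digraph_Component"
    "Graph_Theory.Pair_Digraph"
begin

section \<open>Generators, duality, stationarity\<close>

text \<open>
  Configurations on the vertex set $V = \{1,\dots,N\}$ are extensional functions, so a state space
  of the form $S^N$ is \<open>{1..N} \<rightarrow>\<^sub>E S\<close>.  A generator acts on total real functions of configurations;
  at a point of the state space its value depends only on the function's values on the state space.
\<close>

type_synonym 'c gen = "('c \<Rightarrow> real) \<Rightarrow> 'c \<Rightarrow> real"

definition dual ::
  "'a gen \<Rightarrow> 'a set \<Rightarrow> 'b gen \<Rightarrow> 'b set \<Rightarrow> ('a \<Rightarrow> 'b \<Rightarrow> real) \<Rightarrow> bool" where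
  "dual L \<Omega> Ldual \<Omega>dual D \<longleftrightarrow>
     (\<forall>x\<in>\<Omega>. \<forall>n\<in>\<Omega>dual. L (\<lambda>y. D y n) x = Ldual (\<lambda>m. D x m) n)"

definition self_dual :: "'a gen \<Rightarrow> 'a set \<Rightarrow> ('a \<Rightarrow> 'a \<Rightarrow> real) \<Rightarrow> bool" where
  "self_dual L \<Omega> D \<longleftrightarrow> dual L \<Omega> L \<Omega> D"

text \<open>
  Stationarity in the generator sense, \<open>\<integral> L f d\<mu> = 0\<close> for all \<open>f\<close> in a class \<open>F\<close> of test functions.
  Integrability is required explicitly because the integral of a non-integrable function is \<open>0\<close>.
\<close>

definition stationary :: "'a gen \<Rightarrow> 'a set \<Rightarrow> ('a \<Rightarrow> real) set \<Rightarrow> 'a measure \<Rightarrow> bool" where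
  "stationary L \<Omega> F \<mu> \<longleftrightarrow>
     prob_space \<mu> \<and> emeasure \<mu> \<Omega> = 1 \<and>
     (\<forall>f\<in>F. set_integrable \<mu> \<Omega> (L f) \<and> (LINT x:\<Omega>|\<mu>. L f x) = 0)"

definition bounded_functions :: "'a set \<Rightarrow> ('a \<Rightarrow> real) set" where
  "bounded_functions \<Omega> = {f. bounded (f ` \<Omega>)}"

definition bounded_borel_functions :: "nat \<Rightarrow> (nat \<Rightarrow> real) set \<Rightarrow> ((nat \<Rightarrow> real) \<Rightarrow> real) set" where
  "bounded_borel_functions N \<Omega> =
     {f \<in> borel_measurable (restrict_space (\<Pi>\<^sub>M i\<in>{1..N}. borel) \<Omega>). bounded (f ` \<Omega>)}"

text \<open>
  The \<open>i\<close>-th partial derivative of a function on \<open>S\<^sup>N\<close>; for \<open>S = {0..}\<close> it is one-sided at the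
  boundary.
\<close>

definition pd :: "real set \<Rightarrow> nat \<Rightarrow> (nat \<Rightarrow> real) gen" where
  "pd S i f x = vector_derivative (\<lambda>t. f (x(i := t))) (at (x i) within S)"

definition C1_on :: "nat \<Rightarrow> real set \<Rightarrow> ((nat \<Rightarrow> real) \<Rightarrow> real) \<Rightarrow> bool" where
  "C1_on N S f \<longleftrightarrow>
     continuous_on ({1..N} \<rightarrow>\<^sub>E S) f \<and>
     (\<forall>i\<in>{1..N}.
        (\<forall>x\<in>{1..N} \<rightarrow>\<^sub>E S. (\<lambda>t. f (x(i := t))) differentiable (at (x i) within S)) \<and>
        continuous_on ({1..N} \<rightarrow>\<^sub>E S) (pd S i f))"

definition C2_compact :: "nat \<Rightarrow> real set \<Rightarrow> ((nat \<Rightarrow> real) \<Rightarrow> real) set" where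
  "C2_compact N S =
     {f. C1_on N S f \<and> (\<forall>i\<in>{1..N}. C1_on N S (pd S i f)) \<and>
         (\<exists>K. compact K \<and> K \<subseteq> ({1..N} \<rightarrow>\<^sub>E S) \<and> (\<forall>x\<in>({1..N} \<rightarrow>\<^sub>E S) - K. f x = 0))}"


section \<open>The processes\<close>

text \<open>The graphs below have a symmetric arc relation; every edge is counted once, as \<open>i < l\<close>.\<close>

definition edges :: "nat pair_pre_digraph \<Rightarrow> (nat \<times> nat) set" where
  "edges G = {(i, l). (i, l) \<in> parcs G \<and> i < l}"

text \<open>
  Natural-number subtraction is harmless: whenever \<open>x i = 0\<close>, the rate multiplying the term is \<open>0\<close>.
\<close>

definition hop :: "nat \<Rightarrow> nat \<Rightarrow> (nat \<Rightarrow> nat) \<Rightarrow> (nat \<Rightarrow> nat)" where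
  "hop i l x = x(i := x i - 1, l := x l + 1)"

text \<open>The first parameter of \<open>sep_gen\<close> is the integer \<open>2j\<close>.\<close>

definition sep_gen :: "nat \<Rightarrow> nat pair_pre_digraph \<Rightarrow> (nat \<Rightarrow> nat) gen" where
  "sep_gen twoj G f x = (\<Sum>(i, l)\<in>edges G.
      real (x i) * (real twoj - real (x l)) * (f (hop i l x) - f x)
    + (real twoj - real (x i)) * real (x l) * (f (hop l i x) - f x))"

definition sip_gen :: "real \<Rightarrow> nat pair_pre_digraph \<Rightarrow> (nat \<Rightarrow> nat) gen" where
  "sip_gen k G f x = (\<Sum>(i, l)\<in>edges G.
      real (x i) * (2 * k + real (x l)) * (f (hop i l x) - f x)
    + real (x l) * (2 * k + real (x i)) * (f (hop l i x) - f x))"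

definition irw_gen :: "nat pair_pre_digraph \<Rightarrow> (nat \<Rightarrow> nat) gen" where
  "irw_gen G f x = (\<Sum>(i, l)\<in>edges G.
      real (x i) * (f (hop i l x) - f x) + real (x l) * (f (hop l i x) - f x))"

definition rotation :: "nat \<Rightarrow> nat \<Rightarrow> (nat \<Rightarrow> real) gen" where
  "rotation i l f x = x i * pd UNIV l f x - x l * pd UNIV i f x"

text \<open>
  With this normalisation the operator multiplies the SIP rates by four: for $N = 2$ and
  $D(x,(1,0)) = 4x_1^2-2$, \<open>bmp_gen\<close> yields $8(x_2^2-x_1^2)$ while \<open>sip_gen (1/4)\<close> yields
  $2(x_2^2-x_1^2)$.  The dual of BMP is therefore SIP(1/4) run at speed 4, with generator
  \<open>\<lambda>f n. 4 * sip_gen (1/4) G f n\<close>.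
\<close>

definition bmp_gen :: "nat pair_pre_digraph \<Rightarrow> (nat \<Rightarrow> real) gen" where
  "bmp_gen G f x = (\<Sum>(i, l)\<in>edges G. rotation i l (rotation i l f) x)"

definition pd_diff :: "nat \<Rightarrow> nat \<Rightarrow> (nat \<Rightarrow> real) gen" where
  "pd_diff i l f x = pd {0..} i f x - pd {0..} l f x"

definition bep_gen :: "real \<Rightarrow> nat pair_pre_digraph \<Rightarrow> (nat \<Rightarrow> real) gen" where
  "bep_gen k G f x = (\<Sum>(i, l)\<in>edges G.
      x i * x l * pd_diff i l (pd_diff i l f) x - 2 * k * (x i - x l) * pd_diff i l f x)"

definition kmp_density :: "real \<Rightarrow> real \<Rightarrow> real" where
  "kmp_density a p = Gamma (2 * a) / (Gamma a)\<^sup>2 * p powr (a - 1) * (1 - p) powr (a - 1)"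

definition kmp_gen :: "real \<Rightarrow> nat pair_pre_digraph \<Rightarrow> (nat \<Rightarrow> real) gen" where
  "kmp_gen k G f x = (\<Sum>(i, l)\<in>edges G.
      LINT p:{0..1}|lborel.
        (f (x(i := p * (x i + x l), l := (1 - p) * (x i + x l))) - f x) * kmp_density (2 * k) p)"

text \<open>\<open>multichoose a m\<close> is the binomial coefficient \<open>a + m - 1\<close> over \<open>m\<close>, for real \<open>a > 0\<close>.\<close>

definition multichoose :: "real \<Rightarrow> nat \<Rightarrow> real" where
  "multichoose a m = Gamma (a + real m) / (fact m * Gamma a)"

definition dual_kmp_weight :: "real \<Rightarrow> nat \<Rightarrow> nat \<Rightarrow> real" where
  "dual_kmp_weight a r C = multichoose a r * multichoose a (C - r) / multichoose (2 * a) C"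

definition dual_kmp_gen :: "real \<Rightarrow> nat pair_pre_digraph \<Rightarrow> (nat \<Rightarrow> nat) gen" where
  "dual_kmp_gen k G f n = (\<Sum>(i, l)\<in>edges G. \<Sum>r = 0..n i + n l.
      (f (n(i := r, l := n i + n l - r)) - f n) * dual_kmp_weight (2 * k) r (n i + n l))"


section \<open>Marginals not in the library\<close>

definition neg_binomial_distr :: "real \<Rightarrow> real \<Rightarrow> nat measure" where
  "neg_binomial_distr a p =
     density (count_space UNIV) (\<lambda>x. ennreal (multichoose a x * p ^ x * (1 - p) powr a))"

definition gamma_distr :: "real \<Rightarrow> real \<Rightarrow> real measure" where
  "gamma_distr a \<theta> = density lborel
     (\<lambda>x. ennreal (if 0 < x then x powr (a - 1) * exp (- x / \<theta>) / (Gamma a * \<theta> powr a) else 0))"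


section \<open>Orthogonal polynomials\<close>

text \<open>
  Each family is its three-term recurrence solved for the polynomial of highest index.  The
  recurrences in their usual form follow as lemmas.
\<close>

fun krawtchouk :: "nat \<Rightarrow> real \<Rightarrow> nat \<Rightarrow> real \<Rightarrow> real" where
  "krawtchouk J p 0 x = 1"
| "krawtchouk J p (Suc 0) x = x - real J * p"
| "krawtchouk J p (Suc (Suc n)) x =
     ((x - (real (Suc n) + real J * p - 2 * real (Suc n) * p)) * krawtchouk J p (Suc n) x
      - p * (1 - p) * (real J - real (Suc n) + 1) * krawtchouk J p n x) / (real (Suc n) + 1)"

fun meixner :: "real \<Rightarrow> real \<Rightarrow> nat \<Rightarrow> real \<Rightarrow> real" where
  "meixner a p 0 x = 1"
| "meixner a p (Suc 0) x = (p - 1) / p * (x - a * p / (1 - p))"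
| "meixner a p (Suc (Suc n)) x = (p - 1) / p *
     ((x - (real (Suc n) + p * real (Suc n) + a * p) / (1 - p)) * meixner a p (Suc n) x
      - real (Suc n) * (real (Suc n) - 1 + a) / (p - 1) * meixner a p n x)"

fun charlier :: "real \<Rightarrow> nat \<Rightarrow> real \<Rightarrow> real" where
  "charlier c 0 x = 1"
| "charlier c (Suc 0) x = (c - x) / c"
| "charlier c (Suc (Suc n)) x =
     ((real (Suc n) + c - x) * charlier c (Suc n) x - real (Suc n) * charlier c n x) / c"

fun hermite :: "nat \<Rightarrow> real \<Rightarrow> real" where
  "hermite 0 x = 1"
| "hermite (Suc 0) x = 2 * x"
| "hermite (Suc (Suc n)) x = 2 * x * hermite (Suc n) x - 2 * real (Suc n) * hermite n x"

text \<open>\<open>laguerre a n\<close> is the generalized Laguerre polynomial with upper index \<open>a - 1\<close>.\<close>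

fun laguerre :: "real \<Rightarrow> nat \<Rightarrow> real \<Rightarrow> real" where
  "laguerre a 0 x = 1"
| "laguerre a (Suc 0) x = a - x"
| "laguerre a (Suc (Suc n)) x =
     ((2 * real (Suc n) + a - x) * laguerre a (Suc n) x
      - (real (Suc n) + a - 1) * laguerre a n x) / (real (Suc n) + 1)"

lemma krawtchouk_recurrence:
  "x * krawtchouk J p n x =
     (real n + 1) * krawtchouk J p (n + 1) x
     + (real n + real J * p - 2 * real n * p) * krawtchouk J p n x
     + p * (1 - p) * (real J - real n + 1) * (if n = 0 then 0 else krawtchouk J p (n - 1) x)"
proof (cases n)
  case (Suc m)
  have "(real (Suc m) + 1) * krawtchouk J p (Suc (Suc m)) x =
      (x - (real (Suc m) + real J * p - 2 * real (Suc m) * p)) * krawtchouk J p (Suc m) x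
      - p * (1 - p) * (real J - real (Suc m) + 1) * krawtchouk J p m x"
    unfolding krawtchouk.simps(3) by (simp del: of_nat_Suc add: add_pos_pos less_imp_neq[symmetric])
  then show ?thesis
    by (simp add: Suc left_diff_distrib del: of_nat_Suc krawtchouk.simps)
qed simp

lemma meixner_recurrence:
  assumes "0 < p" "p < 1"
  shows "x * meixner a p n x =
     p / (p - 1) * meixner a p (n + 1) x
     + (real n + p * real n + a * p) / (1 - p) * meixner a p n x
     + real n * (real n - 1 + a) / (p - 1) * (if n = 0 then 0 else meixner a p (n - 1) x)"
proof -
  have cancel: "p / (p - 1) * ((p - 1) / p * y) = y" for y
    using assms by simp
  show ?thesis
  proof (cases n)
    case 0
    then show ?thesis
      using cancel[of "x - a * p / (1 - p)"] by simp
  next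
    case (Suc m)
    have "p / (p - 1) * meixner a p (Suc (Suc m)) x =
        (x - (real (Suc m) + p * real (Suc m) + a * p) / (1 - p)) * meixner a p (Suc m) x
        - real (Suc m) * (real (Suc m) - 1 + a) / (p - 1) * meixner a p m x"
      unfolding meixner.simps(3) by (rule cancel)
    then show ?thesis
      by (simp add: Suc left_diff_distrib del: of_nat_Suc meixner.simps)
  qed
qed

lemma charlier_recurrence:
  assumes "c > 0"
  shows "x * charlier c n x =
     - c * charlier c (n + 1) x + (real n + c) * charlier c n x
     - real n * (if n = 0 then 0 else charlier c (n - 1) x)"
proof (cases n)
  case (Suc m)
  have "c * charlier c (Suc (Suc m)) x =
      (real (Suc m) + c - x) * charlier c (Suc m) x - real (Suc m) * charlier c m x"
    using assms by (simp del: of_nat_Suc)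
  then show ?thesis
    by (simp add: Suc algebra_simps del: of_nat_Suc charlier.simps)
qed (use assms in simp)

lemma hermite_recurrence:
  "hermite (n + 1) x - 2 * x * hermite n x + 2 * real n * (if n = 0 then 0 else hermite (n - 1) x) = 0"
  by (cases n) simp_all

lemma laguerre_recurrence:
  "x * laguerre a n x =
     - (real n + 1) * laguerre a (n + 1) x + (2 * real n + a) * laguerre a n x
     - (real n + a - 1) * (if n = 0 then 0 else laguerre a (n - 1) x)"
proof (cases n)
  case (Suc m)
  have "(real (Suc m) + 1) * laguerre a (Suc (Suc m)) x =
      (2 * real (Suc m) + a - x) * laguerre a (Suc m) x
      - (real (Suc m) + a - 1) * laguerre a m x"
    unfolding laguerre.simps(3) by (simp del: of_nat_Suc add: add_pos_pos less_imp_neq[symmetric])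
  then show ?thesis
    by (simp add: Suc left_diff_distrib del: of_nat_Suc laguerre.simps)
      (simp add: algebra_simps del: laguerre.simps)
qed simp

text \<open>\<open>odd_double_fact n\<close> is $(2n-1)!!$, with $(-1)!! = 1$.\<close>

definition odd_double_fact :: "nat \<Rightarrow> real" where
  "odd_double_fact n = (\<Prod>i = 1..n. 2 * real i - 1)"

end

theory Submission
  imports Defs
begin

text \<open>
  On every edge the generators of SIP, BMP and BEP are, up to a scalar and an additive constant, the
  bilinear form $K^+K^- + K^-K^+ - 2K^0K^0$ in two commuting copies of the $su(1,1)$ Lie algebra (SEP
  and IRW use the $su(2)$ and Heisenberg analogues)
  of one-site operators.  A duality therefore reduces to one-site identities: raising, lowering and
  diagonal operators in $x$, applied to a polynomial $d_n(x)$, are combinations of $d_{n-1}(x)$,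
  $d_n(x)$, $d_{n+1}(x)$, and the change of basis preserves the bilinear form.  The three discrete
  families are instances of a single recurrence.  For KMP both sides of the duality relation equal
  $L_{n_i+n_l}^{(4k-1)}(x_i+x_l)$ up to normalisation: one by the convolution formula for Laguerre
  polynomials, the other by Beta moments and the Vandermonde identity.

  Stationarity of all processes except KMP follows from a Stein identity for the marginal, applied
  in one coordinate at a time; for KMP it is the independence of the sum and the ratio of two
  independent Gamma variables.
\<close>

section \<open>Self-duality of the hopping processes\<close>

text \<open>The parameters of the discrete families are moments of the stationary law:
  \<open>w * a\<close> is its mean, which is the zero of \<open>q 1\<close>, and
  \<open>w * (1 + s * w) * a\<close> its variance. So w is p for exclusion, c for walkers and p / (1
  - p) for inclusion, while u only fixes the scale of the polynomials. The polynomials are given by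
  their recurrences alone, so the one-site identities are extracted from these by induction. The
  prefactors in the duality functions have one purpose: after multiplication by them, raising the
  index n has coefficient a + s n and lowering it has coefficient n, and these are the hop rates on
  the dual side. The delicate points sit at the borders of the state spaces. For exclusion the
  recurrence reaches the index J + 1, where the prefactor 1 / (J choose n) degenerates; for BEP the
  derivatives are one-sided and the Gamma density may blow up at 0; and test functions are
  unconstrained outside the state space.\<close>

text \<open>The rates $x_i(a + s x_l)$ give SEP, IRW and SIP for $s = -1, 0, 1$, with Krawtchouk, Charlier and
  Meixner polynomials.  The coefficient of $q_{n-1}$ is the one for which the change of basis in
  \<open>shift_up\<close> and \<open>shift_down\<close> preserves the bilinear form of the generator.\<close>

locale meixner_class =
  fixes s a u w :: real and \<alpha> \<beta> :: "nat \<Rightarrow> real" and q :: "nat \<Rightarrow> real \<Rightarrow> real"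
  assumes u_nonzero: "u \<noteq> 0" and \<alpha>_nonzero: "\<alpha> n \<noteq> 0" and \<beta>_0: "\<beta> 0 = 0"
    and \<alpha>_\<beta>: "\<alpha> n * \<beta> (Suc n) = (a + s * real n) * (real n + 1)"
    and q_0: "q 0 x = 1"
    and recurrence: "x * q n x = u * \<alpha> n * q (Suc n) x
      + ((1 + 2 * s * w) * real n + w * a) * q n x + w * (1 + s * w) / u * \<beta> n * q (n - 1) x"
begin

text \<open>The recurrence at x + 1 expresses q (m + 1) at x + 1 by q m and q (m - 1) at x + 1.
  Multiplied by a + s x, these two are known by induction; the recurrence at x absorbs the remaining
  factors x, and \<open>\<alpha>_\<beta>\<close> closes the identity.\<close>

lemma shift_up:
  "(a + s * x) * q n (x + 1) = s * u * \<alpha> n * q (Suc n) x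
     + (1 + s * w) * (2 * s * real n + a) * q n x + (1 + s * w)\<^sup>2 / u * \<beta> n * q (n - 1) x"
proof (induction n rule: less_induct)
  case (less n)
  \<comment> \<open>Divisions by u are hidden in y, with \<open>u * y = 1 + s * w\<close> as a side
    relation, so that \<open>algebra\<close> faces a purely polynomial problem.\<close>
  define y where "y = (1 + s * w) / u"
  have uy: "u * y = 1 + s * w" using u_nonzero by (simp add: y_def)
  have rec: "x * q n x = u * \<alpha> n * q (Suc n) x
      + ((1 + 2 * s * w) * real n + w * a) * q n x + w * y * \<beta> n * q (n - 1) x" for n x
    using recurrence[of x n] by (simp add: y_def)
  have yy: "(1 + s * w)\<^sup>2 / u = u * y * y"
    using u_nonzero by (simp add: y_def power2_eq_square)
  note [simp] = of_nat_Suc[where 'a = real]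
  show ?case
  proof (cases n)
    case 0
    have "u * \<alpha> 0 * q (Suc 0) x = x - w * a" using rec[of x 0] by (simp add: q_0 \<beta>_0)
    then have "s * u * \<alpha> 0 * q (Suc 0) x = s * (x - w * a)" by simp
    with 0 show ?thesis by (simp add: q_0 \<beta>_0 algebra_simps)
  next
    case (Suc m)
    have IH: "(a + s * x) * q m (x + 1) = s * u * \<alpha> m * q (Suc m) x
     + (1 + s * w) * (2 * s * real m + a) * q m x + u * y * y * \<beta> m * q (m - 1) x"
      using less[of m] Suc by (simp add: yy)
    have r1: "(x + 1) * q m (x + 1) = u * \<alpha> m * q (Suc m) (x + 1)
      + ((1 + 2 * s * w) * real m + w * a) * q m (x + 1) + w * y * \<beta> m * q (m - 1) (x + 1)"
      by (rule rec)
    have "u * \<alpha> m * ((a + s * x) * q (Suc m) (x + 1)) = u * \<alpha> m *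
     (s * u * \<alpha> (Suc m) * q (Suc (Suc m)) x
     + (1 + s * w) * (2 * s * real (Suc m) + a) * q (Suc m) x + u * y * y * \<beta> (Suc m) * q m x)"
    \<comment> \<open>At m = 0 there is no second induction hypothesis; its term is killed by
      \<open>\<beta> 0 = 0\<close>.\<close>
    proof (cases m)
      case 0
      show ?thesis
        using rec[of x 1] rec[of x 0] r1 IH uy \<alpha>_\<beta>[of 0] \<beta>_0
        unfolding 0 by (simp add: q_0) algebra
    next
      case (Suc l)
      have IH2: "(a + s * x) * q l (x + 1) = s * u * \<alpha> l * q (Suc l) x
       + (1 + s * w) * (2 * s * real l + a) * q l x + u * y * y * \<beta> l * q (l - 1) x"
        using less[of l] Suc \<open>n = Suc m\<close> by (simp add: yy)
      show ?thesis
        using rec[of x "Suc (Suc l)"] rec[of x "Suc l"] rec[of x l] r1 IH IH2 uy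
         \<alpha>_\<beta>[of l] \<alpha>_\<beta>[of "Suc l"]
        unfolding Suc by simp algebra
    qed
    then show ?thesis using u_nonzero \<alpha>_nonzero[of m] by (simp add: Suc yy)
  qed
qed

text \<open>The induction is that of \<open>shift_up\<close>. Multiplied by s, the right-hand side
  is the one of \<open>shift_up\<close> with \<open>s * w\<close> in place of
  \<open>1 + s * w\<close>.\<close>

lemma shift_down:
  "x * q n (x - 1) = u * \<alpha> n * q (Suc n) x
     + w * (2 * s * real n + a) * q n x + s * w\<^sup>2 / u * \<beta> n * q (n - 1) x"
proof (induction n rule: less_induct)
  case (less n)
  define t where "t = 1 / u"
  have ut: "u * t = 1" using u_nonzero by (simp add: t_def)
  have rec: "x * q n x = u * \<alpha> n * q (Suc n) x
      + ((1 + 2 * s * w) * real n + w * a) * q n x + w * (1 + s * w) * t * \<beta> n * q (n - 1) x" for n x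
    using recurrence[of x n] by (simp add: t_def)
  have yy: "s * w\<^sup>2 / u = s * w * w * t"
    using u_nonzero by (simp add: t_def power2_eq_square)
  note [simp] = of_nat_Suc[where 'a = real]
  show ?case
  proof (cases n)
    case 0
    have "u * \<alpha> 0 * q (Suc 0) x = x - w * a" using rec[of x 0] by (simp add: q_0 \<beta>_0)
    with 0 show ?thesis by (simp add: q_0 \<beta>_0 algebra_simps)
  next
    case (Suc m)
    have IH: "x * q m (x - 1) = u * \<alpha> m * q (Suc m) x
     + w * (2 * s * real m + a) * q m x + s * w * w * t * \<beta> m * q (m - 1) x"
      using less[of m] Suc by (simp add: yy)
    have r1: "(x - 1) * q m (x - 1) = u * \<alpha> m * q (Suc m) (x - 1)
      + ((1 + 2 * s * w) * real m + w * a) * q m (x - 1) + w * (1 + s * w) * t * \<beta> m * q (m - 1) (x - 1)"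
      by (rule rec)
    have "u * \<alpha> m * (x * q (Suc m) (x - 1)) = u * \<alpha> m *
     (u * \<alpha> (Suc m) * q (Suc (Suc m)) x
     + w * (2 * s * real (Suc m) + a) * q (Suc m) x + s * w * w * t * \<beta> (Suc m) * q m x)"
    proof (cases m)
      case 0
      show ?thesis
        using rec[of x 1] rec[of x 0] r1 IH ut \<alpha>_\<beta>[of 0] \<beta>_0
        unfolding 0 by (simp add: q_0) algebra
    next
      case (Suc l)
      have IH2: "x * q l (x - 1) = u * \<alpha> l * q (Suc l) x
       + w * (2 * s * real l + a) * q l x + s * w * w * t * \<beta> l * q (l - 1) x"
        using less[of l] Suc \<open>n = Suc m\<close> by (simp add: yy)
      show ?thesis
        using rec[of x "Suc (Suc l)"] rec[of x "Suc l"] rec[of x l] r1 IH IH2 ut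
         \<alpha>_\<beta>[of l] \<alpha>_\<beta>[of "Suc l"]
        unfolding Suc by simp algebra
    qed
    then show ?thesis using u_nonzero \<alpha>_nonzero[of m] by (simp add: Suc yy)
  qed
qed

end

definition hop_gen :: "real \<Rightarrow> real \<Rightarrow> nat pair_pre_digraph \<Rightarrow> (nat \<Rightarrow> nat) gen" where
  "hop_gen s a G f x = (\<Sum>(i, l)\<in>edges G.
      real (x i) * (a + s * real (x l)) * (f (hop i l x) - f x)
    + real (x l) * (a + s * real (x i)) * (f (hop l i x) - f x))"

lemma sep_gen_eq_hop_gen: "sep_gen J = hop_gen (-1) (real J)"
  by (simp add: sep_gen_def hop_gen_def fun_eq_iff mult.commute)

lemma sip_gen_eq_hop_gen: "sip_gen k = hop_gen 1 (2 * k)"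
  by (simp add: sip_gen_def hop_gen_def fun_eq_iff)

lemma irw_gen_eq_hop_gen: "irw_gen = hop_gen 0 1"
  by (simp add: irw_gen_def hop_gen_def fun_eq_iff)

section \<open>Reduction of self-duality on the graph to one pair of sites\<close>

lemma edges_subset:
  assumes "pair_graph G" "pverts G = V" "(i, l) \<in> edges G"
  shows "i \<in> V" "l \<in> V" "i < l"
proof -
  interpret pair_graph G by fact
  show "i \<in> V" "l \<in> V" "i < l"
    using assms in_arcsD1 in_arcsD2 by (auto simp: edges_def)
qed

lemma finite_edges:
  assumes "pair_graph G"
  shows "finite (edges G)"
proof -
  interpret pair_graph G by fact
  show ?thesis
    by (rule finite_subset[OF _ pair_finite_arcs]) (auto simp: edges_def)
qed

lemma prod_remove_two:
  fixes g :: "'a \<Rightarrow> 'b::comm_monoid_mult"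
  assumes "finite I" "i \<in> I" "l \<in> I" "i \<noteq> l"
  shows "prod g I = g i * g l * prod g (I - {i, l})"
  using assms by (simp add: prod.remove[of I i] prod.remove[of "I - {i}" l] Diff_insert2[symmetric] mult.assoc insert_commute)

lemma hop_simps:
  assumes "i \<noteq> l"
  shows "hop i l x i = x i - 1" "hop i l x l = x l + 1" "j \<noteq> i \<Longrightarrow> j \<noteq> l \<Longrightarrow> hop i l x j = x j"
  using assms by (simp_all add: hop_def)

lemma hop_prod:
  fixes g :: "'a::comm_monoid_mult"
  assumes "finite I" "i \<in> I" "l \<in> I" "i \<noteq> l"
  shows "(\<Prod>j\<in>I. (F j (hop i l x j) :: 'a)) = F i (x i - 1) * F l (x l + 1) * (\<Prod>j\<in>I - {i, l}. F j (x j))"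
  using assms by (simp add: prod_remove_two hop_simps cong: prod.cong) (auto intro!: prod.cong arg_cong2[where f="(*)"] simp: hop_simps)

text \<open>An edge changes only the factors at i and l, so the product R over the other sites
  factors out of both sides. In the applications, values of d beyond the border of S carry a
  vanishing rate.\<close>

lemma self_dual_hop_gen:
  assumes G: "pair_graph G" "pverts G = I"
    and two_site: "\<And>x y m n. x \<in> S \<Longrightarrow> y \<in> S \<Longrightarrow> m \<in> S \<Longrightarrow> n \<in> S \<Longrightarrow>
      real x * (a + s * real y) * (d m (x - 1) * d n (y + 1) - d m x * d n y)
      + real y * (a + s * real x) * (d m (x + 1) * d n (y - 1) - d m x * d n y)
      = real m * (a + s * real n) * (d (m - 1) x * d (n + 1) y - d m x * d n y)
      + real n * (a + s * real m) * (d (m + 1) x * d (n - 1) y - d m x * d n y)"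
  shows "self_dual (hop_gen s a G) (I \<rightarrow>\<^sub>E S) (\<lambda>x n. \<Prod>i\<in>I. d (n i) (x i))"
  unfolding self_dual_def dual_def hop_gen_def
proof (intro ballI sum.cong refl, clarify)
  fix x n i l assume x: "x \<in> I \<rightarrow>\<^sub>E S" and n: "n \<in> I \<rightarrow>\<^sub>E S" and e: "(i, l) \<in> edges G"
  interpret pair_graph G by fact
  have I: "finite I" using G(2) by auto
  have il: "i \<in> I" "l \<in> I" "i \<noteq> l" using edges_subset[OF G e] by auto
  have li: "l \<noteq> i" using il by simp
  have comm: "I - {l, i} = I - {i, l}" by auto
  have S: "x i \<in> S" "x l \<in> S" "n i \<in> S" "n l \<in> S" using x n il by (auto simp: PiE_def Pi_def)
  define R where "R = (\<Prod>j\<in>I - {i, l}. d (n j) (x j))"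
  note hx = hop_prod[OF I il, where F = "\<lambda>j. d (n j)" and x = x, folded R_def]
    hop_prod[OF I il(2,1) li, where F = "\<lambda>j. d (n j)" and x = x, unfolded comm, folded R_def]
  note hn = hop_prod[OF I il, where F = "\<lambda>j m. d m (x j)" and x = n, folded R_def]
    hop_prod[OF I il(2,1) li, where F = "\<lambda>j m. d m (x j)" and x = n, unfolded comm, folded R_def]
  note h0 = prod_remove_two[OF I il, of "\<lambda>j. d (n j) (x j)", folded R_def]
  show "real (x i) * (a + s * real (x l)) * ((\<Prod>j\<in>I. d (n j) (hop i l x j)) - (\<Prod>j\<in>I. d (n j) (x j))) +
       real (x l) * (a + s * real (x i)) * ((\<Prod>j\<in>I. d (n j) (hop l i x j)) - (\<Prod>j\<in>I. d (n j) (x j))) =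
       real (n i) * (a + s * real (n l)) * ((\<Prod>j\<in>I. d (hop i l n j) (x j)) - (\<Prod>j\<in>I. d (n j) (x j))) +
       real (n l) * (a + s * real (n i)) * ((\<Prod>j\<in>I. d (hop l i n j) (x j)) - (\<Prod>j\<in>I. d (n j) (x j)))"
    unfolding hx hn h0
    using two_site[OF S(1,2,3,4)] by algebra
qed

context meixner_class
begin

text \<open>Dividing by c turns the coefficients \<alpha> n and \<beta> n into the dual hop rates a
  + s n and n. The condition \<open>up\<close> is stated with the values of q at points of S, not
  for coefficients: for exclusion at n = J the normalisation \<open>c (Suc n)\<close> is 0, and the
  equation holds because q (J + 1) vanishes on S and a + s n = 0.\<close>

lemma self_dual_normalized:
  assumes G: "pair_graph G" "pverts G = I"
    and norm: "\<And>n. n \<in> S \<Longrightarrow> c n \<noteq> 0"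
    and up: "\<And>n x. n \<in> S \<Longrightarrow> x \<in> S \<Longrightarrow>
        \<alpha> n * q (Suc n) (real x) / c n = (a + s * real n) * (q (Suc n) (real x) / c (Suc n))"
    and down: "\<And>n. n \<in> S \<Longrightarrow> \<beta> n / c n = real n / c (n - 1)"
  shows "self_dual (hop_gen s a G) (I \<rightarrow>\<^sub>E S) (\<lambda>x n. \<Prod>i\<in>I. q (n i) (real (x i)) / c (n i))"
proof (rule self_dual_hop_gen[OF G, where d = "\<lambda>n x. q n (real x) / c n"])
  define t where "t = 1 / u"
  define d where "d n x = q n (real x) / c n" for n x
  have ut: "u * t = 1" using u_nonzero by (simp add: t_def)
  have A: "\<alpha> n * q (Suc n) (real x) / c n = (a + s * real n) * d (Suc n) x" if "n \<in> S" "x \<in> S" for n x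
    using up[OF that] by (simp add: d_def)
  have B: "\<beta> n * q (n - 1) (real x) / c n = real n * d (n - 1) x" if "n \<in> S" for n x
    using arg_cong[OF down[OF that], of "\<lambda>z. z * q (n - 1) (real x)"] by (simp add: d_def)
  \<comment> \<open>One statement for \<open>recurrence\<close>, \<open>shift_up\<close> and
    \<open>shift_down\<close>, which differ only in the coefficients e, f, g.\<close>
  have normalize: "X / c n = e * ((a + s * real n) * d (n + 1) x) + f * d n x + g * (real n * d (n - 1) x)"
    if "n \<in> S" "x \<in> S" and
      X: "X = e * \<alpha> n * q (Suc n) (real x) + f * q n (real x) + g * \<beta> n * q (n - 1) (real x)"
    for X e f g n x
    unfolding X Suc_eq_plus1[symmetric] A[OF that(1,2), symmetric] B[OF that(1), symmetric]
    by (simp only: d_def add_divide_distrib times_divide_eq_right mult.assoc)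
  have div_u: "z / u = z * t" for z by (simp add: t_def)
  note eqs = normalize[OF _ _ recurrence, unfolded div_u] normalize[OF _ _ shift_up, unfolded div_u]
    normalize[OF _ _ shift_down, unfolded div_u]
  have Z: "real x * d n x = u * ((a + s * real n) * d (n + 1) x)
      + ((1 + 2 * s * w) * real n + w * a) * d n x + w * (1 + s * w) * t * (real n * d (n - 1) x)"
    if "n \<in> S" "x \<in> S" for n x
    using eqs(1)[OF that] by (simp add: d_def)
  have P: "(a + s * real x) * d n (x + 1) = s * u * ((a + s * real n) * d (n + 1) x)
      + (1 + s * w) * (2 * s * real n + a) * d n x + (1 + s * w)\<^sup>2 * t * (real n * d (n - 1) x)"
    if "n \<in> S" "x \<in> S" for n x
    using eqs(2)[OF that] by (simp add: d_def add.commute)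
  have M: "real x * d n (x - 1) = u * ((a + s * real n) * d (n + 1) x)
      + w * (2 * s * real n + a) * d n x + s * w\<^sup>2 * t * (real n * d (n - 1) x)"
    if "n \<in> S" "x \<in> S" for n x
  proof -
    \<comment> \<open>At x = 0 the factor x masks the truncated subtraction.\<close>
    have "real x * d n (x - 1) = real x * q n (real x - 1) / c n"
      by (cases x) (simp_all add: d_def)
    then show ?thesis using eqs(3)[OF that] by simp
  qed
  fix x y m n assume *: "x \<in> S" "y \<in> S" "m \<in> S" "n \<in> S"
  have "real x * (a + s * real y) * (d m (x - 1) * d n (y + 1) - d m x * d n y)
      + real y * (a + s * real x) * (d m (x + 1) * d n (y - 1) - d m x * d n y)
      = (real x * d m (x - 1)) * ((a + s * real y) * d n (y + 1))
      + ((a + s * real x) * d m (x + 1)) * (real y * d n (y - 1))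
      - a * (real x * d m x) * d n y - a * d m x * (real y * d n y)
      - 2 * s * (real x * d m x) * (real y * d n y)"
    by (simp add: algebra_simps)
  \<comment> \<open>The terms raising both indices cancel, and so do those lowering both. Raising
    one and lowering the other has coefficient \<open>(1 + s * w)\<^sup>2 + (s * w)\<^sup>2 - 2 * s
    * w * (1 + s * w) = 1\<close>.\<close>
  also have "\<dots> = real m * (a + s * real n) * (d (m - 1) x * d (n + 1) y - d m x * d n y)
      + real n * (a + s * real m) * (d (m + 1) x * d (n - 1) y - d m x * d n y)"
    unfolding Z[OF *(3,1)] Z[OF *(4,2)] P[OF *(3,1)] P[OF *(4,2)] M[OF *(3,1)] M[OF *(4,2)]
    using ut by algebra
  finally show "real x * (a + s * real y) * (q m (real (x - 1)) / c m * (q n (real (y + 1)) / c n) - q m (real x) / c m * (q n (real y) / c n))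
      + real y * (a + s * real x) * (q m (real (x + 1)) / c m * (q n (real (y - 1)) / c n) - q m (real x) / c m * (q n (real y) / c n))
      = real m * (a + s * real n) * (q (m - 1) (real x) / c (m - 1) * (q (n + 1) (real y) / c (n + 1)) - q m (real x) / c m * (q n (real y) / c n))
      + real n * (a + s * real m) * (q (m + 1) (real x) / c (m + 1) * (q (n - 1) (real y) / c (n - 1)) - q m (real x) / c m * (q n (real y) / c n))"
    unfolding d_def .
qed

end

section \<open>The Krawtchouk, Meixner and Charlier instances\<close>

lemma krawtchouk_class:
  assumes "0 < p" "p < 1"
  shows "meixner_class (-1) (real J) 1 p (\<lambda>n. real n + 1)
    (\<lambda>n. if n = 0 then 0 else real J - real n + 1) (krawtchouk J p)"
proof
  fix n x
  \<comment> \<open>\<beta> 0 is set to 0 by hand: J - n + 1 does not vanish at n = 0, where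
    \<open>q (n - 1)\<close> is q 0 by truncation.\<close>
  show "x * krawtchouk J p n x = 1 * (real n + 1) * krawtchouk J p (Suc n) x
     + ((1 + 2 * - 1 * p) * real n + p * real J) * krawtchouk J p n x
     + p * (1 + - 1 * p) / 1 * (if n = 0 then 0 else real J - real n + 1) * krawtchouk J p (n - 1) x"
    using krawtchouk_recurrence[of x J p n]
    by (cases n) (simp_all add: algebra_simps del: krawtchouk.simps)
qed (simp_all add: add_pos_pos less_imp_neq[symmetric])

text \<open>Starts the induction on x in \<open>krawtchouk_vanishes\<close>, since J choose n is 0
  for n = J + 1. The value is the coefficient of t^n in (1 - p t)^J, which is the generating
  function (1 - p t)^(J - x) (1 + (1 - p) t)^x at x = 0.\<close>

lemma krawtchouk_at_0: "krawtchouk J p n 0 = (- p) ^ n * real (J choose n)"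
proof (induction n rule: less_induct)
  case (less n)
  consider "n = 0" | "n = 1" | m where "n = Suc (Suc m)"
    by (metis One_nat_def not0_implies_Suc)
  then show ?case
  proof cases
    case (3 m)
    define z where "z = (- p) ^ m"
    have absorb: "real (Suc k) * real (J choose Suc k) = (real J - real k) * real (J choose k)" for k
      by (metis binomial_absorb_comp binomial_eq_0_iff diff_is_0_eq linorder_not_le mult_eq_0_iff
          of_nat_0 of_nat_diff of_nat_mult order.strict_implies_order binomial_absorption Suc_times_binomial_eq)
    have "real (Suc (Suc m)) * krawtchouk J p n 0 =
       - (real (Suc m) + real J * p - 2 * real (Suc m) * p) * krawtchouk J p (Suc m) 0
      - p * (1 - p) * (real J - real m) * krawtchouk J p m 0"
      unfolding 3 krawtchouk.simps by (simp add: add_pos_pos less_imp_neq[symmetric])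
    also have "\<dots> = real (Suc (Suc m)) * ((- p) ^ n * real (J choose n))"
      using absorb[of m] absorb[of "Suc m"] unfolding 3 less[of m, unfolded 3, simplified]
        less[of "Suc m", unfolded 3, simplified]
      by (simp flip: z_def) algebra
    finally show ?thesis by simp
  qed auto
qed

text \<open>This closes the recurrence at the last index $J$ of the dual state space.\<close>

lemma krawtchouk_vanishes:
  assumes p: "0 < p" "p < 1" and "x \<le> J"
  shows "krawtchouk J p (Suc J) (real x) = 0"
  using \<open>x \<le> J\<close>
proof (induction x)
  case 0
  then show ?case by (simp add: krawtchouk_at_0 del: krawtchouk.simps)
next
  case (Suc x)
  interpret meixner_class "-1" "real J" 1 p "\<lambda>n. real n + 1"
    "\<lambda>n. if n = 0 then 0 else real J - real n + 1" "krawtchouk J p"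
    using p by (rule krawtchouk_class)
  have zero: "krawtchouk J p (Suc J) (real x) = 0" using Suc by simp
  \<comment> \<open>\<beta> (J + 1) = 0 decouples the index J + 1 from J. The recurrence then makes
    the polynomial of index J + 2 vanish at x, and \<open>shift_up\<close> expresses the left-hand
    side by the polynomials of index J + 1 and J + 2 at x alone.\<close>
  then have "(real J - real x) * krawtchouk J p (Suc J) (real (Suc x)) = 0"
    using recurrence[of "real x" "Suc J"] shift_up[of "real x" "Suc J"]
    by (simp add: add.commute del: krawtchouk.simps)
  with Suc.prems show ?case by simp
qed

lemma self_dual_sep:
  assumes G: "pair_graph G" "pverts G = I" and p: "0 < p" "p < 1"
  shows "self_dual (sep_gen J G) (I \<rightarrow>\<^sub>E {0..J})
    (\<lambda>x n. \<Prod>i\<in>I. krawtchouk J p (n i) (real (x i)) / real (J choose n i))"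
proof -
  interpret meixner_class "-1" "real J" 1 p "\<lambda>n. real n + 1"
    "\<lambda>n. if n = 0 then 0 else real J - real n + 1" "krawtchouk J p"
    using p by (rule krawtchouk_class)
  have absorb: "real (Suc n) * real (J choose Suc n) = real (J - n) * real (J choose n)" for n
    unfolding of_nat_mult[symmetric] by (metis Suc_times_binomial_eq binomial_absorb_comp binomial_absorption)
  show ?thesis unfolding sep_gen_eq_hop_gen
  proof (rule self_dual_normalized[OF G])
    fix n x assume "n \<in> {0..J}" "x \<in> {0..J}"
    then show "(real n + 1) * krawtchouk J p (Suc n) (real x) / real (J choose n)
      = (real J + - 1 * real n) * (krawtchouk J p (Suc n) (real x) / real (J choose Suc n))"
      using arg_cong[OF absorb[of n], of "\<lambda>z. z * krawtchouk J p (Suc n) (real x)"]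
        krawtchouk_vanishes[OF p, of x J]
      by (cases "n = J") (auto simp: divide_simps of_nat_diff algebra_simps simp del: krawtchouk.simps)
  next
    fix n assume "n \<in> {0..J}"
    then show "(if n = 0 then 0 else real J - real n + 1) / real (J choose n) = real n / real (J choose (n - 1))"
      using absorb[of "n - 1"]
      by (cases n) (auto simp: divide_simps of_nat_diff algebra_simps)
  qed auto
qed

lemma self_dual_sip:
  assumes G: "pair_graph G" "pverts G = I" and k: "0 < k" and p: "0 < p" "p < 1"
  shows "self_dual (sip_gen k G) (I \<rightarrow>\<^sub>E UNIV)
    (\<lambda>x n. \<Prod>i\<in>I. Gamma (2 * k) / Gamma (2 * k + real (n i)) * meixner (2 * k) p (n i) (real (x i)))"
proof -
  have pos: "Gamma (2 * k) > 0" "Gamma (2 * k + real n) > 0" for n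
    using k by (auto intro!: Gamma_real_pos)
  have Gamma_Suc: "Gamma (2 * k + real (Suc n)) = (2 * k + real n) * Gamma (2 * k + real n)" for n
    using Gamma_plus1[of "2 * k + real n"] k
    by (force simp: add_ac nonpos_Ints_def)
  \<comment> \<open>Here u = - w and 1 + w = 1 / (1 - p), so the prefactor w (1 + w) / u of the
    lowering term collapses to 1 / (p - 1).\<close>
  interpret meixner_class 1 "2 * k" "p / (p - 1)" "p / (1 - p)" "\<lambda>n. 1"
    "\<lambda>n. real n * (real n - 1 + 2 * k)" "meixner (2 * k) p"
  proof
    fix n x
    define y where "y = 1 - p"
    have y: "p - 1 = - y" "p = 1 - y" "y \<noteq> 0" "1 - y \<noteq> 0" using p by (auto simp: y_def)
    have "(1 + 2 * 1 * (p / (1 - p))) * real n + p / (1 - p) * (2 * k) = (real n + p * real n + 2 * k * p) / (1 - p)"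
      unfolding y_def[symmetric] using y(3) by (simp add: y(2) field_simps)
    moreover have "1 + 1 * (p / (1 - p)) = 1 / (1 - p)" using p by (simp add: field_simps)
    then have "p / (1 - p) * (1 + 1 * (p / (1 - p))) / (p / (p - 1)) * (real n * (real n - 1 + 2 * k))
        = real n * (real n - 1 + 2 * k) / (p - 1)"
      unfolding y_def[symmetric] y(1) using y(3,4) p by simp
    ultimately show "x * meixner (2 * k) p n x = p / (p - 1) * 1 * meixner (2 * k) p (Suc n) x
      + ((1 + 2 * 1 * (p / (1 - p))) * real n + p / (1 - p) * (2 * k)) * meixner (2 * k) p n x
      + p / (1 - p) * (1 + 1 * (p / (1 - p))) / (p / (p - 1)) * (real n * (real n - 1 + 2 * k)) * meixner (2 * k) p (n - 1) x"
      using meixner_recurrence[OF p, of x "2 * k" n]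
      by (cases n) (simp_all del: meixner.simps)
  qed (use p in \<open>auto simp: algebra_simps\<close>)
  have eq: "Gamma (2 * k) / Gamma (2 * k + real n) * z = z / (Gamma (2 * k + real n) / Gamma (2 * k))" for n z
    by simp
  show ?thesis unfolding sip_gen_eq_hop_gen eq
  proof (rule self_dual_normalized[OF G])
    fix n x :: nat
    show "Gamma (2 * k + real n) / Gamma (2 * k) \<noteq> 0" using pos(2)[of n] pos(1) by simp
    show "1 * meixner (2 * k) p (Suc n) (real x) / (Gamma (2 * k + real n) / Gamma (2 * k)) =
      (2 * k + 1 * real n) * (meixner (2 * k) p (Suc n) (real x) / (Gamma (2 * k + real (Suc n)) / Gamma (2 * k)))"
      unfolding Gamma_Suc using pos(2)[of n] pos(1) k
      by (simp add: add_pos_nonneg less_imp_neq[symmetric] del: meixner.simps)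
    show "real n * (real n - 1 + 2 * k) / (Gamma (2 * k + real n) / Gamma (2 * k))
      = real n / (Gamma (2 * k + real (n - 1)) / Gamma (2 * k))"
    proof (cases n)
      case (Suc m)
      have "2 * k + real m > 0" using k by simp
      then show ?thesis unfolding Suc Gamma_Suc using pos(2)[of m] pos(1) by (simp add: divide_simps)
    qed simp
  qed
qed

lemma self_dual_irw:
  assumes G: "pair_graph G" "pverts G = I" and c: "0 < c"
  shows "self_dual (irw_gen G) (I \<rightarrow>\<^sub>E UNIV) (\<lambda>x n. \<Prod>i\<in>I. charlier c (n i) (real (x i)))"
proof -
  interpret meixner_class 0 1 "- c" c "\<lambda>n. 1" real "charlier c"
  proof
    fix n x
    show "x * charlier c n x = - c * 1 * charlier c (Suc n) x +
      ((1 + 2 * 0 * c) * real n + c * 1) * charlier c n x +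
      c * (1 + 0 * c) / - c * real n * charlier c (n - 1) x"
      using charlier_recurrence[OF c, of x n] c
      by (cases n) (simp_all add: algebra_simps del: charlier.simps)
  qed (use c in auto)
  show ?thesis unfolding irw_gen_eq_hop_gen
    using self_dual_normalized[OF G, where S = UNIV and c = "\<lambda>_. 1"] by simp
qed

section \<open>Duality of the diffusions with the inclusion process\<close>

lemma pd_eqI:
  assumes "((\<lambda>t. f (x(i := t))) has_real_derivative D) (at (x i) within S)"
    and "at (x i) within S \<noteq> bot"
  shows "pd S i f x = D"
  unfolding pd_def using assms
  by (auto intro!: vector_derivative_within simp: has_real_derivative_iff_has_vector_derivative)

lemma at_within_nonneg_neq_bot: "\<forall>x\<in>{0..}. at (x::real) within {0..} \<noteq> bot"
proof
  fix x :: real assume x: "x \<in> {0..}"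
  have "x islimpt {x<..<x + 1}" by (rule islimpt_greaterThanLessThan1) simp
  then have "x islimpt {0..}" by (rule islimpt_subset) (use x in auto)
  then show "at x within {0..} \<noteq> bot" by (simp add: trivial_limit_within)
qed

text \<open>F has to agree with G only for r in S. Hence F may itself be a derivative that is known
  on the state space only, which is what allows an edge operator to be applied twice.\<close>

lemma pd_prod_fst:
  assumes "i \<noteq> l" and "at s within S \<noteq> bot" "s \<in> S"
    and F: "\<And>r. r \<in> S \<Longrightarrow> F (x(i := r, l := t)) = G r"
    and G: "(G has_real_derivative D) (at s within S)"
  shows "pd S i F (x(i := s, l := t)) = D"
proof (rule pd_eqI)
  have upd: "x(i := s, l := t, i := r) = x(i := r, l := t)" for r
    using \<open>i \<noteq> l\<close> by (auto simp: fun_eq_iff)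
  show "((\<lambda>r. F (x(i := s, l := t, i := r))) has_real_derivative D) (at ((x(i := s, l := t)) i) within S)"
    unfolding upd using assms
    by (auto intro!: has_field_derivative_transform_within[OF G zero_less_one])
qed (use assms in auto)

lemma pd_prod_snd:
  assumes "i \<noteq> l" and "at t within S \<noteq> bot" "t \<in> S"
    and F: "\<And>r. r \<in> S \<Longrightarrow> F (x(i := s, l := r)) = G r"
    and G: "(G has_real_derivative D) (at t within S)"
  shows "pd S l F (x(i := s, l := t)) = D"
  using pd_prod_fst[of l i t S F x s G D] assms
  by (simp add: fun_upd_twist)

text \<open>The duality functions are products over the sites: g and h stand for the factors at the
  two ends of an edge, R for the rest. Two derivatives of each factor are carried because the edge
  operators are squares.\<close>

context
  fixes i l :: nat and x :: "nat \<Rightarrow> real" and F g g' g'' h h' h'' R S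
  assumes il: "i \<noteq> l"
    and S: "\<forall>s\<in>S. at s within S \<noteq> bot" "x i \<in> S" "x l \<in> S"
    and F: "\<And>s t. s \<in> S \<Longrightarrow> t \<in> S \<Longrightarrow> F (x(i := s, l := t)) = g s * h t * R"
    and g: "\<And>s. (g has_real_derivative g' s) (at s)"
      "\<And>s. (g' has_real_derivative g'' s) (at s)"
    and h: "\<And>t. (h has_real_derivative h' t) (at t)"
      "\<And>t. (h' has_real_derivative h'' t) (at t)"
begin

private lemma g_within: "(g has_real_derivative g' s) (at s within S)"
  "(g' has_real_derivative g'' s) (at s within S)"
  and h_within: "(h has_real_derivative h' s) (at s within S)"
  "(h' has_real_derivative h'' s) (at s within S)"
  by (rule g h DERIV_subset subset_UNIV)+

private lemma x_eq: "x(i := x i, l := x l) = x"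
  by simp

private lemma pd_eqs:
  assumes "s \<in> S" "t \<in> S"
  shows "pd S i F (x(i := s, l := t)) = g' s * h t * R"
    and "pd S l F (x(i := s, l := t)) = g s * h' t * R"
proof -
  show "pd S i F (x(i := s, l := t)) = g' s * h t * R"
    by (rule pd_prod_fst[where G = "\<lambda>r. g r * h t * R"])
       (use assms il in \<open>auto intro!: derivative_eq_intros g_within h_within F simp: S(1)[rule_format]\<close>)
  show "pd S l F (x(i := s, l := t)) = g s * h' t * R"
    by (rule pd_prod_snd[where G = "\<lambda>r. g s * h r * R"])
       (use assms il in \<open>auto intro!: derivative_eq_intros g_within h_within F simp: S(1)[rule_format]\<close>)
qed

lemma pd_diff_pd_diff_prod:
  assumes "S = {0..}"
  shows "pd_diff i l F x = (g' (x i) * h (x l) - g (x i) * h' (x l)) * R"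
    and "pd_diff i l (pd_diff i l F) x =
      (g'' (x i) * h (x l) - 2 * g' (x i) * h' (x l) + g (x i) * h'' (x l)) * R"
proof -
  have D: "pd_diff i l F (x(i := s, l := t)) = (g' s * h t - g s * h' t) * R" if "s \<in> S" "t \<in> S" for s t
    unfolding pd_diff_def assms[symmetric] pd_eqs[OF that] by (simp add: algebra_simps)
  show "pd_diff i l F x = (g' (x i) * h (x l) - g (x i) * h' (x l)) * R"
    using D[OF S(2,3)] by simp
  have "pd S i (pd_diff i l F) (x(i := x i, l := x l)) = (g'' (x i) * h (x l) - g' (x i) * h' (x l)) * R"
    by (rule pd_prod_fst[where G = "\<lambda>r. (g' r * h (x l) - g r * h' (x l)) * R"])
       (use il in \<open>auto intro!: derivative_eq_intros g_within h_within simp: S D D[OF S(2), simplified] algebra_simps\<close>)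
  moreover have "pd S l (pd_diff i l F) (x(i := x i, l := x l)) = (g' (x i) * h' (x l) - g (x i) * h'' (x l)) * R"
    by (rule pd_prod_snd[where G = "\<lambda>r. (g' (x i) * h r - g (x i) * h' r) * R"])
       (use il in \<open>auto intro!: derivative_eq_intros g_within h_within simp: S D D[OF S(2), simplified] algebra_simps\<close>)
  ultimately show "pd_diff i l (pd_diff i l F) x =
      (g'' (x i) * h (x l) - 2 * g' (x i) * h' (x l) + g (x i) * h'' (x l)) * R"
    unfolding pd_diff_def[of i l "pd_diff i l F"] assms[symmetric] x_eq by (simp add: algebra_simps)
qed

lemma rotation_rotation_prod:
  assumes "S = UNIV"
  shows "rotation i l (rotation i l F) x =
      ((x i)\<^sup>2 * g (x i) * h'' (x l) + (x l)\<^sup>2 * g'' (x i) * h (x l) - 2 * x i * x l * g' (x i) * h' (x l)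
       - x i * g' (x i) * h (x l) - x l * g (x i) * h' (x l)) * R"
proof -
  have D: "rotation i l F (x(i := s, l := t)) = (s * g s * h' t - t * g' s * h t) * R" if "s \<in> S" "t \<in> S" for s t
    unfolding rotation_def assms[symmetric] pd_eqs[OF that] using il by (simp add: algebra_simps)
  have "pd S i (rotation i l F) (x(i := x i, l := x l))
      = (g (x i) * h' (x l) + x i * g' (x i) * h' (x l) - x l * g'' (x i) * h (x l)) * R"
    by (rule pd_prod_fst[where G = "\<lambda>r. (r * g r * h' (x l) - x l * g' r * h (x l)) * R"])
       (use il in \<open>auto intro!: derivative_eq_intros g_within h_within simp: S D D[OF S(2), simplified] algebra_simps\<close>)
  moreover have "pd S l (rotation i l F) (x(i := x i, l := x l))
      = (x i * g (x i) * h'' (x l) - g' (x i) * h (x l) - x l * g' (x i) * h' (x l)) * R"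
    by (rule pd_prod_snd[where G = "\<lambda>r. (x i * g (x i) * h' r - r * g' (x i) * h r) * R"])
       (use il in \<open>auto intro!: derivative_eq_intros g_within h_within simp: S D D[OF S(2), simplified] algebra_simps\<close>)
  ultimately show ?thesis
    unfolding rotation_def[of i l "rotation i l F"] assms[symmetric] x_eq
    by algebra
qed

end

text \<open>In the generating function (1 - t)^(-a) exp (- x t / (1 - t)), lowering a by 1 is
  multiplication by 1 - t. The induction eliminates with two consecutive recurrences for a + 1; n =
  2 is a base case because the identity at n - 2 = 0 has no second term.\<close>

lemma laguerre_shift:
  "laguerre a n x = laguerre (a + 1) n x - (if n = 0 then 0 else laguerre (a + 1) (n - 1) x)"
proof (induction n rule: less_induct)
  case (less n)
  consider "n = 0" | "n = 1" | "n = 2" | m where "n = Suc (Suc (Suc m))"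
    by (metis One_nat_def Suc_1 not0_implies_Suc)
  then show ?case
  proof cases
    case 3
    then show ?thesis by (simp add: numeral_2_eq_2 field_simps)
  next
    case (4 m)
    have rec: "(real n + 2) * laguerre a (Suc (Suc n)) x = (2 * real (Suc n) + a - x) * laguerre a (Suc n) x
      - (real (Suc n) + a - 1) * laguerre a n x" for a n
      using laguerre_recurrence[of x a "Suc n"] by (simp add: algebra_simps del: laguerre.simps)
    have IH: "laguerre a (Suc (Suc m)) x = laguerre (a + 1) (Suc (Suc m)) x - laguerre (a + 1) (Suc m) x"
      "laguerre a (Suc m) x = laguerre (a + 1) (Suc m) x - laguerre (a + 1) m x"
      using less[of "Suc (Suc m)"] less[of "Suc m"] 4 by auto
    have "(real m + 3) * (laguerre a n x - (laguerre (a + 1) n x - laguerre (a + 1) (n - 1) x)) = 0"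
      using IH rec[where n = "Suc m" and a = a]
        rec[where n = "Suc m" and a = "a + 1"] rec[where n = m and a = "a + 1"]
      unfolding 4 diff_Suc_1 of_nat_Suc if_False nat.simps by algebra
    then show ?thesis using 4 by (simp add: add_pos_pos less_imp_neq[symmetric] del: laguerre.simps)
  qed auto
qed

text \<open>This is the recurrence for a + 1 rewritten by \<open>laguerre_shift\<close>. It leads
  from the parameter a + 1, which differentiation produces, back to a.\<close>

lemma laguerre_times_x:
  "x * laguerre (a + 1) n x = (real n + a) * laguerre a n x - (real n + 1) * laguerre a (Suc n) x"
  using laguerre_recurrence[of x "a + 1" n]
  unfolding laguerre_shift[of a n x] laguerre_shift[of a "Suc n" x]
  by (cases n) (simp_all add: algebra_simps del: laguerre.simps(3))

text \<open>Differentiating the factor x of the recurrence leaves an undifferentiated polynomial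
  with parameter a; \<open>laguerre_shift\<close> rewrites it with parameter a + 1, and the
  recurrence for a + 1 finishes.\<close>

lemma has_derivative_laguerre:
  "(laguerre a n has_real_derivative - (if n = 0 then 0 else laguerre (a + 1) (n - 1) x)) (at x)"
proof (induction n rule: less_induct)
  case (less n)
  consider "n = 0" | "n = 1" | m where "n = Suc (Suc m)"
    by (metis One_nat_def not0_implies_Suc)
  then show ?case
  proof cases
    case 1
    then show ?thesis by simp
  next
    case 2
    then show ?thesis by (auto intro!: derivative_eq_intros)
  next
    case (3 m)
    define D where "D j = - (if j = 0 then 0 else laguerre (a + 1) (j - 1) x)" for j
    have IH: "(laguerre a (Suc m) has_real_derivative D (Suc m)) (at x)"
      "(laguerre a m has_real_derivative D m) (at x)"
      using less[of "Suc m"] less[of m] 3 by (auto simp: D_def)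
    have "(laguerre a n has_real_derivative
      (- laguerre a (Suc m) x + (2 * real (Suc m) + a - x) * D (Suc m)
        - (real (Suc m) + a - 1) * D m) / (real (Suc m) + 1)) (at x)"
      unfolding 3 laguerre.simps
      by (rule derivative_eq_intros IH refl | simp add: add_pos_pos less_imp_neq[symmetric])+
    moreover have "- laguerre a (Suc m) x + (2 * real (Suc m) + a - x) * D (Suc m)
        - (real (Suc m) + a - 1) * D m = (real (Suc m) + 1) * (- laguerre (a + 1) (Suc m) x)"
      using laguerre_shift[of a "Suc m" x] laguerre_recurrence[of x "a + 1" m]
      by (cases m) (simp_all add: D_def algebra_simps del: laguerre.simps(3))
    ultimately show ?thesis
      by (simp add: 3 add_pos_pos less_imp_neq[symmetric] del: laguerre.simps)
  qed
qed

section \<open>The Laguerre normalisation and the Brownian energy process\<close>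

lemma multichoose_0 [simp]: "0 < a \<Longrightarrow> multichoose a 0 = 1"
  using less_imp_neq[OF Gamma_real_pos, of a] by (simp add: multichoose_def)

lemma multichoose_pos: "0 < a \<Longrightarrow> 0 < multichoose a n"
  by (auto simp: multichoose_def intro!: divide_pos_pos mult_pos_pos Gamma_real_pos)

lemma multichoose_Suc:
  assumes "0 < a"
  shows "real (Suc n) * multichoose a (Suc n) = (a + real n) * multichoose a n"
proof -
  have "Gamma (a + real (Suc n)) = (a + real n) * Gamma (a + real n)"
    using Gamma_plus1[of "a + real n"] assms by (force simp: add_ac nonpos_Ints_def)
  then show ?thesis using Gamma_real_pos[OF assms] by (simp add: multichoose_def)
qed

lemma fact_Gamma_eq_multichoose: "fact n * Gamma a / Gamma (a + real n) * z = z / multichoose a n"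
  by (simp add: multichoose_def)

text \<open>With a = 2k, the edge operator is a bilinear form in the one-site operators x, x d/dx
  and x d^2/dx^2 + a d/dx. On the normalised polynomials the last is minus lowering
  (\<open>xd''\<close>), the second is the index minus lowering (\<open>xd'\<close>), and the first
  is the recurrence (\<open>xd\<close>). The terms that lower both indices cancel.\<close>

lemma dual_bep:
  assumes G: "pair_graph G" "pverts G = I" and k: "0 < k"
  shows "dual (bep_gen k G) (I \<rightarrow>\<^sub>E {0..}) (sip_gen k G) (I \<rightarrow>\<^sub>E UNIV)
    (\<lambda>x n. \<Prod>i\<in>I. fact (n i) * Gamma (2 * k) / Gamma (2 * k + real (n i)) * laguerre (2 * k) (n i) (x i))"
  unfolding dual_def fact_Gamma_eq_multichoose bep_gen_def sip_gen_def
proof (intro ballI sum.cong refl, clarify)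
  fix x :: "nat \<Rightarrow> real" and n i l
  assume x: "x \<in> I \<rightarrow>\<^sub>E {0..}" and e: "(i, l) \<in> edges G"
  interpret pair_graph G by fact
  define a where "a = 2 * k"
  define c where "c = multichoose a"
  define d where "d m y = laguerre a m y / c m" for m y
  define d' where "d' m y = - (if m = 0 then 0 else laguerre (a + 1) (m - 1) y) / c m" for m y
  define d'' where "d'' m y = (if m \<le> 1 then 0 else laguerre (a + 2) (m - 2) y) / c m" for m y
  have a: "a > 0" using k by (simp add: a_def)
  have c: "c m > 0" for m using a by (simp add: c_def multichoose_pos)
  have c0: "c m \<noteq> 0" for m using c[of m] by simp
  have d': "(d m has_real_derivative d' m y) (at y)" for m y
    unfolding d_def[abs_def] d'_def by (auto intro!: derivative_eq_intros has_derivative_laguerre simp: c0)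
  have d'': "(d' m has_real_derivative d'' m y) (at y)" for m y
    unfolding d'_def[abs_def] d''_def
    by (cases m) (auto intro!: derivative_eq_intros has_derivative_laguerre simp: c0 numeral_2_eq_2 add.assoc)
  have c_Suc: "real (Suc m) * c (Suc m) = (a + real m) * c m" for m
    unfolding c_def by (rule multichoose_Suc[OF a])
  have up: "(real m + 1) * laguerre a (Suc m) y / c m = (a + real m) * d (m + 1) y" for m y
    using arg_cong[OF c_Suc, of "\<lambda>z. z * laguerre a (Suc m) y" m]
    by (simp add: d_def c0 field_simps del: laguerre.simps)
  have down: "(real m + a - 1) * (if m = 0 then 0 else laguerre a (m - 1) y) / c m = real m * d (m - 1) y" for m y
    using arg_cong[OF c_Suc, of "\<lambda>z. z * laguerre a (m - 1) y" "m - 1"]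
    by (cases m) (simp_all add: d_def c0 field_simps del: laguerre.simps(3))
  have xd: "y * d m y = - ((a + real m) * d (m + 1) y) + (2 * real m + a) * d m y - real m * d (m - 1) y" for m y
    using arg_cong[OF laguerre_recurrence[of y a m], of "\<lambda>z. z / c m"]
    unfolding up[symmetric] down[symmetric]
    by (simp add: d_def add_divide_distrib diff_divide_distrib algebra_simps del: laguerre.simps)
  have lag': "y * (if m = 0 then 0 else laguerre (a + 1) (m - 1) y)
      = (real m + a - 1) * (if m = 0 then 0 else laguerre a (m - 1) y) - real m * laguerre a m y" for m y
    using laguerre_times_x[of y a "m - 1"] by (cases m) (simp_all add: algebra_simps del: laguerre.simps)
  have xd': "y * d' m y = real m * d m y - real m * d (m - 1) y" for m y
    using arg_cong[OF lag'[of y m], of "\<lambda>z. - z / c m"]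
    unfolding down[symmetric] unfolding d'_def d_def
    by (simp only: minus_diff_eq diff_divide_distrib times_divide_eq_right mult_minus_right minus_divide_left)
  have xd'': "y * d'' m y + a * d' m y = - (real m * d (m - 1) y)" for m y
  proof (cases m)
    case 0
    then show ?thesis by (simp add: d''_def d'_def)
  next
    case (Suc j)
    \<comment> \<open>\<open>laguerre_times_x\<close> for a + 1 leaves (j + a) times the difference
      of two consecutive polynomials with parameter a + 1, which \<open>laguerre_shift\<close> folds
      into one with parameter a.\<close>
    have "y * (if j = 0 then 0 else laguerre (a + 2) (j - 1) y) - a * laguerre (a + 1) j y
      = - ((real j + a) * laguerre a j y)"
      using laguerre_times_x[of y "a + 1" "j - 1"] unfolding laguerre_shift[of a j y]
      by (cases j) (simp_all add: algebra_simps del: laguerre.simps(3))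
    from arg_cong[OF this, of "\<lambda>z. z / c m"] show ?thesis
      unfolding down[symmetric] d'_def d''_def Suc
      by (cases j) (simp_all add: diff_divide_distrib numeral_2_eq_2 add_ac del: laguerre.simps(3))
  qed
  have I: "finite I" using G(2) by auto
  have il: "i \<in> I" "l \<in> I" "i \<noteq> l" using edges_subset[OF G e] by auto
  have li: "l \<noteq> i" using il by simp
  have comm: "I - {l, i} = I - {i, l}" by auto
  have pos: "x i \<in> {0..}" "x l \<in> {0..}" using x il by (auto simp: PiE_def Pi_def)
  define R where "R = (\<Prod>j\<in>I - {i, l}. d (n j) (x j))"
  note hn = hop_prod[OF I il, where F = "\<lambda>j m. d m (x j)" and x = n, folded R_def]
    hop_prod[OF I il(2,1) li, where F = "\<lambda>j m. d m (x j)" and x = n, unfolded comm, folded R_def]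
  note h0 = prod_remove_two[OF I il, of "\<lambda>j. d (n j) (x j)", folded R_def]
  have F: "(\<Prod>j\<in>I. d (n j) ((x(i := s, l := t)) j)) = d (n i) s * d (n l) t * R" for s t
    unfolding prod_remove_two[OF I il] R_def using il(3) by (auto intro!: prod.cong)
  note D = pd_diff_pd_diff_prod[OF il(3) at_within_nonneg_neq_bot pos, where g = "d (n i)" and h = "d (n l)"
     and F = "\<lambda>y. \<Prod>j\<in>I. d (n j) (y j)", OF F d' d'' d' d'' refl]
  have "x i * x l * pd_diff i l (pd_diff i l (\<lambda>y. \<Prod>j\<in>I. d (n j) (y j))) x
     - a * (x i - x l) * pd_diff i l (\<lambda>y. \<Prod>j\<in>I. d (n j) (y j)) x =
     ((x i * d'' (n i) (x i) + a * d' (n i) (x i)) * (x l * d (n l) (x l))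
      + (x i * d (n i) (x i)) * (x l * d'' (n l) (x l) + a * d' (n l) (x l))
      - 2 * (x i * d' (n i) (x i)) * (x l * d' (n l) (x l))
      - a * (x i * d' (n i) (x i)) * d (n l) (x l) - a * d (n i) (x i) * (x l * d' (n l) (x l))) * R"
    unfolding D by (simp add: algebra_simps)
  also have "\<dots> =
     real (n i) * (a + real (n l)) * ((\<Prod>j\<in>I. d (hop i l n j) (x j)) - (\<Prod>j\<in>I. d (n j) (x j))) +
     real (n l) * (a + real (n i)) * ((\<Prod>j\<in>I. d (hop l i n j) (x j)) - (\<Prod>j\<in>I. d (n j) (x j)))"
    unfolding hn h0 xd xd' xd'' by (simp add: algebra_simps)
  finally show "x i * x l * pd_diff i l (pd_diff i l (\<lambda>y. \<Prod>j\<in>I. laguerre (2 * k) (n j) (y j) / multichoose (2 * k) (n j))) x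
     - 2 * k * (x i - x l) * pd_diff i l (\<lambda>y. \<Prod>j\<in>I. laguerre (2 * k) (n j) (y j) / multichoose (2 * k) (n j)) x =
     real (n i) * (2 * k + real (n l)) * ((\<Prod>j\<in>I. laguerre (2 * k) (hop i l n j) (x j) / multichoose (2 * k) (hop i l n j))
       - (\<Prod>j\<in>I. laguerre (2 * k) (n j) (x j) / multichoose (2 * k) (n j))) +
     real (n l) * (2 * k + real (n i)) * ((\<Prod>j\<in>I. laguerre (2 * k) (hop l i n j) (x j) / multichoose (2 * k) (hop l i n j))
       - (\<Prod>j\<in>I. laguerre (2 * k) (n j) (x j) / multichoose (2 * k) (n j)))"
    unfolding d_def a_def c_def .
qed

section \<open>Hermite polynomials and the Brownian momentum process\<close>

lemma has_derivative_hermite: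
  "(hermite n has_real_derivative 2 * real n * hermite (n - 1) x) (at x)"
proof (induction n rule: less_induct)
  case (less n)
  consider "n = 0" | "n = 1" | m where "n = Suc (Suc m)"
    by (metis One_nat_def not0_implies_Suc)
  then show ?case
  proof cases
    case (3 m)
    have IH: "(hermite (Suc m) has_real_derivative 2 * real (Suc m) * hermite m x) (at x)"
      "(hermite m has_real_derivative 2 * real m * hermite (m - 1) x) (at x)"
      using less[of "Suc m"] less[of m] 3 by auto
    show ?thesis
      unfolding 3 hermite.simps
      by (rule derivative_eq_intros IH refl)+
        (use hermite_recurrence[of m x] in \<open>cases m; simp add: algebra_simps\<close>)
  qed (auto intro!: derivative_eq_intros)
qed

lemma odd_double_fact_pos: "odd_double_fact n > 0"
  unfolding odd_double_fact_def by (rule prod_pos) auto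

lemma odd_double_fact_Suc: "odd_double_fact (Suc n) = (2 * real n + 1) * odd_double_fact n"
  by (simp add: odd_double_fact_def)

text \<open>The squared rotation is a bilinear form in x^2, x d/dx and d^2/dx^2. All three preserve
  parity, so even Hermite polynomials suffice. On them x^2 raises with coefficient (1/2 + n) / 2 and
  the second derivative lowers with 8 n: the product 8 / 2 is the factor 4, and 1/2 = 2k gives k =
  1/4.\<close>

lemma dual_bmp:
  assumes G: "pair_graph G" "pverts G = I"
  shows "dual (bmp_gen G) (I \<rightarrow>\<^sub>E UNIV) (\<lambda>f n. 4 * sip_gen (1 / 4) G f n) (I \<rightarrow>\<^sub>E UNIV)
    (\<lambda>x n. \<Prod>i\<in>I. 1 / odd_double_fact (n i) * hermite (2 * n i) (x i))"
  unfolding dual_def bmp_gen_def sip_gen_def sum_distrib_left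
proof (intro ballI sum.cong refl, clarify)
  fix x :: "nat \<Rightarrow> real" and n i l
  assume e: "(i, l) \<in> edges G"
  interpret pair_graph G by fact
  define d where "d m y = 1 / odd_double_fact m * hermite (2 * m) y" for m y
  define d' where "d' m y = 4 * real m * hermite (2 * m - 1) y / odd_double_fact m" for m y
  \<comment> \<open>The second derivative of H_(2m) is 8 m (2m - 1) H_(2m-2), and the factor 2m - 1
    is absorbed by (2m - 1)!! = (2m - 1) (2m - 3)!!.\<close>
  define d'' where "d'' m y = 8 * (real m * d (m - 1) y)" for m y
  have c0: "odd_double_fact m \<noteq> 0" for m using odd_double_fact_pos[of m] by simp
  have down: "real m * d (m - 1) y = real m * (2 * real m - 1) * hermite (2 * m - 2) y / odd_double_fact m" for m y
  proof (cases m)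
    case (Suc j)
    have "2 * real j + 1 \<noteq> 0" using of_nat_0_le_iff[of j, where 'a = real] by linarith
    moreover have "2 * real m - 1 = 2 * real j + 1" by (simp add: Suc)
    ultimately show ?thesis
      by (simp only: d_def Suc odd_double_fact_Suc diff_Suc_1 mult_Suc_right diff_add_inverse) simp
  qed simp
  have d': "(d m has_real_derivative d' m y) (at y)" for m y
    unfolding d_def[abs_def] d'_def
    by (auto intro!: derivative_eq_intros has_derivative_hermite simp: c0)
  have d'': "(d' m has_real_derivative d'' m y) (at y)" for m y
  proof (cases m)
    case 0
    then show ?thesis by (simp add: d'_def[abs_def] d''_def)
  next
    case (Suc j)
    have "(d' m has_real_derivative 4 * real m * (2 * real (2 * m - 1) * hermite (2 * m - 1 - 1) y) / odd_double_fact m) (at y)"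
      unfolding d'_def[abs_def]
      by (rule derivative_eq_intros has_derivative_hermite refl | simp add: c0)+
    also have "4 * real m * (2 * real (2 * m - 1) * hermite (2 * m - 1 - 1) y) / odd_double_fact m = d'' m y"
      unfolding d''_def down by (simp add: Suc algebra_simps)
    finally show ?thesis .
  qed
  have rec: "2 * y * hermite j y = hermite (Suc j) y + 2 * real j * hermite (j - 1) y" for j y
    using hermite_recurrence[of j y] by (cases j) simp_all
  have xd': "y * d' m y = 2 * real m * d m y + 4 * (real m * d (m - 1) y)" for m y
    unfolding down unfolding d'_def d_def
    using arg_cong[OF rec[of y "2 * m - 1"], of "\<lambda>z. 2 * real m * z / odd_double_fact m"] c0[of m]
    by (cases m) (simp_all add: field_simps del: hermite.simps)
  have xxd: "y\<^sup>2 * d m y = (1 / 2 + real m) * d (m + 1) y / 2 + (2 * real m + 1 / 2) * d m y + 2 * (real m * d (m - 1) y)" for m y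
  proof -
    have "2 * real m + 1 \<noteq> 0" using of_nat_0_le_iff[of m, where 'a = real] by linarith
    then have up: "(1 / 2 + real m) * d (m + 1) y / 2 = hermite (Suc (Suc (2 * m))) y / (4 * odd_double_fact m)"
      using c0[of m] by (simp add: d_def odd_double_fact_Suc divide_simps del: hermite.simps)
    have "4 * y\<^sup>2 * hermite (2 * m) y = hermite (Suc (Suc (2 * m))) y + (8 * real m + 2) * hermite (2 * m) y
        + 8 * real m * (2 * real m - 1) * hermite (2 * m - 2) y"
    proof (cases m)
      case 0
      then show ?thesis by (simp add: power2_eq_square)
    next
      case (Suc j)
      show ?thesis
        unfolding Suc using rec[of y "2 * j + 2"] rec[of y "2 * j + 1"] rec[of y "2 * j + 3"]
        by (simp add: numeral_eq_Suc del: hermite.simps) algebra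
    qed
    then have "y\<^sup>2 * hermite (2 * m) y = hermite (Suc (Suc (2 * m))) y / 4 + (2 * real m + 1 / 2) * hermite (2 * m) y
        + 2 * (real m * (2 * real m - 1) * hermite (2 * m - 2) y)"
      by (simp add: algebra_simps del: hermite.simps)
    from arg_cong[OF this, of "\<lambda>z. z / odd_double_fact m"]
    show ?thesis unfolding up down unfolding d_def
      by (simp add: add_divide_distrib del: hermite.simps)
  qed
  have I: "finite I" using G(2) by auto
  have il: "i \<in> I" "l \<in> I" "i \<noteq> l" using edges_subset[OF G e] by auto
  have li: "l \<noteq> i" using il by simp
  have comm: "I - {l, i} = I - {i, l}" by auto
  define R where "R = (\<Prod>j\<in>I - {i, l}. d (n j) (x j))"
  note hn = hop_prod[OF I il, where F = "\<lambda>j m. d m (x j)" and x = n, folded R_def]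
    hop_prod[OF I il(2,1) li, where F = "\<lambda>j m. d m (x j)" and x = n, unfolded comm, folded R_def]
  note h0 = prod_remove_two[OF I il, of "\<lambda>j. d (n j) (x j)", folded R_def]
  have F: "(\<Prod>j\<in>I. d (n j) ((x(i := s, l := t)) j)) = d (n i) s * d (n l) t * R" for s t
    unfolding prod_remove_two[OF I il] R_def using il(3) by (auto intro!: prod.cong)
  have nb: "\<forall>s\<in>UNIV. at (s::real) within UNIV \<noteq> bot" by simp
  note D = rotation_rotation_prod[OF il(3) nb UNIV_I UNIV_I, where g = "d (n i)" and h = "d (n l)"
     and F = "\<lambda>y. \<Prod>j\<in>I. d (n j) (y j)", OF F d' d'' d' d'' refl]
  have "rotation i l (rotation i l (\<lambda>y. \<Prod>j\<in>I. d (n j) (y j))) x =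
     (((x i)\<^sup>2 * d (n i) (x i)) * d'' (n l) (x l) + d'' (n i) (x i) * ((x l)\<^sup>2 * d (n l) (x l))
      - 2 * (x i * d' (n i) (x i)) * (x l * d' (n l) (x l))
      - (x i * d' (n i) (x i)) * d (n l) (x l) - d (n i) (x i) * (x l * d' (n l) (x l))) * R"
    unfolding D by (simp add: algebra_simps)
  also have "\<dots> = 4 * (
     real (n i) * (2 * (1 / 4) + real (n l)) * ((\<Prod>j\<in>I. d (hop i l n j) (x j)) - (\<Prod>j\<in>I. d (n j) (x j))) +
     real (n l) * (2 * (1 / 4) + real (n i)) * ((\<Prod>j\<in>I. d (hop l i n j) (x j)) - (\<Prod>j\<in>I. d (n j) (x j))))"
    unfolding hn h0 xd' xxd d''_def by (simp add: field_simps)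
  finally show "rotation i l (rotation i l (\<lambda>y. \<Prod>j\<in>I. 1 / odd_double_fact (n j) * hermite (2 * n j) (y j))) x = 4 * (
     real (n i) * (2 * (1 / 4) + real (n l)) * ((\<Prod>j\<in>I. 1 / odd_double_fact (hop i l n j) * hermite (2 * hop i l n j) (x j))
        - (\<Prod>j\<in>I. 1 / odd_double_fact (n j) * hermite (2 * n j) (x j))) +
     real (n l) * (2 * (1 / 4) + real (n i)) * ((\<Prod>j\<in>I. 1 / odd_double_fact (hop l i n j) * hermite (2 * hop l i n j) (x j))
        - (\<Prod>j\<in>I. 1 / odd_double_fact (n j) * hermite (2 * n j) (x j))))"
    unfolding d_def .
qed

section \<open>Duality of KMP\<close>

text \<open>The recurrence, read coefficientwise, is (1 - t)^2 F' = (a - x - a t) F for the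
  generating function F. It is written without division so that it holds for formal power series
  term by term.\<close>

lemma laguerre_fps_ode:
  "fps_deriv (Abs_fps (\<lambda>n. laguerre a n x)) =
     2 * (fps_X * fps_deriv (Abs_fps (\<lambda>n. laguerre a n x)))
     - fps_X * (fps_X * fps_deriv (Abs_fps (\<lambda>n. laguerre a n x)))
     + (fps_const (a - x) - fps_const a * fps_X) * Abs_fps (\<lambda>n. laguerre a n x)"
proof (rule fps_ext)
  fix n
  have rec: "(real n + 1) * laguerre a (Suc n) x = (2 * real n + a - x) * laguerre a n x
      - (real n + a - 1) * (if n = 0 then 0 else laguerre a (n - 1) x)"
    using laguerre_recurrence[of x a n] by (simp add: algebra_simps del: laguerre.simps)
  show "fps_nth (fps_deriv (Abs_fps (\<lambda>n. laguerre a n x))) n =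
     fps_nth (2 * (fps_X * fps_deriv (Abs_fps (\<lambda>n. laguerre a n x)))
     - fps_X * (fps_X * fps_deriv (Abs_fps (\<lambda>n. laguerre a n x)))
     + (fps_const (a - x) - fps_const a * fps_X) * Abs_fps (\<lambda>n. laguerre a n x)) n"
    using rec by (cases n; cases "n - 1")
      (simp_all add: numeral_fps_const left_diff_distrib mult.assoc algebra_simps del: laguerre.simps(2,3))
qed

text \<open>Comparing coefficients turns the equation back into the recurrence, so the constant term
  determines the solution.\<close>

lemma laguerre_fps_unique:
  assumes "fps_nth H 0 = 1"
    and ode: "fps_deriv H = 2 * (fps_X * fps_deriv H) - fps_X * (fps_X * fps_deriv H)
      + (fps_const (a - x) - fps_const a * fps_X) * (H :: real fps)"
  shows "fps_nth H n = laguerre a n x"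
proof (induction n rule: less_induct)
  case (less n)
  show ?case
  proof (cases n)
    case 0
    then show ?thesis using assms(1) by simp
  next
    case (Suc m)
    have "(real m + 1) * fps_nth H (Suc m) = (2 * real m + a - x) * fps_nth H m
      - (real m + a - 1) * (if m = 0 then 0 else fps_nth H (m - 1))"
      using arg_cong[OF ode, of "\<lambda>F. fps_nth F m"]
      by (cases m; cases "m - 1") (simp_all add: numeral_fps_const left_diff_distrib mult.assoc algebra_simps)
    also have "\<dots> = (real m + 1) * laguerre a (Suc m) x"
      using laguerre_recurrence[of x a m] less[of m] less[of "m - 1"] Suc
      by (cases m) (simp_all add: algebra_simps del: laguerre.simps(2,3))
    finally show ?thesis using Suc by (simp add: add_pos_pos less_imp_neq[symmetric] del: laguerre.simps)
  qed
qed

text \<open>The logarithmic derivative of the generating function is linear in the pair (a, x).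
  Logarithmic derivatives of factors add up, so \<open>F * G\<close> solves the equation for (a + b,
  x + y).\<close>

lemma laguerre_convolution:
  "(\<Sum>r=0..n. laguerre a r x * laguerre b (n - r) y) = laguerre (a + b) n (x + y)"
proof -
  define F where "F = Abs_fps (\<lambda>n. laguerre a n x)"
  define G where "G = Abs_fps (\<lambda>n. laguerre b n y)"
  have "fps_nth (F * G) n = laguerre (a + b) n (x + y)"
  proof (rule laguerre_fps_unique)
    show "fps_nth (F * G) 0 = 1" by (simp add: F_def G_def)
    have F: "fps_deriv F = 2 * (fps_X * fps_deriv F) - fps_X * (fps_X * fps_deriv F)
       + (fps_const (a - x) - fps_const a * fps_X) * F"
      and G: "fps_deriv G = 2 * (fps_X * fps_deriv G) - fps_X * (fps_X * fps_deriv G)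
       + (fps_const (b - y) - fps_const b * fps_X) * G"
      unfolding F_def G_def by (rule laguerre_fps_ode)+
    have c: "fps_const (a + b - (x + y)) = fps_const (a - x) + fps_const (b - y)"
      "fps_const (a + b) = fps_const a + fps_const b"
      by (simp_all add: algebra_simps)
    have "fps_deriv (F * G) = F * fps_deriv G + fps_deriv F * G" by simp
    then show "fps_deriv (F * G) = 2 * (fps_X * fps_deriv (F * G)) - fps_X * (fps_X * fps_deriv (F * G))
      + (fps_const (a + b - (x + y)) - fps_const (a + b) * fps_X) * (F * G)"
      using F G unfolding c by algebra
  qed
  then show ?thesis by (simp add: F_def G_def fps_mult_nth)
qed

lemma laguerre_at_0: "0 < a \<Longrightarrow> laguerre a n 0 = multichoose a n"
proof (induction n rule: less_induct)
  case (less n)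
  consider "n = 0" | "n = 1" | m where "n = Suc (Suc m)"
    by (metis One_nat_def not0_implies_Suc)
  then show ?case
  proof cases
    case 2
    then show ?thesis using multichoose_Suc[OF less(2), of 0] less(2) by simp
  next
    case (3 m)
    have IH: "laguerre a (Suc m) 0 = multichoose a (Suc m)" "laguerre a m 0 = multichoose a m"
      using less 3 by auto
    have "(real m + 2) * laguerre a n 0 = (2 * real (Suc m) + a) * laguerre a (Suc m) 0 - (real m + a) * laguerre a m 0"
      using laguerre_recurrence[of 0 a "Suc m"] unfolding 3 by (simp add: algebra_simps del: laguerre.simps)
    also have "\<dots> = (real m + 2) * multichoose a n"
      unfolding IH using multichoose_Suc[OF less(2), of m] multichoose_Suc[OF less(2), of "Suc m"]
      by (simp add: 3 algebra_simps)
    finally show ?thesis by (simp add: add_pos_pos less_imp_neq[symmetric])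
  qed (use less in simp)
qed

text \<open>The convolution formula at x = y = 0. It says that the dual KMP weights have total mass
  1.\<close>

lemma multichoose_vandermonde:
  assumes "0 < a" "0 < b"
  shows "(\<Sum>r=0..n. multichoose a r * multichoose b (n - r)) = multichoose (a + b) n"
  using laguerre_convolution[of a 0 b n 0]
  by (simp only: laguerre_at_0[OF assms(1)] laguerre_at_0[OF assms(2)] laguerre_at_0[OF add_pos_pos[OF assms]] add_0)

text \<open>The right-hand side is the hypergeometric 1F1(-n; a; x). In this form a enters only
  through Pochhammer symbols, which Beta moments cancel. Multiplication by x shifts the summation
  index (\<open>t_Suc\<close>), so the recurrence reduces to a binomial identity for the coefficient
  of each \<open>t j\<close> (\<open>coeff\<close>).\<close>

lemma laguerre_explicit:
  assumes "0 < a"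
  shows "laguerre a n x / multichoose a n = (\<Sum>j\<le>n. real (n choose j) * ((- x) ^ j / pochhammer a j))"
proof (induction n rule: less_induct)
  case (less n)
  consider "n = 0" | "n = 1" | m where "n = Suc (Suc m)"
    by (metis One_nat_def not0_implies_Suc)
  then show ?case
  proof cases
    case 2
    then show ?thesis using multichoose_Suc[OF assms, of 0] assms by (simp add: divide_simps)
  next
    case (3 m)
    define k where "k = Suc m"
    define t where "t j = (- x) ^ j / pochhammer a j" for j
    \<comment> \<open>The common upper limit lets the sums for m, k and Suc k be compared termwise;
      the surplus binomials are 0.\<close>
    define e where "e i = (\<Sum>j\<le>Suc k. real (i choose j) * t j)" for i
    have IH: "laguerre a i x = multichoose a i * e i" if "i \<le> k" for i
    proof -
      have "laguerre a i x / multichoose a i = (\<Sum>j\<le>i. real (i choose j) * t j)"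
        unfolding t_def using that 3 by (intro less) (auto simp: k_def)
      also have "\<dots> = e i"
        unfolding e_def using that by (intro sum.mono_neutral_left) auto
      finally show ?thesis using multichoose_pos[OF assms, of i] by (simp add: divide_simps mult.commute)
    qed
    have t_Suc: "- x * t j = (a + real j) * t (Suc j)" for j
      using assms by (simp add: t_def pochhammer_Suc)
    have poly: "(a + real k) * e (Suc k) = (2 * real k + a - x) * e k - real k * e m"
    proof -
      have xe: "- x * e k = (\<Sum>j\<le>Suc k. (if j = 0 then 0 else (a + real j - 1) * real (k choose (j - 1))) * t j)"
      proof -
        have "- x * e k = (\<Sum>j\<le>k. real (k choose j) * (- x * t j))"
          unfolding e_def sum_distrib_left by (simp add: mult_ac)
        also have "\<dots> = (\<Sum>j\<le>k. (if Suc j = 0 then 0 else (a + real (Suc j) - 1) * real (k choose (Suc j - 1))) * t (Suc j))"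
          unfolding t_Suc by (simp add: mult_ac)
        also have "\<dots> = (\<Sum>j\<le>Suc k. (if j = 0 then 0 else (a + real j - 1) * real (k choose (j - 1))) * t j)"
          by (subst sum.atMost_Suc_shift) simp
        finally show ?thesis .
      qed
      have coeff: "(a + real k) * real (Suc k choose j) = (2 * real k + a) * real (k choose j)
          + (if j = 0 then 0 else (a + real j - 1) * real (k choose (j - 1))) - real k * real (m choose j)" for j
      proof (cases j)
        case (Suc i)
        have "real (Suc i) * real (k choose Suc i) = (real k - real i) * real (k choose i)"
          by (metis (no_types, opaque_lifting) binomial_absorb_comp binomial_absorption binomial_eq_0_iff
              diff_is_0_eq' linorder_not_le mult_eq_0_iff of_nat_0 of_nat_diff of_nat_mult order.asym less_or_eq_imp_le cancel_comm_monoid_add_class.diff_cancel)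
        moreover have "real k * real (m choose Suc i) = (real k - real (Suc i)) * real (k choose Suc i)"
          by (metis binomial_absorb_comp k_def diff_Suc_1 of_nat_mult of_nat_diff binomial_eq_0_iff mult_zero_right not_less_eq of_nat_0 linorder_not_le order_le_less diff_is_0_eq)
        ultimately show ?thesis using Suc by (simp add: algebra_simps)
      qed (simp add: algebra_simps)
      have "(a + real k) * e (Suc k) = (\<Sum>j\<le>Suc k. ((a + real k) * real (Suc k choose j)) * t j)"
        unfolding e_def sum_distrib_left by (simp only: mult.assoc)
      also have "\<dots> = (2 * real k + a) * e k + - x * e k - real k * e m"
        unfolding coeff xe unfolding e_def
        by (simp only: sum_distrib_left sum.distrib sum_subtractf distrib_right left_diff_distrib mult.assoc)
      finally show ?thesis by (simp add: algebra_simps)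
    qed
    have "(real k + 1) * laguerre a n x = (2 * real k + a - x) * laguerre a k x - (real k + a - 1) * laguerre a m x"
      using laguerre_recurrence[of x a "Suc m"] unfolding 3 k_def by (simp add: algebra_simps del: laguerre.simps)
    also have "(real k + a - 1) * laguerre a m x = real k * multichoose a k * e m"
      using IH[of m] multichoose_Suc[OF assms, of m] by (simp add: k_def algebra_simps)
    also have "(2 * real k + a - x) * laguerre a k x - real k * multichoose a k * e m = multichoose a k * ((2 * real k + a - x) * e k - real k * e m)"
      unfolding IH[OF order_refl] by (simp add: algebra_simps)
    also have "\<dots> = (real k + 1) * (multichoose a n * e n)"
      unfolding poly[symmetric] using multichoose_Suc[OF assms, of k] by (simp add: 3 k_def algebra_simps)
    finally have "laguerre a n x = multichoose a n * e n"
      by (simp add: add_pos_pos less_imp_neq[symmetric])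
    then show ?thesis using multichoose_pos[OF assms, of n] by (simp add: e_def t_def 3 k_def)
  qed (use assms in simp)
qed

section \<open>Binomial sums, Beta moments and the KMP update of Laguerre products\<close>

lemma binomial_sum_Suc:
  "(\<Sum>i\<le>Suc n. real (Suc n choose i) * f i) = (\<Sum>i\<le>n. real (n choose i) * (f i + f (Suc i)))"
proof -
  have "(\<Sum>i\<le>Suc n. real (Suc n choose i) * f i) = f 0 + (\<Sum>i\<le>n. real (n choose i) * f (Suc i) + real (n choose Suc i) * f (Suc i))"
    by (subst sum.atMost_Suc_shift) (simp add: algebra_simps)
  also have "\<dots> = (\<Sum>i\<le>n. real (n choose i) * f (Suc i)) + (\<Sum>i\<le>Suc n. real (n choose i) * f i)"
    by (subst sum.atMost_Suc_shift[of "\<lambda>i. real (n choose i) * f i"]) (simp add: sum.distrib)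
  also have "(\<Sum>i\<le>Suc n. real (n choose i) * f i) = (\<Sum>i\<le>n. real (n choose i) * f i)"
    by simp
  finally show ?thesis by (simp add: sum.distrib distrib_left)
qed

text \<open>With E the index shift, this is (1 + E)^m (1 + E)^n = (1 + E)^(m + n) applied to f and
  read at 0.\<close>

lemma binomial_sum_add:
  "(\<Sum>i\<le>m. \<Sum>j\<le>n. real (m choose i) * real (n choose j) * f (i + j)) = (\<Sum>i\<le>m + n. real (m + n choose i) * (f i :: real))"
proof (induction m arbitrary: f)
  case (Suc m)
  have "(\<Sum>i\<le>Suc m. \<Sum>j\<le>n. real (Suc m choose i) * real (n choose j) * f (i + j)) =
     (\<Sum>i\<le>Suc m. real (Suc m choose i) * (\<Sum>j\<le>n. real (n choose j) * f (i + j)))"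
    by (simp add: sum_distrib_left mult.assoc del: binomial_Suc_Suc sum.atMost_Suc)
  also have "\<dots> = (\<Sum>i\<le>m. \<Sum>j\<le>n. real (m choose i) * real (n choose j) * (\<lambda>i. f i + f (Suc i)) (i + j))"
    unfolding binomial_sum_Suc by (simp add: sum_distrib_left sum.distrib algebra_simps)
  also have "\<dots> = (\<Sum>i\<le>Suc m + n. real (Suc m + n choose i) * f i)"
    unfolding Suc.IH[of "\<lambda>i. f i + f (Suc i)"] by (simp add: binomial_sum_Suc del: binomial_Suc_Suc sum.atMost_Suc)
  finally show ?case .
qed simp

lemma kmp_moments:
  assumes "0 < a"
  shows "set_integrable lborel {0..1} (\<lambda>p. p ^ i * (1 - p) ^ j * kmp_density a p)" (is ?A)
    and "(LINT p:{0..1}|lborel. p ^ i * (1 - p) ^ j * kmp_density a p) =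
      pochhammer a i * pochhammer a j / pochhammer (2 * a) (i + j)" (is ?B)
proof -
  define c where "c = Gamma (2 * a) / (Gamma a)\<^sup>2"
  have pos: "Gamma a > 0" "Gamma (2 * a) > 0" "Gamma (2 * a + real (i + j)) > 0"
    using assms by (auto intro!: Gamma_real_pos)
  have eq: "p ^ i * (1 - p) ^ j * kmp_density a p =
      c * (p powr (a + real i - 1) * (1 - p) powr (a + real j - 1))" if "p \<in> {0..1}" for p
  proof -
    \<comment> \<open>At q = 0 both sides are 0, also for n = 0, because 0 powr r = 0 for every
      r.\<close>
    have "q powr (a + real n - 1) = q ^ n * q powr (a - 1)" if "q \<ge> 0" for q n
      using that by (cases "q = 0") (simp_all add: powr_add powr_diff powr_realpow)
    then show ?thesis using that by (simp add: kmp_density_def c_def)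
  qed
  have int: "set_integrable lborel {0..1} (\<lambda>p. p powr (a + real i - 1) * (1 - p) powr (a + real j - 1))"
    using integrable_Beta[of "a + real i" "a + real j"] assms by simp
  show ?A
    using int by (subst set_integrable_cong[OF refl refl eq]) auto
  have "(LINT p:{0..1}|lborel. p ^ i * (1 - p) ^ j * kmp_density a p) =
    (LINT p:{0..1}|lborel. c * (p powr (a + real i - 1) * (1 - p) powr (a + real j - 1)))"
    using eq by (intro set_lebesgue_integral_cong) auto
  also have "\<dots> = c * Beta (a + real i) (a + real j)"
    using set_borel_integral_eq_integral(2)[OF int] has_integral_Beta_real[of "a + real i" "a + real j"] assms
    by (simp add: integral_unique)
  also have "\<dots> = pochhammer a i * pochhammer a j / pochhammer (2 * a) (i + j)"
    using assms pos
    by (simp add: c_def Beta_def pochhammer_Gamma nonpos_Ints_def power2_eq_square add_ac)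
  finally show ?B .
qed

lemma set_integral_sum:
  fixes f :: "'i \<Rightarrow> 'a \<Rightarrow> 'b::{banach, second_countable_topology}"
  assumes "\<And>i. i \<in> I \<Longrightarrow> set_integrable M A (f i)"
  shows "set_integrable M A (\<lambda>x. \<Sum>i\<in>I. f i x)"
    and "(LINT x:A|M. \<Sum>i\<in>I. f i x) = (\<Sum>i\<in>I. LINT x:A|M. f i x)"
  using assms unfolding set_integrable_def set_lebesgue_integral_def
  by (simp_all add: scaleR_sum_right)

text \<open>The Beta moment (a)_i (a)_j / (2a)_(i+j) cancels the Pochhammer symbols of the two
  expansions. Apart from binomials the rest depends on i + j only, and
  \<open>binomial_sum_add\<close> collapses it to the expansion with parameter 2a and index m +
  n.\<close>

lemma kmp_laguerre:
  assumes a: "0 < a"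
  defines "d \<equiv> \<lambda>n x. laguerre a n x / multichoose a n"
  shows "set_integrable lborel {0..1} (\<lambda>p. d m (p * e) * d n ((1 - p) * e) * kmp_density a p)" (is ?A)
    and "(LINT p:{0..1}|lborel. d m (p * e) * d n ((1 - p) * e) * kmp_density a p) =
      laguerre (2 * a) (m + n) e / multichoose (2 * a) (m + n)" (is ?B)
proof -
  define g where "g i j = real (m choose i) * real (n choose j) * ((- e) ^ (i + j) / (pochhammer a i * pochhammer a j))" for i j
  have expand: "d m (p * e) * d n ((1 - p) * e) * kmp_density a p =
      (\<Sum>i\<le>m. \<Sum>j\<le>n. g i j * (p ^ i * (1 - p) ^ j * kmp_density a p))" for p
  proof -
    have pw: "(- (q * e)) ^ i = q ^ i * (- e) ^ i" for q i
      by (metis mult_minus_right power_mult_distrib)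
    show ?thesis
      unfolding d_def laguerre_explicit[OF a] g_def sum_product unfolding pw sum_distrib_right
      by (intro sum.cong refl) (simp add: power_add)
  qed
  have int: "set_integrable lborel {0..1} (\<lambda>p. g i j * (p ^ i * (1 - p) ^ j * kmp_density a p))" for i j
    using kmp_moments(1)[OF a] by auto
  show ?A unfolding expand
    by (intro set_integral_sum int)
  have "(LINT p:{0..1}|lborel. d m (p * e) * d n ((1 - p) * e) * kmp_density a p) =
     (\<Sum>i\<le>m. \<Sum>j\<le>n. LINT p:{0..1}|lborel. g i j * (p ^ i * (1 - p) ^ j * kmp_density a p))"
    unfolding expand by (simp only: set_integral_sum int)
  also have "\<dots> = (\<Sum>i\<le>m. \<Sum>j\<le>n. real (m choose i) * real (n choose j) * ((- e) ^ (i + j) / pochhammer (2 * a) (i + j)))"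
    using a by (simp add: kmp_moments(2) g_def pochhammer_pos less_imp_neq[symmetric])
  also have "\<dots> = laguerre (2 * a) (m + n) e / multichoose (2 * a) (m + n)"
    using a by (simp only: binomial_sum_add[of m n "\<lambda>i. (- e) ^ i / pochhammer (2 * a) i"]
      laguerre_explicit mult_pos_pos zero_less_numeral)
  finally show ?B .
qed

lemma dual_kmp:
  assumes G: "pair_graph G" "pverts G = I" and k: "0 < k"
  shows "dual (kmp_gen k G) (I \<rightarrow>\<^sub>E {0..}) (dual_kmp_gen k G) (I \<rightarrow>\<^sub>E UNIV)
    (\<lambda>x n. \<Prod>i\<in>I. fact (n i) * Gamma (2 * k) / Gamma (2 * k + real (n i)) * laguerre (2 * k) (n i) (x i))"
  unfolding dual_def fact_Gamma_eq_multichoose kmp_gen_def dual_kmp_gen_def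
proof (intro ballI sum.cong refl, clarify)
  fix x :: "nat \<Rightarrow> real" and n i l
  assume edge: "(i, l) \<in> edges G"
  interpret pair_graph G by fact
  define a where "a = 2 * k"
  define d where "d m y = laguerre a m y / multichoose a m" for m y
  have a: "a > 0" using k by (simp add: a_def)
  have I: "finite I" using G(2) by auto
  have il: "i \<in> I" "l \<in> I" "i \<noteq> l" using edges_subset[OF G edge] by auto
  define R where "R = (\<Prod>j\<in>I - {i, l}. d (n j) (x j))"
  define D where "D = (\<Prod>j\<in>I. d (n j) (x j))"
  define e where "e = x i + x l"
  define C where "C = n i + n l"
  have F: "(\<Prod>j\<in>I. d (n j) ((x(i := s, l := t)) j)) = d (n i) s * d (n l) t * R" for s t
    unfolding prod_remove_two[OF I il] R_def using il(3) by (auto intro!: prod.cong)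
  have F': "(\<Prod>j\<in>I. d ((n(i := s, l := t)) j) (x j)) = d s (x i) * d t (x l) * R" for s t
    unfolding prod_remove_two[OF I il] R_def using il(3) by (auto intro!: prod.cong)
  have mass: "set_integrable lborel {0..1} (kmp_density a)" "(LINT p:{0..1}|lborel. kmp_density a p) = 1"
    using kmp_moments[OF a, of 0 0] by simp_all
  \<comment> \<open>E is the common value of the two averages. The loss term is D times a total mass
    on either side: that of the Beta density here, that of the dual weights there, both equal to
    1.\<close>
  define E where "E = laguerre (2 * a) C e / multichoose (2 * a) C"
  have "(LINT p:{0..1}|lborel. ((\<Prod>j\<in>I. d (n j) ((x(i := p * e, l := (1 - p) * e)) j)) - D) * kmp_density a p)
    = (LINT p:{0..1}|lborel. R * (d (n i) (p * e) * d (n l) ((1 - p) * e) * kmp_density a p) - D * kmp_density a p)"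
    unfolding F by (simp add: algebra_simps)
  also have "\<dots> = R * E - D"
    unfolding E_def C_def
    using kmp_laguerre[OF a, of "n i" e "n l", folded d_def] mass by (simp add: set_integral_diff(2))
  also have "\<dots> = R * (\<Sum>r = 0..C. d r (x i) * d (C - r) (x l) * dual_kmp_weight a r C) - D * (\<Sum>r = 0..C. dual_kmp_weight a r C)"
  proof -
    have pos: "multichoose a r > 0" "multichoose (2 * a) r > 0" for r using a by (simp_all add: multichoose_pos)
    have "d r (x i) * d (C - r) (x l) * dual_kmp_weight a r C = laguerre a r (x i) * laguerre a (C - r) (x l) / multichoose (2 * a) C" for r
      using pos(1)[of r] pos(1)[of "C - r"] by (simp add: d_def dual_kmp_weight_def)
    then have 1: "(\<Sum>r = 0..C. d r (x i) * d (C - r) (x l) * dual_kmp_weight a r C) = E"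
      using laguerre_convolution[of a "x i" a C "x l"] by (simp add: E_def e_def flip: sum_divide_distrib)
    have "(\<Sum>r = 0..C. dual_kmp_weight a r C) = 1"
      using multichoose_vandermonde[OF a a, of C] pos(2)[of C]
      by (simp add: dual_kmp_weight_def flip: sum_divide_distrib)
    with 1 show ?thesis by simp
  qed
  also have "\<dots> = (\<Sum>r = 0..C. ((\<Prod>j\<in>I. d ((n(i := r, l := C - r)) j) (x j)) - D) * dual_kmp_weight a r C)"
    unfolding F' by (simp add: sum_distrib_left sum_subtractf algebra_simps)
  finally show "(LINT p:{0..1}|lborel.
      ((\<Prod>j\<in>I. laguerre (2 * k) (n j) ((x(i := p * (x i + x l), l := (1 - p) * (x i + x l))) j) / multichoose (2 * k) (n j))
       - (\<Prod>j\<in>I. laguerre (2 * k) (n j) (x j) / multichoose (2 * k) (n j))) * kmp_density (2 * k) p) =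
    (\<Sum>r = 0..n i + n l.
      ((\<Prod>j\<in>I. laguerre (2 * k) ((n(i := r, l := n i + n l - r)) j) (x j) / multichoose (2 * k) ((n(i := r, l := n i + n l - r)) j))
       - (\<Prod>j\<in>I. laguerre (2 * k) (n j) (x j) / multichoose (2 * k) (n j))) * dual_kmp_weight (2 * k) r (n i + n l))"
    unfolding d_def a_def D_def C_def e_def .
qed

section \<open>Stationary measures of the hopping processes\<close>

text \<open>Fubini with coordinate i split off. The inner integral does not see x i, so the outer
  one may run over the full product again; keeping the same outer measure makes the step
  iterable.\<close>

lemma integral_PiM_resample:
  fixes F :: "_ \<Rightarrow> real"
  assumes "finite I" "i \<in> I" "\<And>j. prob_space (M j)" "integrable (Pi\<^sub>M I M) F"
  shows "integral\<^sup>L (Pi\<^sub>M I M) F = (\<integral>x. (\<integral>y. F (x(i := y)) \<partial>M i) \<partial>Pi\<^sub>M I M)"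
proof -
  interpret product_prob_space M I by (rule product_prob_spaceI) fact
  interpret rest: product_prob_space M "I - {i}" by (rule product_prob_spaceI) fact
  interpret P: pair_sigma_finite "M i" "Pi\<^sub>M (I - {i}) M" ..
  have I: "insert i (I - {i}) = I" using assms(2) by auto
  have "integral\<^sup>L (Pi\<^sub>M I M) F = (\<integral>x. (\<integral>y. F (x(i := y)) \<partial>M i) \<partial>Pi\<^sub>M (I - {i}) M)"
    using product_integral_insert[of "I - {i}" i F, unfolded I] assms(1,4) by simp
  also have "\<dots> = (\<integral>x. (\<integral>y. F (x(i := y)) \<partial>M i) \<partial>distr (Pi\<^sub>M I M) (Pi\<^sub>M (I - {i}) M) (\<lambda>x. restrict x (I - {i})))"
    unfolding distr_restrict[OF Diff_subset assms(1), of "{i}", symmetric] ..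
  also have "\<dots> = (\<integral>x. (\<integral>y. F ((restrict x (I - {i}))(i := y)) \<partial>M i) \<partial>Pi\<^sub>M I M)"
  proof (rule integral_distr)
    have "(\<lambda>p. F ((fst p)(i := snd p))) \<in> borel_measurable (Pi\<^sub>M (I - {i}) M \<Otimes>\<^sub>M M i)"
      using measurable_compose[OF measurable_add_dim[of i "I - {i}" M], unfolded I, OF borel_measurable_integrable[OF assms(4)]]
      by (simp add: case_prod_beta')
    then show "(\<lambda>x. \<integral>y. F (x(i := y)) \<partial>M i) \<in> borel_measurable (Pi\<^sub>M (I - {i}) M)"
      by (intro M.borel_measurable_lebesgue_integral) (simp add: case_prod_beta')
  qed auto
  also have "\<dots> = (\<integral>x. (\<integral>y. F (x(i := y)) \<partial>M i) \<partial>Pi\<^sub>M I M)"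
  proof (intro Bochner_Integration.integral_cong refl)
    fix x y assume "x \<in> space (Pi\<^sub>M I M)"
    then have "(restrict x (I - {i}))(i := y) = x(i := y)"
      by (auto simp: space_PiM PiE_def extensional_def fun_eq_iff)
    then show "F ((restrict x (I - {i}))(i := y)) = F (x(i := y))" by simp
  qed
  finally show ?thesis .
qed

corollary integral_PiM_eq_0:
  fixes F :: "_ \<Rightarrow> real"
  assumes "finite I" "i \<in> I" "\<And>j. prob_space (M j)" "integrable (Pi\<^sub>M I M) F"
    and "\<And>x. x \<in> space (Pi\<^sub>M I M) \<Longrightarrow> (\<integral>y. F (x(i := y)) \<partial>M i) = 0"
  shows "integral\<^sup>L (Pi\<^sub>M I M) F = 0"
  unfolding integral_PiM_resample[OF assms(1-4)] using assms(5)
  by (simp cong: Bochner_Integration.integral_cong)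

lemma emeasure_PiM_power_eq_1:
  assumes "finite I" "prob_space \<mu>" "S \<in> sets \<mu>" "AE y in \<mu>. y \<in> S"
  shows "emeasure (Pi\<^sub>M I (\<lambda>_. \<mu>)) (I \<rightarrow>\<^sub>E S) = 1"
proof -
  interpret prob_space \<mu> by fact
  have "emeasure \<mu> S = 1" by (rule emeasure_eq_1_AE) fact+
  interpret product_prob_space "\<lambda>_. \<mu>" I by unfold_locales
  show ?thesis using \<open>emeasure \<mu> S = 1\<close> emeasure_PiM[OF assms(1), of "\<lambda>_. S"] assms(3) by simp
qed

text \<open>The test functions are only controlled on the state space, so stationarity is checked for
  their extension by zero.\<close>

lemma stationaryI:
  assumes "finite I" "prob_space \<mu>" "S \<in> sets \<mu>" "AE y in \<mu>. y \<in> S"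
    and "\<And>f. f \<in> F \<Longrightarrow> \<exists>g. (\<forall>x\<in>I \<rightarrow>\<^sub>E S. L f x = g x) \<and> integrable (Pi\<^sub>M I (\<lambda>_. \<mu>)) g \<and>
      integral\<^sup>L (Pi\<^sub>M I (\<lambda>_. \<mu>)) g = 0"
  shows "stationary L (I \<rightarrow>\<^sub>E S) F (Pi\<^sub>M I (\<lambda>_. \<mu>))"
  unfolding stationary_def
proof (intro conjI ballI)
  let ?P = "Pi\<^sub>M I (\<lambda>_. \<mu>)" and ?\<Omega> = "I \<rightarrow>\<^sub>E S"
  interpret prob_space \<mu> by fact
  interpret product_prob_space "\<lambda>_. \<mu>" I by unfold_locales
  show P: "prob_space ?P" by (rule prob_space_PiM) (rule assms)
  show em: "emeasure ?P ?\<Omega> = 1" by (rule emeasure_PiM_power_eq_1) fact+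
  have \<Omega>: "?\<Omega> \<in> sets ?P" using assms by (intro sets_PiM_I_finite) auto
  have AE: "AE x in ?P. x \<in> ?\<Omega>"
    using prob_space.AE_prob_1[OF P] em by (simp add: measure_def)
  fix f assume "f \<in> F"
  then obtain g where g: "\<And>x. x \<in> ?\<Omega> \<Longrightarrow> L f x = g x" "integrable ?P g" "integral\<^sup>L ?P g = 0"
    using assms(5) by meson
  have eq: "indicator ?\<Omega> x *\<^sub>R L f x = indicator ?\<Omega> x *\<^sub>R g x" for x
    using g(1) by (auto split: split_indicator)
  show "set_integrable ?P ?\<Omega> (L f)"
    unfolding set_integrable_def eq using g(2) \<Omega> by (rule integrable_mult_indicator[rotated])
  have "(LINT x:?\<Omega>|?P. L f x) = integral\<^sup>L ?P g"
    unfolding set_lebesgue_integral_def eq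
    by (rule integral_cong_AE) (use AE g(2) \<Omega> in \<open>auto intro!: borel_measurable_integrable integrable_mult_indicator\<close>)
  then show "(LINT x:?\<Omega>|?P. L f x) = 0" using g(3) by simp
qed

lemma stationary_sumI:
  assumes "finite E" "finite I" "prob_space \<mu>" "S \<in> sets \<mu>" "AE y in \<mu>. y \<in> S"
    and "\<And>f i l. f \<in> F \<Longrightarrow> (i, l) \<in> E \<Longrightarrow> \<exists>g. (\<forall>x\<in>I \<rightarrow>\<^sub>E S. A i l f x = g x) \<and>
      integrable (Pi\<^sub>M I (\<lambda>_. \<mu>)) g \<and> integral\<^sup>L (Pi\<^sub>M I (\<lambda>_. \<mu>)) g = 0"
  shows "stationary (\<lambda>f x. \<Sum>(i, l)\<in>E. A i l f x) (I \<rightarrow>\<^sub>E S) F (Pi\<^sub>M I (\<lambda>_. \<mu>))"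
proof (rule stationaryI[OF assms(2-5)])
  fix f assume "f \<in> F"
  then have "\<forall>e\<in>E. \<exists>g. (\<forall>x\<in>I \<rightarrow>\<^sub>E S. A (fst e) (snd e) f x = g x) \<and>
      integrable (Pi\<^sub>M I (\<lambda>_. \<mu>)) g \<and> integral\<^sup>L (Pi\<^sub>M I (\<lambda>_. \<mu>)) g = 0"
    using assms(6) by auto
  from bchoice[OF this] obtain g where
    g: "\<And>e x. e \<in> E \<Longrightarrow> x \<in> I \<rightarrow>\<^sub>E S \<Longrightarrow> A (fst e) (snd e) f x = g e x"
      "\<And>e. e \<in> E \<Longrightarrow> integrable (Pi\<^sub>M I (\<lambda>_. \<mu>)) (g e)"
      "\<And>e. e \<in> E \<Longrightarrow> integral\<^sup>L (Pi\<^sub>M I (\<lambda>_. \<mu>)) (g e) = 0"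
    by blast
  show "\<exists>g. (\<forall>x\<in>I \<rightarrow>\<^sub>E S. (\<Sum>(i, l)\<in>E. A i l f x) = g x) \<and>
      integrable (Pi\<^sub>M I (\<lambda>_. \<mu>)) g \<and> integral\<^sup>L (Pi\<^sub>M I (\<lambda>_. \<mu>)) g = 0"
  proof (intro exI[of _ "\<lambda>x. \<Sum>e\<in>E. g e x"] conjI ballI)
    show "(\<Sum>(i, l)\<in>E. A i l f x) = (\<Sum>e\<in>E. g e x)" if "x \<in> I \<rightarrow>\<^sub>E S" for x
      by (intro sum.cong refl) (simp add: case_prod_beta g(1)[OF _ that])
    show "integrable (Pi\<^sub>M I (\<lambda>_. \<mu>)) (\<lambda>x. \<Sum>e\<in>E. g e x)"
      by (intro Bochner_Integration.integrable_sum g(2))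
    show "(\<integral>x. (\<Sum>e\<in>E. g e x) \<partial>Pi\<^sub>M I (\<lambda>_. \<mu>)) = 0"
      by (subst Bochner_Integration.integral_sum) (simp_all add: g)
  qed
qed

text \<open>First moments suffice: every hop rate is linear in each of two different sites, and the
  sites are independent.\<close>

context
  fixes \<mu> :: "nat measure" and w :: "nat \<Rightarrow> real" and I :: "nat set"
  assumes \<mu>: "\<mu> = density (count_space UNIV) (\<lambda>x. ennreal (w x))"
    and w_nonneg: "\<And>x. w x \<ge> 0"
    and prob: "prob_space \<mu>"
    and moment: "summable (\<lambda>x. (1 + real x) * w x)"
    and I: "finite I"
begin

private abbreviation (input) "P \<equiv> Pi\<^sub>M I (\<lambda>_. \<mu>)"

private lemma space_P: "space P = I \<rightarrow>\<^sub>E UNIV"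
  by (simp add: space_PiM \<mu>)

text \<open>There are only countably many configurations on finitely many sites, so every function
  is measurable. This is why \<open>bounded_functions\<close> can do without a measurability
  condition.\<close>

private lemma sets_P: "A \<subseteq> space P \<Longrightarrow> A \<in> sets P"
proof -
  assume A: "A \<subseteq> space P"
  have "countable (I \<rightarrow>\<^sub>E (UNIV :: nat set))" using I by (intro countable_PiE) auto
  with A have "countable A" unfolding space_P by (rule countable_subset)
  moreover have "{x} \<in> sets P" if "x \<in> A" for x
  proof -
    have "{x} = (\<Pi>\<^sub>E j\<in>I. {x j})"
      using that A by (subst PiE_singleton) (auto simp: space_P PiE_def)
    also have "\<dots> \<in> sets P" using I by (intro sets_PiM_I_finite) (auto simp: \<mu>)
    finally show ?thesis .
  qed
  ultimately show "A \<in> sets P" by (rule sets.countable[rotated])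
qed

private lemma measurable_P: "(f :: _ \<Rightarrow> real) \<in> borel_measurable P"
  by (auto simp: measurable_def intro!: sets_P)

private lemma integral_\<mu>:
  assumes "\<And>y. \<bar>f y\<bar> \<le> K * (1 + real y)"
  shows "integrable \<mu> f" "summable (\<lambda>y. w y * f y)" "integral\<^sup>L \<mu> f = (\<Sum>y. w y * f y)"
proof -
  have "summable (\<lambda>y. norm (w y * f y))"
  proof (rule summable_comparison_test'[of "\<lambda>y. K * ((1 + real y) * w y)" 0])
    show "norm (norm (w n * f n)) \<le> K * ((1 + real n) * w n)" for n
      using mult_left_mono[OF assms w_nonneg[of n], of n] w_nonneg[of n] by (simp add: abs_mult mult_ac)
  qed (intro summable_mult moment)
  then have int: "integrable (count_space UNIV) (\<lambda>y. w y * f y)"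
    by (simp add: integrable_count_space_nat_iff)
  then show "summable (\<lambda>y. w y * f y)"
    by (simp add: integrable_count_space_nat_iff summable_norm_cancel)
  show "integrable \<mu> f" unfolding \<mu> using int w_nonneg
    by (subst integrable_density) auto
  show "integral\<^sup>L \<mu> f = (\<Sum>y. w y * f y)" unfolding \<mu> using int w_nonneg
    by (subst integral_density) (auto simp: integral_count_space_nat)
qed

text \<open>The bound is a constant times the product of 1 + x j over all sites, whose integral
  factors into first moments.\<close>

private lemma integrable_P:
  assumes il: "i \<in> I" "l \<in> I" "i \<noteq> l"
    and u: "\<And>x. \<bar>u x\<bar> \<le> K * (1 + real x)" and v: "\<And>x. \<bar>v x\<bar> \<le> K' * (1 + real x)"
    and g: "\<And>x. \<bar>g x\<bar> \<le> B"
  shows "integrable P (\<lambda>x. u (x i) * v (x l) * g x)"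
proof (rule Bochner_Integration.integrable_bound[OF _ measurable_P])
  interpret prob_space \<mu> by (rule prob)
  interpret product_prob_space "\<lambda>_. \<mu>" I by unfold_locales
  have "integrable \<mu> (\<lambda>y. 1 + real y)" by (rule integral_\<mu>[of _ 1]) simp
  then show "integrable P (\<lambda>x. K * K' * B * (\<Prod>j\<in>I. 1 + real (x j)))"
    by (intro integrable_mult_right product_integrable_prod I) auto
  have nn: "K \<ge> 0" "K' \<ge> 0" "B \<ge> 0"
    using u[of 0] v[of 0] g[of undefined] by auto
  show "AE x in P. norm (u (x i) * v (x l) * g x) \<le> norm (K * K' * B * (\<Prod>j\<in>I. 1 + real (x j)))"
  proof (rule AE_I2)
    fix x
    have "norm (u (x i) * v (x l) * g x) \<le> (K * (1 + real (x i))) * (K' * (1 + real (x l))) * B"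
      unfolding real_norm_def abs_mult
      by (intro mult_mono u v g) (auto intro!: mult_nonneg_nonneg nn)
    also have "\<dots> = K * K' * B * ((1 + real (x i)) * (1 + real (x l)) * 1)" by simp
    also have "\<dots> \<le> K * K' * B * ((1 + real (x i)) * (1 + real (x l)) * (\<Prod>j\<in>I - {i, l}. 1 + real (x j)))"
      by (intro mult_left_mono prod_ge_1) (auto intro!: mult_nonneg_nonneg nn)
    also have "\<dots> = K * K' * B * (\<Prod>j\<in>I. 1 + real (x j))"
      using prod_remove_two[OF I il, of "\<lambda>j. 1 + real (x j)"] by simp
    finally show "norm (u (x i) * v (x l) * g x) \<le> norm (K * K' * B * (\<Prod>j\<in>I. 1 + real (x j)))" by simp
  qed
qed

text \<open>\<open>balance\<close> encodes the Stein identity E[X h(X - 1)] = c E[(a + s X) h(X)].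
  Used at both ends of an edge, it equates the gain from hops i to l with the loss from hops l to i
  (\<open>exchange\<close>), and the two directions together give 0. The conditions on S say that
  hops of nonzero rate stay in the state space.\<close>

lemma stationary_hop_gen:
  fixes a s c :: real
  assumes balance: "\<And>x. (real x + 1) * w (Suc x) = c * (a + s * real x) * w x"
    and S: "\<And>x. x \<notin> S \<Longrightarrow> w x = 0" "\<And>x. x \<in> S \<Longrightarrow> x - 1 \<in> S"
      "\<And>x. x \<in> S \<Longrightarrow> a + s * real x \<noteq> 0 \<Longrightarrow> Suc x \<in> S"
    and G: "pair_graph G" "pverts G = I"
  shows "stationary (hop_gen s a G) (I \<rightarrow>\<^sub>E S) (bounded_functions (I \<rightarrow>\<^sub>E S)) P"
  unfolding hop_gen_def[abs_def]
proof (rule stationary_sumI[OF finite_edges[OF G(1)] I prob])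
  show "S \<in> sets \<mu>" by (simp add: \<mu>)
  show "AE y in \<mu>. y \<in> S"
    unfolding \<mu> by (subst AE_density) (use S(1) in \<open>simp_all add: AE_count_space, metis less_irrefl\<close>)
  define K where "K = \<bar>a\<bar> + \<bar>s\<bar>"
  have lin: "\<bar>a + s * real x\<bar> \<le> K * (1 + real x)" for x
    unfolding K_def by (rule order_trans[OF abs_triangle_ineq])
      (auto simp: abs_mult algebra_simps add_nonneg_nonneg)
  have id: "\<bar>real x\<bar> \<le> 1 * (1 + real x)" for x by simp
  have clin: "\<bar>c * (a + s * real x)\<bar> \<le> (\<bar>c\<bar> * K) * (1 + real x)" for x
    using mult_left_mono[OF lin, of "\<bar>c\<bar>" x] by (simp add: abs_mult mult.assoc)
  \<comment> \<open>Shifting the series by one index brings in (y + 1) w (y + 1), to which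
    \<open>balance\<close> applies.\<close>
  have stein: "(\<integral>y. real y * h (y - 1) - c * (a + s * real y) * h y \<partial>\<mu>) = 0"
    if "\<And>y. \<bar>h y\<bar> \<le> B" for h :: "nat \<Rightarrow> real" and B
  proof -
    have B: "B \<ge> 0" using that[of 0] by auto
    have b1: "\<bar>real y * h (y - 1)\<bar> \<le> B * (1 + real y)" for y
      using mult_mono[OF id that, of y "y - 1"] B by (simp add: abs_mult mult_ac)
    have b2: "\<bar>c * (a + s * real y) * h y\<bar> \<le> (\<bar>c\<bar> * K * B) * (1 + real y)" for y
      using mult_mono[OF clin that, of y y] B by (simp add: abs_mult mult_ac K_def)
    note i1 = integral_\<mu>[OF b1] and i2 = integral_\<mu>[OF b2]
    have "integral\<^sup>L \<mu> (\<lambda>y. real y * h (y - 1)) = (\<Sum>y. w (Suc y) * (real (Suc y) * h y))"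
      unfolding i1(3) using suminf_split_head[OF i1(2)] by simp
    also have "\<dots> = (\<Sum>y. w y * (c * (a + s * real y) * h y))"
    proof (rule suminf_cong)
      show "w (Suc y) * (real (Suc y) * h y) = w y * (c * (a + s * real y) * h y)" for y
        using arg_cong[OF balance[of y], of "\<lambda>z. z * h y"] by (simp add: algebra_simps)
    qed
    finally show ?thesis using i1(1,3) i2(1,3) by simp
  qed
  have exchange: "(\<integral>x. real (x i) * (a + s * real (x l)) * f (hop i l x) \<partial>P)
    = (\<integral>x. (a + s * real (x i)) * real (x l) * f x \<partial>P)"
    if il: "i \<in> I" "l \<in> I" "i \<noteq> l" and f: "\<And>x. \<bar>f x\<bar> \<le> B" for i l f B
  proof -
    \<comment> \<open>The half-way term: a particle is added at l and none removed at i. The Stein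
      identity at i leads from the gain to Z, the one at l from the reverse loss to Z.\<close>
    define Z where "Z x = c * (a + s * real (x i)) * (a + s * real (x l)) * f (x(l := x l + 1))" for x
    have Z: "integrable P Z"
      unfolding Z_def[abs_def]
      by (rule integrable_P[OF il, where u = "\<lambda>y. c * (a + s * real y)" and v = "\<lambda>y. a + s * real y", OF clin lin f])
    have A: "integrable P (\<lambda>x. real (x i) * (a + s * real (x l)) * f (hop i l x))"
      by (rule integrable_P[OF il, where v = "\<lambda>y. a + s * real y", OF id lin f])
    have D: "integrable P (\<lambda>x. (a + s * real (x i)) * real (x l) * f x)"
      by (rule integrable_P[OF il, where u = "\<lambda>y. a + s * real y", OF lin id f])
    have "(\<integral>x. real (x i) * (a + s * real (x l)) * f (hop i l x) - Z x \<partial>P) = 0"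
    proof (rule integral_PiM_eq_0[OF I il(1) prob])
      fix x
      have "(\<integral>y. real y * ((a + s * real (x l)) * f (x(i := y - 1, l := x l + 1)))
        - c * (a + s * real y) * ((a + s * real (x l)) * f (x(i := y, l := x l + 1))) \<partial>\<mu>) = 0"
        by (rule stein[of "\<lambda>y. (a + s * real (x l)) * f (x(i := y, l := x l + 1))"
          "\<bar>a + s * real (x l)\<bar> * B"]) (auto simp: abs_mult intro!: mult_left_mono f)
      then show "(\<integral>y. real ((x(i := y)) i) * (a + s * real ((x(i := y)) l)) * f (hop i l (x(i := y))) - Z (x(i := y)) \<partial>\<mu>) = 0"
        using il(3) by (simp add: Z_def hop_def mult.assoc)
    qed (use A Z in simp)
    moreover have "(\<integral>x. (a + s * real (x i)) * real (x l) * f x - Z x \<partial>P) = 0"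
    proof (rule integral_PiM_eq_0[OF I il(2) prob])
      fix x
      \<comment> \<open>f is read one step up at l, so that y h(y - 1) returns f at y; for y = 0 the
        factor y hides the truncated subtraction.\<close>
      define h where "h y = (a + s * real (x i)) * f (x(l := Suc y))" for y
      have h: "real y * h (y - 1) = real y * ((a + s * real (x i)) * f (x(l := y)))" for y
        by (cases y) (simp_all add: h_def)
      have "(\<integral>y. real y * h (y - 1) - c * (a + s * real y) * h y \<partial>\<mu>) = 0"
        by (rule stein[of h "\<bar>a + s * real (x i)\<bar> * B"]) (auto simp: h_def abs_mult intro!: mult_left_mono f)
      then show "(\<integral>y. (a + s * real ((x(l := y)) i)) * real ((x(l := y)) l) * f (x(l := y)) - Z (x(l := y)) \<partial>\<mu>) = 0"
        unfolding h using il(3) by (simp add: Z_def h_def mult_ac)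
    qed (use D Z in simp)
    ultimately show ?thesis using A D Z by simp
  qed
  fix f i l assume f: "f \<in> bounded_functions (I \<rightarrow>\<^sub>E S)" and "(i, l) \<in> edges G"
  from edges_subset[OF G this(2)] have il: "i \<in> I" "l \<in> I" "i \<noteq> l" "l \<noteq> i" by auto
  obtain B where B: "\<And>x. x \<in> I \<rightarrow>\<^sub>E S \<Longrightarrow> \<bar>f x\<bar> \<le> B"
    using f by (auto simp: bounded_functions_def bounded_iff)
  define g where "g x = (if x \<in> I \<rightarrow>\<^sub>E S then f x else 0)" for x
  have g: "\<bar>g x\<bar> \<le> \<bar>B\<bar>" for x
    using B[of x] by (auto simp: g_def)
  \<comment> \<open>f is controlled on the state space only. A hop that leaves it has rate 0, so f
    can be replaced by its extension by zero.\<close>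
  have eqs: "real (x i) * (a + s * real (x l)) * (f (hop i l x) - f x) =
      real (x i) * (a + s * real (x l)) * (g (hop i l x) - g x)"
    if "x \<in> I \<rightarrow>\<^sub>E S" "i \<in> I" "l \<in> I" "i \<noteq> l" for x i l
  proof (cases "x i = 0 \<or> a + s * real (x l) = 0")
    case False
    then have "Suc (x l) \<in> S" "x i - 1 \<in> S" using that S(2,3) by (auto simp: PiE_iff)
    then have "hop i l x \<in> I \<rightarrow>\<^sub>E S" using that by (auto simp: hop_def PiE_iff extensional_def)
    then show ?thesis using that by (simp add: g_def)
  qed auto
  have int: "integrable P (\<lambda>x. real (x i) * (a + s * real (x l)) * g (h x))"
    "integrable P (\<lambda>x. real (x l) * (a + s * real (x i)) * g (h x))" for h
    by (rule integrable_P[OF il(1-3), where v = "\<lambda>y. a + s * real y", OF id lin g]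
      integrable_P[OF il(2,1,4), where v = "\<lambda>y. a + s * real y", OF id lin g])+
  note ex = exchange[OF il(1-3), where f = g, OF g] exchange[OF il(2,1,4), where f = g, OF g]
  define T where "T x = real (x i) * (a + s * real (x l)) * (g (hop i l x) - g x)
    + real (x l) * (a + s * real (x i)) * (g (hop l i x) - g x)" for x
  have "integrable P T" "integral\<^sup>L P T = 0"
    unfolding T_def[abs_def] using int[of "hop i l"] int[of "hop l i"] int[of "\<lambda>x. x"] ex
    by (simp_all add: right_diff_distrib mult.commute[of "a + s * _"])
  moreover have "real (x i) * (a + s * real (x l)) * (f (hop i l x) - f x)
      + real (x l) * (a + s * real (x i)) * (f (hop l i x) - f x) = T x" if "x \<in> I \<rightarrow>\<^sub>E S" for x
    unfolding T_def eqs[OF that il(1-3)] eqs[OF that il(2,1,4)] ..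
  ultimately show "\<exists>g. (\<forall>x\<in>I \<rightarrow>\<^sub>E S. real (x i) * (a + s * real (x l)) * (f (hop i l x) - f x)
      + real (x l) * (a + s * real (x i)) * (f (hop l i x) - f x) = g x) \<and> integrable P g \<and> integral\<^sup>L P g = 0"
    by (intro exI[of _ T]) simp
qed

end

section \<open>Binomial, Poisson and negative binomial marginals\<close>

lemma stationary_sep:
  assumes G: "pair_graph G" "pverts G = I" and p: "0 < p" "p < 1"
  shows "stationary (sep_gen J G) (I \<rightarrow>\<^sub>E {0..J}) (bounded_functions (I \<rightarrow>\<^sub>E {0..J}))
    (\<Pi>\<^sub>M i\<in>I. measure_pmf (binomial_pmf J p))"
  unfolding sep_gen_eq_hop_gen
proof (rule stationary_hop_gen[where c = "p / (1 - p)", OF measure_pmf_eq_density pmf_nonneg _ _ _ _ _ _ _ G])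
  interpret pair_graph G by fact
  show "finite I" using G(2) by auto
  have absorb: "real (Suc n) * real (J choose Suc n) = real (J - n) * real (J choose n)" for n
    unfolding of_nat_mult[symmetric] by (metis Suc_times_binomial_eq binomial_absorb_comp binomial_absorption)
  fix x
  show "x \<notin> {0..J} \<Longrightarrow> pmf (binomial_pmf J p) x = 0" using p by simp
  show "(real x + 1) * pmf (binomial_pmf J p) (Suc x) = p / (1 - p) * (real J + - 1 * real x) * pmf (binomial_pmf J p) x"
  proof (cases "Suc x \<le> J")
    case True
    then have J: "J - x = Suc (J - Suc x)" by simp
    show ?thesis
      using arg_cong[OF absorb[of x], of "\<lambda>z. z * p * p ^ x * (1 - p) ^ (J - Suc x)"] p True
      unfolding of_nat_diff[OF Suc_leD[OF True]]
      by (simp add: J) (simp only: mult_ac add.commute)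
  next
    case False
    then show ?thesis using p by (cases "x = J") (auto simp: binomial_eq_0)
  qed
  show "summable (\<lambda>x. (1 + real x) * pmf (binomial_pmf J p) x)"
    using p by (intro summable_finite[of "{..J}"]) auto
  show "x \<in> {0..J} \<Longrightarrow> real J + - 1 * real x \<noteq> 0 \<Longrightarrow> Suc x \<in> {0..J}" by auto
qed (auto simp: measure_pmf.prob_space_axioms)

lemma stationary_irw:
  assumes G: "pair_graph G" "pverts G = I" and c: "0 < c"
  shows "stationary (irw_gen G) (I \<rightarrow>\<^sub>E UNIV) (bounded_functions (I \<rightarrow>\<^sub>E UNIV))
    (\<Pi>\<^sub>M i\<in>I. measure_pmf (poisson_pmf c))"
  unfolding irw_gen_eq_hop_gen
proof (rule stationary_hop_gen[where c = c, OF measure_pmf_eq_density pmf_nonneg _ _ _ _ _ _ _ G])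
  interpret pair_graph G by fact
  show "finite I" using G(2) by auto
  fix x
  show "(real x + 1) * pmf (poisson_pmf c) (Suc x) = c * (1 + 0 * real x) * pmf (poisson_pmf c) x"
    using c by (simp add: divide_simps)
  show "summable (\<lambda>x. (1 + real x) * pmf (poisson_pmf c) x)"
  \<comment> \<open>The bound 1 + x \<le> 2^x compares the moment series with the exponential series
    at 2c.\<close>
  proof (rule summable_comparison_test'[of "\<lambda>x. (2 * c) ^ x / fact x" 0])
    show "summable (\<lambda>x. (2 * c) ^ x / fact x)"
      using summable_exp[of "2 * c"] by (simp add: divide_inverse mult.commute)
    show "norm ((1 + real x) * pmf (poisson_pmf c) x) \<le> (2 * c) ^ x / fact x" for x
    proof -
      have "1 + real x \<le> 2 ^ x"
        using of_nat_mono[OF Suc_leI[OF less_exp[of x]], where 'a = real] by simp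
      then have "(1 + real x) * (c ^ x / fact x * exp (- c)) \<le> 2 ^ x * (c ^ x / fact x * 1)"
        using c by (intro mult_mono) auto
      then show ?thesis using c by (simp add: power_mult_distrib)
    qed
  qed
qed (auto simp: measure_pmf.prob_space_axioms)

text \<open>Newton's binomial series for (1 - p)^(-a), as multichoose a x is (-1)^x times the
  generalised binomial coefficient of - a over x.\<close>

lemma multichoose_sums:
  assumes "0 < a" "0 < p" "p < (1::real)"
  shows "(\<lambda>x. multichoose a x * p ^ x) sums ((1 - p) powr - a)"
proof -
  have "multichoose a x * p ^ x = (- a gchoose x) * (- p) ^ x" for x
  proof -
    have "multichoose a x = pochhammer a x / fact x"
      using assms by (simp add: multichoose_def pochhammer_Gamma nonpos_Ints_def)
    moreover have "(- 1) ^ x * (- p) ^ x = p ^ x" by (simp flip: power_mult_distrib)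
    ultimately show ?thesis by (simp add: gbinomial_pochhammer mult_ac)
  qed
  then show ?thesis using gen_binomial_real[of "- p" "- a"] assms by simp
qed

lemma stationary_sip:
  assumes G: "pair_graph G" "pverts G = I" and k: "0 < k" and p: "0 < p" "p < 1"
  shows "stationary (sip_gen k G) (I \<rightarrow>\<^sub>E UNIV) (bounded_functions (I \<rightarrow>\<^sub>E UNIV))
    (\<Pi>\<^sub>M i\<in>I. neg_binomial_distr (2 * k) p)"
  unfolding sip_gen_eq_hop_gen
proof -
  define a where "a = 2 * k"
  define w where "w x = multichoose a x * p ^ x * (1 - p) powr a" for x
  have a: "0 < a" using k by (simp add: a_def)
  have w: "w x \<ge> 0" for x
    using multichoose_pos[OF a, of x] p by (simp add: w_def)
  have \<mu>: "neg_binomial_distr a p = density (count_space UNIV) (\<lambda>x. ennreal (w x))"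
    by (simp add: neg_binomial_distr_def w_def)
  have sums: "w sums 1"
    using sums_mult2[OF multichoose_sums[OF a p], of "(1 - p) powr a"] p
    by (simp add: w_def[abs_def] flip: powr_add)
  have prob: "prob_space (neg_binomial_distr a p)"
  proof
    have "emeasure (neg_binomial_distr a p) (space (neg_binomial_distr a p)) = (\<integral>\<^sup>+ x. ennreal (w x) \<partial>count_space UNIV)"
      unfolding \<mu> by (subst emeasure_density) auto
    also have "\<dots> = ennreal (\<Sum>x. w x)"
      unfolding nn_integral_count_space_nat using w sums by (intro suminf_ennreal2) (auto simp: sums_iff)
    also have "\<dots> = 1" using sums by (simp add: sums_iff)
    finally show "emeasure (neg_binomial_distr a p) (space (neg_binomial_distr a p)) = 1" .
  qed
  have step: "real (Suc x) * multichoose a (Suc x) = (a + real x) * multichoose a x" for x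
    by (rule multichoose_Suc[OF a])
  \<comment> \<open>A first moment for the parameter a becomes a total mass for a + 1, which
    \<open>multichoose_sums\<close> controls.\<close>
  have raise: "(a + real x) * multichoose a x = a * multichoose (a + 1) x" for x
  proof -
    have "Gamma (a + 1) = a * Gamma a" "Gamma (a + 1 + real x) = (a + real x) * Gamma (a + real x)"
      using Gamma_plus1[of a] Gamma_plus1[of "a + real x"] a by (force simp: add_ac nonpos_Ints_def)+
    then show ?thesis using a by (simp add: multichoose_def)
  qed
  have "summable (\<lambda>x. a * (multichoose (a + 1) x * p ^ x) * (1 - p) powr a)"
    using multichoose_sums[of "a + 1" p] a p by (intro summable_mult summable_mult2) (auto simp: sums_iff)
  then have "summable (\<lambda>x. (a + real x) * w x)"
    by (simp add: w_def mult.assoc[symmetric] raise)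
  \<comment> \<open>The factor 1 + 1 / a makes the bound dominate 1 + x for small a as well.\<close>
  then have "summable (\<lambda>x. (1 + 1 / a) * ((a + real x) * w x))"
    by (rule summable_mult)
  then have moment: "summable (\<lambda>x. (1 + real x) * w x)"
  proof (rule summable_comparison_test'[where N = 0])
    fix x
    have "1 + real x \<le> (1 + 1 / a) * (a + real x)" using a by (simp add: field_simps)
    from mult_right_mono[OF this w[of x]]
    show "norm ((1 + real x) * w x) \<le> (1 + 1 / a) * ((a + real x) * w x)" using w[of x] by simp
  qed
  interpret pair_graph G by fact
  have I: "finite I" using G(2) by auto
  have "stationary (hop_gen 1 a G) (I \<rightarrow>\<^sub>E UNIV) (bounded_functions (I \<rightarrow>\<^sub>E UNIV)) (\<Pi>\<^sub>M i\<in>I. neg_binomial_distr a p)"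
  proof (rule stationary_hop_gen[where c = p, OF \<mu> w prob moment I _ _ _ _ G])
    show "(real x + 1) * w (Suc x) = p * (a + 1 * real x) * w x" for x
      using arg_cong[OF step[of x], of "\<lambda>z. z * p * p ^ x * (1 - p) powr a"] by (simp add: w_def mult_ac add.commute)
  qed simp_all
  then show "stationary (hop_gen 1 (2 * k) G) (I \<rightarrow>\<^sub>E UNIV) (bounded_functions (I \<rightarrow>\<^sub>E UNIV))
    (\<Pi>\<^sub>M i\<in>I. neg_binomial_distr (2 * k) p)" by (simp add: a_def)
qed

section \<open>Stationary measures of the diffusions\<close>

text \<open>Continuity refers to the product topology on all functions, measurability to the product
  over I on extensional functions. Coordinates outside I are constantly \<open>undefined\<close>, so
  Borel functions of the former kind are measurable in the latter sense.\<close>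

lemma measurable_PiM_borel:
  "(\<lambda>x. x) \<in> measurable (Pi\<^sub>M (I :: 'i::countable set) (\<lambda>_. borel :: real measure)) borel"
proof (rule measurable_coordinatewise_then_product)
  fix i :: 'i
  show "(\<lambda>x. x i) \<in> borel_measurable (Pi\<^sub>M I (\<lambda>_. borel :: real measure))"
  proof (cases "i \<in> I")
    case False
    have "(\<lambda>x. x i) \<in> borel_measurable (Pi\<^sub>M I (\<lambda>_. borel :: real measure)) \<longleftrightarrow>
        (\<lambda>x. undefined :: real) \<in> borel_measurable (Pi\<^sub>M I (\<lambda>_. borel :: real measure))"
      by (rule measurable_cong) (use False in \<open>auto simp: space_PiM PiE_def extensional_def\<close>)
    then show ?thesis by simp
  qed simp
qed

section \<open>Topology of the configuration space and integration by parts at one site\<close>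

lemma continuous_on_fun_upd:
  fixes x :: "'i \<Rightarrow> 'a::topological_space"
  shows "continuous_on A (\<lambda>t. x(i := t))"
proof (rule continuous_on_coordinatewise_then_product)
  show "continuous_on A (\<lambda>t. (x(i := t)) j)" for j
    by (cases "j = i") auto
qed

lemma continuous_on_component: "continuous_on A (\<lambda>x. x i)"
  by (rule continuous_on_subset[OF continuous_on_product_coordinates]) simp

lemma closed_PiE_closed:
  assumes "closed (S :: real set)"
  shows "closed (I \<rightarrow>\<^sub>E S)"
proof -
  have "I \<rightarrow>\<^sub>E S = (\<Inter>i. (\<lambda>x. x i) -` (if i \<in> I then S else {undefined}))"
    by (auto simp: PiE_iff extensional_def split: if_splits)
  also have "closed \<dots>"
    using assms by (intro closed_INT ballI closed_vimage continuous_on_component) auto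
  finally show ?thesis .
qed

text \<open>The Stein operator of the density $\rho$ is $\phi \mapsto \kappa\phi + \tau\phi'$ with
  $(\tau\rho)' = \kappa\rho$.  BMP uses $\tau = 1$, BEP uses $\tau(y) = y$.\<close>

locale stein =
  fixes N :: nat and S :: "real set" and \<rho> \<tau> \<kappa> :: "real \<Rightarrow> real" and \<mu> :: "real measure"
  assumes S: "S = UNIV \<or> S = {0..}"
    and \<rho>_nonneg: "\<And>y. \<rho> y \<ge> 0" and \<rho>_borel [measurable]: "\<rho> \<in> borel_measurable borel"
    and \<mu>: "\<mu> = density lborel (\<lambda>y. ennreal (\<rho> y))"
    and prob: "prob_space \<mu>"
    and \<rho>_outside: "\<And>y. y \<notin> S \<Longrightarrow> \<rho> y = 0"
    and \<tau>\<rho>_cont: "continuous_on S (\<lambda>y. \<tau> y * \<rho> y)"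
    and \<tau>\<rho>_deriv: "\<And>y. y \<in> interior S \<Longrightarrow> ((\<lambda>y. \<tau> y * \<rho> y) has_real_derivative \<kappa> y * \<rho> y) (at y)"
    and \<tau>\<rho>_0: "S = {0..} \<Longrightarrow> \<tau> 0 * \<rho> 0 = 0"
    and cont: "continuous_on S \<tau>" "continuous_on S \<kappa>"
begin

abbreviation (input) "\<Omega> \<equiv> {1..N} \<rightarrow>\<^sub>E S"
abbreviation (input) "P \<equiv> Pi\<^sub>M {1..N} (\<lambda>_. \<mu>)"

lemma closed_S: "closed S"
  using S by auto

lemma nontrivial: "y \<in> S \<Longrightarrow> at y within S \<noteq> bot"
  using S at_within_nonneg_neq_bot by auto

lemma sets_\<mu> [measurable_cong]: "sets \<mu> = sets borel"
  by (simp add: \<mu>)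

lemma sets_P: "sets P = sets (Pi\<^sub>M {1..N} (\<lambda>_. borel))"
  by (intro sets_PiM_cong refl sets_\<mu>)

lemma space_P: "space P = {1..N} \<rightarrow>\<^sub>E UNIV"
  by (simp add: space_PiM \<mu>)

lemma AE_S: "AE y in \<mu>. y \<in> S"
  unfolding \<mu>
proof (subst AE_density)
  show "AE y in lborel. 0 < ennreal (\<rho> y) \<longrightarrow> y \<in> S"
    using \<rho>_outside by (intro AE_I2 impI) (rule ccontr, simp)
qed simp

lemma integrable_P:
  fixes f :: "(nat \<Rightarrow> real) \<Rightarrow> real"
  assumes "continuous_on \<Omega> f" "compact K" "K \<subseteq> \<Omega>" "\<And>x. x \<in> \<Omega> - K \<Longrightarrow> f x = 0"
  shows "integrable P (\<lambda>x. indicator \<Omega> x * f x)"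
proof -
  interpret prob_space P by (rule prob_space_PiM) (rule prob)
  have "bounded (f ` K)"
    using assms by (intro compact_imp_bounded compact_continuous_image) (auto intro: continuous_on_subset)
  then obtain B where B: "\<And>x. x \<in> K \<Longrightarrow> \<bar>f x\<bar> \<le> B" by (auto simp: bounded_iff)
  show ?thesis
  proof (rule integrable_const_bound[of _ "\<bar>B\<bar>"])
    show "AE x in P. norm (indicator \<Omega> x * f x) \<le> \<bar>B\<bar>"
    proof (intro AE_I2)
      fix x
      show "norm (indicator \<Omega> x * f x) \<le> \<bar>B\<bar>"
        using B[of x] assms(4)[of x] by (cases "x \<in> \<Omega>"; cases "x \<in> K") auto
    qed
    have "\<Omega> \<in> sets borel" using closed_PiE_closed[OF closed_S] by (rule borel_closed)
    then have "(\<lambda>x. indicator \<Omega> x * f x) \<in> borel_measurable borel"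
      using borel_measurable_continuous_on_indicator[OF _ assms(1)] by simp
    from measurable_compose[OF measurable_PiM_borel this]
    show "(\<lambda>x. indicator \<Omega> x * f x) \<in> borel_measurable P"
      unfolding measurable_cong_sets[OF sets_P refl] .
  qed
qed

text \<open>The integrand against Lebesgue measure is the derivative of
  \<open>\<tau> y * \<rho> y * \<phi> y\<close>, which vanishes at both ends of a compact interval.
  The interior form of the fundamental theorem is used because \<rho> may blow up near 0 (Gamma with
  a < 1); only \<tau> \<rho> is continuous up to the end point.\<close>

lemma stein_identity:
  assumes \<phi>: "\<And>y. y \<in> S \<Longrightarrow> (\<phi> has_real_derivative \<phi>' y) (at y within S)"
    and \<phi>': "continuous_on S \<phi>'"
    and zero: "\<And>y. y \<in> S \<Longrightarrow> \<bar>y\<bar> \<ge> b \<Longrightarrow> \<phi> y = 0" "\<And>y. y \<in> S \<Longrightarrow> \<bar>y\<bar> \<ge> b \<Longrightarrow> \<phi>' y = 0"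
  shows "(\<integral>y. indicator S y * (\<kappa> y * \<phi> y + \<tau> y * \<phi>' y) \<partial>\<mu>) = 0"
proof -
  interpret prob_space \<mu> by (rule prob)
  define c where "c = \<bar>b\<bar> + 1"
  \<comment> \<open>On the half-line the lower end is 0, where \<tau> \<rho> vanishes; on the line
    it lies where \<phi> has already vanished.\<close>
  define lo where "lo = (if S = UNIV then - c else 0)"
  have lo: "lo \<le> c" "{lo..c} \<subseteq> S" "{lo<..<c} \<subseteq> interior S" "lo \<in> S" "c \<in> S" "c > 0" "c \<ge> b"
    using S by (auto simp: lo_def c_def)
  have out: "\<bar>y\<bar> \<ge> b" if "y \<in> S" "y \<notin> {lo..c}" for y
    using that S by (auto simp: lo_def c_def split: if_splits)
  let ?F = "\<lambda>y. \<kappa> y * \<phi> y + \<tau> y * \<phi>' y"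
  have \<phi>_cont: "continuous_on S \<phi>"
    unfolding continuous_on_eq_continuous_within using \<phi> by (blast intro: DERIV_continuous)
  have F_cont: "continuous_on S ?F" by (intro continuous_intros cont \<phi>_cont \<phi>')
  define G where "G y = \<tau> y * \<rho> y * \<phi> y" for y
  have "((\<lambda>y. \<rho> y * ?F y) has_integral (G c - G lo)) {lo..c}"
  proof (rule fundamental_theorem_of_calculus_interior[OF lo(1)])
    show "continuous_on {lo..c} G"
      unfolding G_def using lo(2) by (intro continuous_on_mult continuous_on_subset[OF \<tau>\<rho>_cont] continuous_on_subset[OF \<phi>_cont])
    fix y assume "y \<in> {lo<..<c}"
    then have y: "y \<in> interior S" using lo(3) by blast
    have "(\<phi> has_real_derivative \<phi>' y) (at y)"
      using \<phi>[OF subsetD[OF interior_subset y]] unfolding at_within_interior[OF y] .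
    from DERIV_mult[OF \<tau>\<rho>_deriv[OF y] this]
    show "(G has_vector_derivative \<rho> y * ?F y) (at y)"
      unfolding G_def[abs_def] has_real_derivative_iff_has_vector_derivative[symmetric]
      by (simp add: algebra_simps)
  qed
  moreover have "G c = 0" using zero(1)[OF lo(5)] lo(6,7) by (simp add: G_def)
  moreover have "G lo = 0"
  proof (cases "S = UNIV")
    case True
    then show ?thesis using zero(1)[of lo] lo(6,7) by (simp add: G_def lo_def)
  next
    case False
    then show ?thesis using S \<tau>\<rho>_0 by (auto simp: G_def lo_def)
  qed
  ultimately have int0: "((\<lambda>y. \<rho> y * ?F y) has_integral 0) {lo..c}" by simp
  have eq: "indicator S y * ?F y = indicator {lo..c} y * ?F y" for y
    using zero[of y] out[of y] lo(2) by (auto split: split_indicator)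
  have meas: "(\<lambda>y. indicator S y * ?F y) \<in> borel_measurable borel"
    using borel_measurable_continuous_on_indicator[OF borel_closed[OF closed_S] F_cont] by simp
  have "bounded (?F ` {lo..c})"
    by (intro compact_imp_bounded compact_continuous_image continuous_on_subset[OF F_cont] lo) auto
  then have "\<exists>B. \<forall>y\<in>{lo..c}. \<bar>?F y\<bar> \<le> B" unfolding bounded_iff by simp
  then obtain B where B: "\<And>y. y \<in> {lo..c} \<Longrightarrow> \<bar>?F y\<bar> \<le> B" by blast
  \<comment> \<open>Integrability is obtained for the probability measure, where bounded integrands
    are enough, and then transferred to Lebesgue measure; this also covers an unbounded
    \<rho>.\<close>
  have "integrable \<mu> (\<lambda>y. indicator S y * ?F y)"
  proof (rule integrable_const_bound[of _ "\<bar>B\<bar>"])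
    show "AE y in \<mu>. norm (indicator S y * ?F y) \<le> \<bar>B\<bar>"
      unfolding eq
    proof (intro AE_I2)
      fix y
      show "norm (indicator {lo..c} y * ?F y) \<le> \<bar>B\<bar>"
        using B[of y] by (cases "y \<in> {lo..c}") auto
    qed
    show "(\<lambda>y. indicator S y * ?F y) \<in> borel_measurable \<mu>"
      unfolding measurable_cong_sets[OF sets_\<mu> refl] by (rule meas)
  qed
  moreover have meas': "(\<lambda>y. indicator S y * ?F y) \<in> borel_measurable lborel" "\<rho> \<in> borel_measurable lborel"
    using meas by simp_all
  note dens = meas' AE_I2[OF \<rho>_nonneg]
  ultimately have "integrable lborel (\<lambda>y. \<rho> y *\<^sub>R (indicator S y * ?F y))"
    unfolding \<mu> integrable_density[OF dens] by simp
  moreover have swap: "\<rho> y *\<^sub>R (indicator S y * ?F y) = indicator {lo..c} y *\<^sub>R (\<rho> y * ?F y)" for y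
    unfolding eq real_scaleR_def by (rule mult.left_commute)
  ultimately have "set_integrable lborel {lo..c} (\<lambda>y. \<rho> y * ?F y)"
    unfolding set_integrable_def swap by simp
  then have "(LINT y:{lo..c}|lborel. \<rho> y * ?F y) = 0"
    using integral_unique[OF int0] by (simp only: set_borel_integral_eq_integral(2))
  moreover have "(\<integral>y. indicator S y * ?F y \<partial>\<mu>) = (LINT y:{lo..c}|lborel. \<rho> y * ?F y)"
    unfolding \<mu> set_lebesgue_integral_def integral_density[OF dens] swap ..
  ultimately show ?thesis by simp
qed

section \<open>Calculus on the state space and the Stein identity on the product\<close>

lemma upd_\<Omega>: "x \<in> \<Omega> \<Longrightarrow> i \<in> {1..N} \<Longrightarrow> y \<in> S \<Longrightarrow> x(i := y) \<in> \<Omega>"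
  by (auto simp: PiE_iff extensional_def)

lemma C1_on_has_derivative:
  assumes "C1_on N S f" "i \<in> {1..N}" "x \<in> \<Omega>"
  shows "((\<lambda>t. f (x(i := t))) has_real_derivative pd S i f x) (at (x i) within S)"
  using assms unfolding C1_on_def pd_def has_real_derivative_iff_has_vector_derivative
  by (simp add: vector_derivative_works)

lemma C1_onI:
  assumes "continuous_on \<Omega> f"
    and D: "\<And>i x. i \<in> {1..N} \<Longrightarrow> x \<in> \<Omega> \<Longrightarrow> ((\<lambda>t. f (x(i := t))) has_real_derivative D i x) (at (x i) within S)"
    and "\<And>i. i \<in> {1..N} \<Longrightarrow> continuous_on \<Omega> (D i)"
  shows "C1_on N S f" and "\<And>i x. i \<in> {1..N} \<Longrightarrow> x \<in> \<Omega> \<Longrightarrow> pd S i f x = D i x"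
proof -
  show pd: "pd S i f x = D i x" if "i \<in> {1..N}" "x \<in> \<Omega>" for i x
    using that by (intro pd_eqI D nontrivial) (auto simp: PiE_iff)
  show "C1_on N S f"
    unfolding C1_on_def
  proof (intro conjI ballI assms(1))
    fix i assume i: "i \<in> {1..N}"
    show "continuous_on \<Omega> (pd S i f)" using assms(3)[OF i] pd[OF i] by (simp cong: continuous_on_cong)
    show "(\<lambda>t. f (x(i := t))) differentiable at (x i) within S" if "x \<in> \<Omega>" for x
      using D[OF i that] by (auto simp: has_field_derivative_def differentiable_def)
  qed
qed

lemma C1_on_mult:
  assumes f: "C1_on N S f" and g: "C1_on N S g"
  shows "C1_on N S (\<lambda>x. f x * g x)"
    and "i \<in> {1..N} \<Longrightarrow> x \<in> \<Omega> \<Longrightarrow> pd S i (\<lambda>x. f x * g x) x = pd S i f x * g x + f x * pd S i g x"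
proof -
  define D where "D i x = pd S i f x * g x + f x * pd S i g x" for i x
  have "((\<lambda>t. f (x(i := t)) * g (x(i := t))) has_real_derivative D i x) (at (x i) within S)"
    if "i \<in> {1..N}" "x \<in> \<Omega>" for i x
    using DERIV_mult[OF C1_on_has_derivative[OF f that] C1_on_has_derivative[OF g that]]
    by (simp add: D_def mult.commute)
  note * = C1_onI[of "\<lambda>x. f x * g x" D, OF _ this]
  show "C1_on N S (\<lambda>x. f x * g x)"
    using f g unfolding C1_on_def by (intro *(1)[unfolded C1_on_def]) (auto simp: D_def[abs_def] intro!: continuous_intros)
  show "pd S i (\<lambda>x. f x * g x) x = pd S i f x * g x + f x * pd S i g x" if "i \<in> {1..N}" "x \<in> \<Omega>"
    using f g that unfolding C1_on_def D_def[symmetric] by (intro *(2)) (auto simp: D_def[abs_def] intro!: continuous_intros)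
qed

lemma C1_on_diff:
  assumes f: "C1_on N S f" and g: "C1_on N S g"
  shows "C1_on N S (\<lambda>x. f x - g x)"
    and "i \<in> {1..N} \<Longrightarrow> x \<in> \<Omega> \<Longrightarrow> pd S i (\<lambda>x. f x - g x) x = pd S i f x - pd S i g x"
proof -
  define D where "D i x = pd S i f x - pd S i g x" for i x
  have "((\<lambda>t. f (x(i := t)) - g (x(i := t))) has_real_derivative D i x) (at (x i) within S)"
    if "i \<in> {1..N}" "x \<in> \<Omega>" for i x
    using DERIV_diff[OF C1_on_has_derivative[OF f that] C1_on_has_derivative[OF g that]]
    by (simp add: D_def)
  note * = C1_onI[of "\<lambda>x. f x - g x" D, OF _ this]
  show "C1_on N S (\<lambda>x. f x - g x)"
    using f g unfolding C1_on_def by (intro *(1)[unfolded C1_on_def]) (auto simp: D_def[abs_def] intro!: continuous_intros)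
  show "pd S i (\<lambda>x. f x - g x) x = pd S i f x - pd S i g x" if "i \<in> {1..N}" "x \<in> \<Omega>"
    using f g that unfolding C1_on_def D_def[symmetric] by (intro *(2)) (auto simp: D_def[abs_def] intro!: continuous_intros)
qed

lemma C1_on_component:
  shows "C1_on N S (\<lambda>x. x j)"
    and "i \<in> {1..N} \<Longrightarrow> x \<in> \<Omega> \<Longrightarrow> pd S i (\<lambda>x. x j) x = (if i = j then 1 else 0)"
proof -
  define D where "D i x = (if i = j then 1 else 0 :: real)" for i and x :: "nat \<Rightarrow> real"
  have "((\<lambda>t. (x(i := t)) j) has_real_derivative D i x) (at (x i) within S)" for i x
    by (auto simp: D_def)
  note * = C1_onI[of "\<lambda>x. x j" D, OF continuous_on_component this]
  show "C1_on N S (\<lambda>x. x j)" by (rule *(1)) (simp add: D_def[abs_def])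
  show "pd S i (\<lambda>x. x j) x = (if i = j then 1 else 0)" if "i \<in> {1..N}" "x \<in> \<Omega>"
    unfolding D_def[symmetric, of i x] using that by (intro *(2)) (auto simp: D_def[abs_def])
qed

text \<open>K is closed, so near x the coordinate line through x avoids K and f vanishes there. Edge
  derivatives therefore keep the support in K.\<close>

lemma pd_eq_0_outside:
  assumes "compact K" "\<forall>x\<in>\<Omega> - K. f x = 0" "i \<in> {1..N}" "x \<in> \<Omega> - K"
  shows "pd S i f x = 0"
proof (rule pd_eqI)
  have "open (- K)" using assms(1) by (simp add: compact_imp_closed open_Compl)
  then have "open ((\<lambda>t. x(i := t)) -` (- K))"
    by (rule open_vimage[OF _ continuous_on_fun_upd])
  moreover have "x i \<in> (\<lambda>t. x(i := t)) -` (- K)" using assms(4) by simp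
  ultimately obtain e where e: "e > 0" "\<And>t. dist t (x i) < e \<Longrightarrow> t \<in> (\<lambda>t. x(i := t)) -` (- K)"
    unfolding open_dist by blast
  show "((\<lambda>t. f (x(i := t))) has_real_derivative 0) (at (x i) within S)"
  proof (rule has_field_derivative_transform_within[OF DERIV_const e(1)])
    show "x i \<in> S" using assms(3,4) by (auto simp: PiE_iff)
    show "0 = f (x(i := t))" if "t \<in> S" "dist t (x i) < e" for t
      using assms(2)[rule_format, of "x(i := t)"] e(2)[OF that(2), simplified] upd_\<Omega>[OF _ assms(3) that(1), of x] assms(4) by auto
  qed
  show "at (x i) within S \<noteq> bot" using assms(3,4) by (intro nontrivial) (auto simp: PiE_iff)
qed

text \<open>With the other coordinates frozen this is \<open>stein_identity\<close> for h along site
  i, where the weight c is constant. In the applications h is a first-order edge derivative and c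
  the coordinate at the other end of the edge.\<close>

lemma stein_site:
  assumes h: "C1_on N S h" and K: "compact K" "K \<subseteq> \<Omega>" "\<forall>x\<in>\<Omega> - K. h x = 0"
    and i: "i \<in> {1..N}" and c: "continuous_on \<Omega> c" "\<And>x y. c (x(i := y)) = c x"
  defines "g \<equiv> \<lambda>x. indicator \<Omega> x * (c x * (\<kappa> (x i) * h x + \<tau> (x i) * pd S i h x))"
  shows "integrable P g" "integral\<^sup>L P g = 0"
proof -
  have pd0: "pd S i h x = 0" if "x \<in> \<Omega> - K" for x
    by (rule pd_eq_0_outside[OF K(1,3) i that])
  have comp: "continuous_on \<Omega> (\<lambda>x. \<phi> (x i))" if "continuous_on S \<phi>" for \<phi> :: "real \<Rightarrow> real"
    by (rule continuous_on_compose2[OF that continuous_on_component]) (use i in \<open>auto simp: PiE_iff\<close>)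
  have hc: "continuous_on \<Omega> h" "continuous_on \<Omega> (pd S i h)" using h i by (auto simp: C1_on_def)
  show int: "integrable P g"
    unfolding g_def
    by (rule integrable_P[OF _ K(1,2)])
      ((intro continuous_intros c(1) comp cont hc)[1], simp add: K(3)[rule_format] pd0 del: One_nat_def)
  show "integral\<^sup>L P g = 0"
  proof (rule integral_PiM_eq_0[OF _ i prob int])
    fix x assume "x \<in> space P"
    show "(\<integral>y. g (x(i := y)) \<partial>\<mu>) = 0"
    \<comment> \<open>If the other coordinates already leave the state space, g vanishes on the
      whole line; otherwise only y in S matters.\<close>
    proof (cases "\<exists>z. x(i := z) \<in> \<Omega>")
      case False
      then show ?thesis by (simp add: g_def)
    next
      case True
      then obtain z where z: "x(i := z) \<in> \<Omega>" by blast
      have mem: "x(i := y) \<in> \<Omega> \<longleftrightarrow> y \<in> S" for y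
        using upd_\<Omega>[OF z i, of y] PiE_mem[OF _ i, of "x(i := y)" "\<lambda>_. S"] by auto
      have "bounded ((\<lambda>x. x i) ` K)"
        using K(1) by (intro compact_imp_bounded compact_continuous_image continuous_on_component)
      then obtain b where b: "\<And>x. x \<in> K \<Longrightarrow> \<bar>x i\<bar> \<le> b"
        unfolding bounded_iff by auto
      have out: "x(i := y) \<in> \<Omega> - K" if "y \<in> S" "\<bar>y\<bar> \<ge> b + 1" for y
        using mem[of y] that b[of "x(i := y)"] by auto
      have "(\<integral>y. indicator S y * (\<kappa> y * h (x(i := y)) + \<tau> y * pd S i h (x(i := y))) \<partial>\<mu>) = 0"
      proof (rule stein_identity[where b = "b + 1"])
        fix y assume y: "y \<in> S"
        show "((\<lambda>y. h (x(i := y))) has_real_derivative pd S i h (x(i := y))) (at y within S)"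
          using C1_on_has_derivative[OF h i, of "x(i := y)"] mem[of y] y by simp
        show "h (x(i := y)) = 0" "pd S i h (x(i := y)) = 0" if "b + 1 \<le> \<bar>y\<bar>"
          using K(3)[rule_format, OF out] pd0[OF out] y that by auto
      next
        show "continuous_on S (\<lambda>y. pd S i h (x(i := y)))"
          by (rule continuous_on_compose2[OF hc(2) continuous_on_fun_upd]) (use mem in auto)
      qed
      moreover have "g (x(i := y)) = c x * (indicator S y * (\<kappa> y * h (x(i := y)) + \<tau> y * pd S i h (x(i := y))))" for y
        using mem[of y] by (simp add: g_def c(2) split: split_indicator)
      ultimately show ?thesis by simp
    qed
  qed simp
qed

end

text \<open>An edge term is the rotation field applied to h = rotation f. The Stein identity at l
  with weight x_i and the one at i with weight x_l both contain - x_i x_l h / \<sigma>^2; it cancels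
  in their difference, which is the integral of the rotation of h.\<close>

lemma stationary_bmp:
  assumes G: "pair_graph G" "pverts G = {1..N}" and \<sigma>: "0 < \<sigma>"
  shows "stationary (bmp_gen G) ({1..N} \<rightarrow>\<^sub>E UNIV) (C2_compact N UNIV)
    (\<Pi>\<^sub>M i\<in>{1..N}. density lborel (normal_density 0 \<sigma>))"
proof -
  define \<mu> where "\<mu> = density lborel (normal_density 0 \<sigma>)"
  define C where "C = sqrt (2 * pi * \<sigma>\<^sup>2)"
  have nd: "normal_density 0 \<sigma> = (\<lambda>y. exp (- y\<^sup>2 / (2 * \<sigma>\<^sup>2)) / C)"
    by (simp add: normal_density_def C_def fun_eq_iff)
  have C: "C \<noteq> 0" using \<sigma> by (simp add: C_def)
  have D: "(normal_density 0 \<sigma> has_real_derivative - y / \<sigma>\<^sup>2 * normal_density 0 \<sigma> y) (at y)" for y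
    unfolding nd using \<sigma> C by (auto intro!: derivative_eq_intros simp: power2_eq_square mult_ac)
  interpret stein N UNIV "normal_density 0 \<sigma>" "\<lambda>_. 1" "\<lambda>y. - y / \<sigma>\<^sup>2" \<mu>
  proof (rule stein.intro)
    show D': "((\<lambda>y. 1 * normal_density 0 \<sigma> y) has_real_derivative - y / \<sigma>\<^sup>2 * normal_density 0 \<sigma> y) (at y)" for y
      using D[of y] by simp
    show "continuous_on UNIV (\<lambda>y. 1 * normal_density 0 \<sigma> y)"
      by (rule DERIV_continuous_on[OF D'])
    show "prob_space \<mu>"
      unfolding \<mu>_def by (rule prob_space_normal_density[OF \<sigma>])
    show "(UNIV :: real set) = {0..} \<Longrightarrow> 1 * normal_density 0 \<sigma> 0 = 0"
      by (drule arg_cong[where f = "\<lambda>A. - 1 \<in> A"]) simp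
    show "continuous_on UNIV (\<lambda>y. - y / \<sigma>\<^sup>2)" using \<sigma> by (intro continuous_intros) simp
  qed (simp_all add: \<mu>_def)
  have "stationary (\<lambda>f x. \<Sum>(i, l)\<in>edges G. rotation i l (rotation i l f) x) \<Omega> (C2_compact N UNIV) P"
  proof (rule stationary_sumI[OF finite_edges[OF G(1)] _ prob])
    fix f i l assume f: "f \<in> C2_compact N UNIV" and e: "(i, l) \<in> edges G"
    have il: "i \<in> {1..N}" "l \<in> {1..N}" "i \<noteq> l" using edges_subset[OF G e] by auto
    have C1: "C1_on N UNIV (pd UNIV j f)" if "j \<in> {1..N}" for j
      using f that by (simp add: C2_compact_def)
    have "\<exists>K. compact K \<and> K \<subseteq> \<Omega> \<and> (\<forall>x\<in>\<Omega> - K. f x = 0)"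
      using f by (simp add: C2_compact_def)
    then obtain K where K: "compact K" "K \<subseteq> \<Omega>" "\<forall>x\<in>\<Omega> - K. f x = 0" by auto
    define h where "h = rotation i l f"
    have h: "C1_on N UNIV h"
      unfolding h_def rotation_def[abs_def] by (intro C1_on_diff(1) C1_on_mult(1) C1_on_component(1) C1 il)
    have h0: "\<forall>x\<in>\<Omega> - K. h x = 0"
      unfolding h_def rotation_def
      by (intro ballI) (simp only: pd_eq_0_outside[OF K(1,3)] il mult_zero_right diff_self)
    have upd: "(x(l := y)) i = x i" "(x(i := y)) l = x l" for x :: "nat \<Rightarrow> real" and y
      using il(3) by simp_all
    note s1 = stein_site[OF h K(1,2) h0 il(2) continuous_on_component upd(1)]
      and s2 = stein_site[OF h K(1,2) h0 il(1) continuous_on_component upd(2)]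
    define g where "g x = indicator \<Omega> x * (x i * (- x l / \<sigma>\<^sup>2 * h x + 1 * pd UNIV l h x))
      - indicator \<Omega> x * (x l * (- x i / \<sigma>\<^sup>2 * h x + 1 * pd UNIV i h x))" for x
    have "rotation i l h x = g x" if "x \<in> \<Omega>" for x
      using that by (simp add: g_def rotation_def[of i l h] algebra_simps del: One_nat_def)
    moreover have "integrable P g" "integral\<^sup>L P g = 0"
      using Bochner_Integration.integrable_diff[OF s1(1) s2(1)] Bochner_Integration.integral_diff[OF s1(1) s2(1)]
      unfolding g_def[abs_def] s1(2) s2(2) by (simp_all only: diff_self)
    ultimately show "\<exists>g. (\<forall>x\<in>\<Omega>. rotation i l (rotation i l f) x = g x) \<and> integrable P g \<and> integral\<^sup>L P g = 0"
      unfolding h_def by blast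
  qed (auto simp: sets_\<mu>)
  then show ?thesis by (simp add: bmp_gen_def[abs_def] \<mu>_def)
qed

section \<open>The Gamma law and the Brownian energy process\<close>

definition gamma_density :: "real \<Rightarrow> real \<Rightarrow> real \<Rightarrow> real" where
  "gamma_density a \<theta> x = (if 0 < x then x powr (a - 1) * exp (- x / \<theta>) / (Gamma a * \<theta> powr a) else 0)"

lemma gamma_distr_eq: "gamma_distr a \<theta> = density lborel (\<lambda>x. ennreal (gamma_density a \<theta> x))"
  by (simp add: gamma_distr_def gamma_density_def)

lemma borel_measurable_gamma_density [measurable]: "gamma_density a \<theta> \<in> borel_measurable borel"
  unfolding gamma_density_def[abs_def] by measurable

lemma gamma_density_nonneg: "0 < a \<Longrightarrow> gamma_density a \<theta> x \<ge> 0"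
  using Gamma_real_pos[of a] by (simp add: gamma_density_def)

lemma prob_space_gamma_distr:
  assumes a: "0 < a" and \<theta>: "0 < \<theta>"
  shows "prob_space (gamma_distr a \<theta>)"
proof
  have Ga: "Gamma a > 0" using a by (rule Gamma_real_pos)
  have "((\<lambda>t. t powr (a - 1) / exp t) has_integral Gamma a) {0..}"
    using Gamma_integral_real[OF a] .
  then have "((\<lambda>t. t powr (a - 1) / exp t / Gamma a) has_integral 1) {0..}"
    using has_integral_divide[of _ "Gamma a" "{0..}" "Gamma a"] Ga by fastforce
  then have "((\<lambda>t. if t \<in> {0..} then t powr (a - 1) / exp t / Gamma a else 0) has_integral 1) UNIV"
    by (rule iffD2[OF has_integral_restrict_UNIV])
  \<comment> \<open>The substitution x = \<theta> t reduces the mass to the Gamma integral; the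
    summand 0 matches the affine substitution rule applied below.\<close>
  moreover have "(if t \<in> {0..} then t powr (a - 1) / exp t / Gamma a else 0) = \<theta> * gamma_density a \<theta> (0 + \<theta> * t)" for t
  proof (cases "t > 0")
    case True
    then have "(\<theta> * t) powr (a - 1) = \<theta> powr a / \<theta> * t powr (a - 1)"
      using \<theta> by (simp add: powr_mult powr_diff)
    then show ?thesis using True \<theta> Ga by (simp add: gamma_density_def exp_minus field_simps)
  next
    case False
    then have "\<not> 0 < \<theta> * t" using \<theta> by (simp add: zero_less_mult_iff)
    then show ?thesis using False by (cases "t = 0") (auto simp: gamma_density_def)
  qed
  ultimately have "((\<lambda>t. \<theta> * gamma_density a \<theta> (0 + \<theta> * t)) has_integral 1) UNIV" by simp
  then have "(\<integral>\<^sup>+t. ennreal (\<theta> * gamma_density a \<theta> (0 + \<theta> * t)) \<partial>lborel) = ennreal 1"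
    using gamma_density_nonneg[OF a] \<theta> by (intro nn_integral_has_integral_lborel) auto
  moreover have "(\<integral>\<^sup>+t. ennreal (\<theta> * gamma_density a \<theta> (0 + \<theta> * t)) \<partial>lborel) =
    (\<integral>\<^sup>+x. ennreal (gamma_density a \<theta> x) \<partial>lborel)"
    using \<theta> gamma_density_nonneg[OF a]
    by (subst (2) nn_integral_real_affine[where c = \<theta> and t = 0])
       (auto simp: ennreal_mult' nn_integral_cmult)
  ultimately show "emeasure (gamma_distr a \<theta>) (space (gamma_distr a \<theta>)) = 1"
    unfolding gamma_distr_eq by (subst emeasure_density) auto
qed

text \<open>With h = pd_diff f, an edge term is x_l times the Stein operator at i minus x_i times
  the one at l, both applied to h: the parts x_i x_l h / \<theta> cancel and a (x_l - x_i) h remains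
  as the drift.\<close>

lemma stationary_bep:
  assumes G: "pair_graph G" "pverts G = {1..N}" and k: "0 < k" and \<theta>: "0 < \<theta>"
  shows "stationary (bep_gen k G) ({1..N} \<rightarrow>\<^sub>E {0..}) (C2_compact N {0..})
    (\<Pi>\<^sub>M i\<in>{1..N}. gamma_distr (2 * k) \<theta>)"
proof -
  define a where "a = 2 * k"
  have a: "0 < a" using k by (simp add: a_def)
  define c where "c = Gamma a * \<theta> powr a"
  have c: "c \<noteq> 0" using Gamma_real_pos[OF a] \<theta> by (simp add: c_def)
  have eq: "y * gamma_density a \<theta> y = y powr a * exp (- y / \<theta>) / c" if "y \<ge> 0" for y
    using that a by (cases "y = 0") (simp_all add: gamma_density_def c_def powr_diff)
  interpret stein N "{0..}" "gamma_density a \<theta>" "\<lambda>y. y" "\<lambda>y. a - y / \<theta>" "gamma_distr a \<theta>"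
  proof (rule stein.intro)
    have "continuous_on {0..} (\<lambda>y. y powr a * exp (- y / \<theta>) / c)"
      using a c \<theta> by (intro continuous_intros continuous_on_powr') auto
    then show "continuous_on {0..} (\<lambda>y. y * gamma_density a \<theta> y)"
      using eq by (subst continuous_on_cong[OF refl]) auto
    show "((\<lambda>y. y * gamma_density a \<theta> y) has_real_derivative (a - y / \<theta>) * gamma_density a \<theta> y) (at y)"
      if "y \<in> interior {0..}" for y
    proof -
      have y: "y > 0" using that by simp
      have "((\<lambda>y. y powr a * exp (- y / \<theta>) / c) has_real_derivative
          (a * y powr (a - 1) * exp (- y / \<theta>) + exp (- y / \<theta>) * (- 1 / \<theta>) * y powr a) / c) (at y)"
        using y \<theta> c by (auto intro!: derivative_eq_intros)
      also have "(a * y powr (a - 1) * exp (- y / \<theta>) + exp (- y / \<theta>) * (- 1 / \<theta>) * y powr a) / c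
          = (a - y / \<theta>) * gamma_density a \<theta> y"
        using y by (simp add: gamma_density_def c_def[symmetric] powr_diff field_simps)
      finally show ?thesis
        by (rule has_field_derivative_transform_within_open[of _ _ _ "{0<..}"]) (use y eq in auto)
    qed
    show "prob_space (gamma_distr a \<theta>)" by (rule prob_space_gamma_distr[OF a \<theta>])
    show "gamma_distr a \<theta> = density lborel (\<lambda>y. ennreal (gamma_density a \<theta> y))" by (rule gamma_distr_eq)
    show "gamma_density a \<theta> y \<ge> 0" for y by (rule gamma_density_nonneg[OF a])
    show "gamma_density a \<theta> y = 0" if "y \<notin> {0..}" for y using that by (simp add: gamma_density_def)
    show "continuous_on {0..} (\<lambda>y. a - y / \<theta>)" using \<theta> by (intro continuous_intros) simp
  qed simp_all
  have "stationary (\<lambda>f x. \<Sum>(i, l)\<in>edges G. x i * x l * pd_diff i l (pd_diff i l f) x - a * (x i - x l) * pd_diff i l f x)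
     \<Omega> (C2_compact N {0..}) P"
  proof (rule stationary_sumI[OF finite_edges[OF G(1)] _ prob])
    fix f i l assume f: "f \<in> C2_compact N {0..}" and e: "(i, l) \<in> edges G"
    have il: "i \<in> {1..N}" "l \<in> {1..N}" "i \<noteq> l" using edges_subset[OF G e] by auto
    have C1: "C1_on N {0..} (pd {0..} j f)" if "j \<in> {1..N}" for j
      using f that by (simp add: C2_compact_def)
    have "\<exists>K. compact K \<and> K \<subseteq> \<Omega> \<and> (\<forall>x\<in>\<Omega> - K. f x = 0)"
      using f by (simp add: C2_compact_def)
    then obtain K where K: "compact K" "K \<subseteq> \<Omega>" "\<forall>x\<in>\<Omega> - K. f x = 0" by auto
    define h where "h = pd_diff i l f"
    have h: "C1_on N {0..} h"
      unfolding h_def pd_diff_def[abs_def] by (intro C1_on_diff(1) C1 il)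
    have h0: "\<forall>x\<in>\<Omega> - K. h x = 0"
      unfolding h_def pd_diff_def
      by (intro ballI) (simp only: pd_eq_0_outside[OF K(1,3)] il diff_self)
    have upd: "(x(l := y)) i = x i" "(x(i := y)) l = x l" for x :: "nat \<Rightarrow> real" and y
      using il(3) by simp_all
    note s1 = stein_site[OF h K(1,2) h0 il(1) continuous_on_component upd(2)]
      and s2 = stein_site[OF h K(1,2) h0 il(2) continuous_on_component upd(1)]
    define g where "g x = indicator \<Omega> x * (x l * ((a - x i / \<theta>) * h x + x i * pd {0..} i h x))
      - indicator \<Omega> x * (x i * ((a - x l / \<theta>) * h x + x l * pd {0..} l h x))" for x
    have "x i * x l * pd_diff i l h x - a * (x i - x l) * h x = g x" if "x \<in> \<Omega>" for x
      using that by (simp add: g_def pd_diff_def[of i l h] algebra_simps del: One_nat_def)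
    moreover have "integrable P g" "integral\<^sup>L P g = 0"
      using Bochner_Integration.integrable_diff[OF s1(1) s2(1)] Bochner_Integration.integral_diff[OF s1(1) s2(1)]
      unfolding g_def[abs_def] s1(2) s2(2) by (simp_all only: diff_self)
    ultimately show "\<exists>g. (\<forall>x\<in>\<Omega>. x i * x l * pd_diff i l (pd_diff i l f) x - a * (x i - x l) * pd_diff i l f x = g x)
        \<and> integrable P g \<and> integral\<^sup>L P g = 0"
      unfolding h_def by blast
  qed (use AE_S in \<open>auto simp: sets_\<mu>\<close>)
  then show ?thesis by (simp add: bep_gen_def[abs_def] a_def)
qed

section \<open>Stationary measures of KMP\<close>

definition kmp_beta :: "real \<Rightarrow> real \<Rightarrow> real" where
  "kmp_beta a p = indicator {0..1} p * kmp_density a p"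

lemma borel_measurable_kmp_beta [measurable]: "kmp_beta a \<in> borel_measurable borel"
  unfolding kmp_beta_def[abs_def] kmp_density_def by measurable

lemma kmp_beta_nonneg: "0 < a \<Longrightarrow> kmp_beta a p \<ge> 0"
  using Gamma_real_pos[of a] Gamma_real_pos[of "2 * a"]
  by (simp add: kmp_beta_def kmp_density_def indicator_def)

definition beta_distr :: "real \<Rightarrow> real measure" where
  "beta_distr a = density lborel (\<lambda>p. ennreal (kmp_beta a p))"

lemma prob_space_beta_distr:
  assumes a: "0 < a"
  shows "prob_space (beta_distr a)"
proof
  have int: "integrable lborel (kmp_beta a)" and one: "integral\<^sup>L lborel (kmp_beta a) = 1"
    using kmp_moments[OF a, of 0 0]
    by (simp_all add: kmp_beta_def[abs_def] set_integrable_def set_lebesgue_integral_def)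
  have "emeasure (beta_distr a) (space (beta_distr a)) = (\<integral>\<^sup>+p. ennreal (kmp_beta a p) \<partial>lborel)"
    unfolding beta_distr_def by (subst emeasure_density) auto
  also have "\<dots> = ennreal 1"
    unfolding one[symmetric] by (rule nn_integral_eq_integral[OF int]) (simp add: kmp_beta_nonneg[OF a])
  finally show "emeasure (beta_distr a) (space (beta_distr a)) = 1" by simp
qed

lemma sets_gamma_distr [measurable_cong]: "sets (gamma_distr a \<theta>) = sets borel"
  and sets_beta_distr [measurable_cong]: "sets (beta_distr a) = sets borel"
  by (simp_all add: gamma_distr_eq beta_distr_def)

text \<open>Density form of the independence: e is the sum, p the share of one site,
  \<open>\<bar>e\<bar>\<close> the Jacobian of u = e p. Both sides vanish unless e > 0 and 0 < p <
  1, so the identity can be inserted under integrals over the whole plane.\<close>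

lemma gamma_density_split:
  assumes a: "0 < a" and \<theta>: "0 < \<theta>"
  shows "\<bar>e\<bar> * (gamma_density a \<theta> (e * p) * gamma_density a \<theta> (e - e * p))
    = gamma_density (2 * a) \<theta> e * kmp_beta a p"
proof (cases "0 < e")
  case False
  have "\<not> (0 < e * p \<and> 0 < e - e * p)" using False by linarith
  then show ?thesis using False by (auto simp: gamma_density_def)
next
  case e: True
  have sub: "e - e * p = e * (1 - p)" by (simp add: algebra_simps)
  show ?thesis
  proof (cases "0 < p \<and> p < 1")
    case False
    then have "\<not> 0 < e * p \<or> \<not> 0 < e * (1 - p)" using e by (simp add: zero_less_mult_iff)
    moreover have "kmp_beta a p = 0"
      using False by (cases "p = 0 \<or> p = 1") (auto simp: kmp_beta_def kmp_density_def)
    ultimately show ?thesis by (auto simp: gamma_density_def sub)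
  next
    case p: True
    have pos: "0 < e * p" "0 < e * (1 - p)" using e p by simp_all
    have G: "Gamma a > 0" "Gamma (2 * a) > 0" using a by (auto intro!: Gamma_real_pos)
    have E: "exp (- (e * p) / \<theta>) * exp (- (e * (1 - p)) / \<theta>) = exp (- e / \<theta>)"
      by (simp add: exp_add[symmetric] add_divide_distrib[symmetric] algebra_simps)
    have W: "(e * p) powr (a - 1) * (e * (1 - p)) powr (a - 1) * e = e powr (2 * a - 1) * (p powr (a - 1) * (1 - p) powr (a - 1))"
    proof -
      have "e powr (a - 1) * e powr (a - 1) * e = e powr (2 * a - 1)"
        using e by (simp add: powr_add[symmetric] powr_mult_base mult.commute[of _ e])
      then show ?thesis using e p by (simp add: powr_mult)
    qed
    have T: "\<theta> powr a * \<theta> powr a = \<theta> powr (2 * a)" by (simp add: powr_add[symmetric])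
    have "\<bar>e\<bar> * (gamma_density a \<theta> (e * p) * gamma_density a \<theta> (e - e * p)) =
       ((e * p) powr (a - 1) * (e * (1 - p)) powr (a - 1) * e) * (exp (- (e * p) / \<theta>) * exp (- (e * (1 - p)) / \<theta>))
         / ((Gamma a)\<^sup>2 * (\<theta> powr a * \<theta> powr a))"
      unfolding sub using pos e by (simp add: gamma_density_def power2_eq_square mult_ac)
    also have "\<dots> = gamma_density (2 * a) \<theta> e * kmp_beta a p"
      unfolding E W T using p e G
      by (simp add: gamma_density_def kmp_beta_def kmp_density_def mult_ac)
    finally show ?thesis .
  qed
qed

text \<open>The planar change of variables is split into two affine substitutions in one variable, v
  = e - u and u = e p, with Tonelli in between to make e the outer variable.\<close>

lemma gamma_pair_eq_distr:
  assumes a: "0 < a" and \<theta>: "0 < \<theta>"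
  shows "gamma_distr a \<theta> \<Otimes>\<^sub>M gamma_distr a \<theta> =
    distr (gamma_distr (2 * a) \<theta> \<Otimes>\<^sub>M beta_distr a) (borel \<Otimes>\<^sub>M borel) (\<lambda>(e, p). (e * p, e - e * p))"
    (is "?L = distr ?Q _ ?T")
proof (rule measure_eqI)
  have a2: "0 < 2 * a" using a by simp
  interpret \<mu>: prob_space "gamma_distr a \<theta>" using a \<theta> by (rule prob_space_gamma_distr)
  interpret \<mu>2: prob_space "gamma_distr (2 * a) \<theta>" using a2 \<theta> by (rule prob_space_gamma_distr)
  interpret \<beta>: prob_space "beta_distr a" using a by (rule prob_space_beta_distr)
  show sets: "sets ?L = sets (distr ?Q (borel \<Otimes>\<^sub>M borel) ?T)"
    by (simp add: sets_gamma_distr cong: sets_pair_measure_cong)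
  fix A assume "A \<in> sets ?L"
  then have A [measurable]: "A \<in> sets (borel \<Otimes>\<^sub>M borel)" unfolding sets by simp
  define \<rho> where "\<rho> x = ennreal (gamma_density a \<theta> x)" for x
  define h where "h u v = (indicator A (u, v) :: ennreal)" for u v
  have [measurable]: "\<rho> \<in> borel_measurable borel" by (simp add: \<rho>_def[abs_def])
  have h [measurable]: "(\<lambda>(u, v). h u v) \<in> borel_measurable (borel \<Otimes>\<^sub>M borel)"
    unfolding h_def by (simp add: case_prod_beta')
  have h' [measurable (raw)]: "(\<lambda>x. h (f x) (g x)) \<in> borel_measurable M"
    if [measurable]: "f \<in> borel_measurable M" "g \<in> borel_measurable M" for f g and M :: "'x measure"
    using measurable_compose[OF measurable_Pair[OF that] h] by simp
  have T [measurable]: "?T \<in> measurable ?Q (borel \<Otimes>\<^sub>M borel)" by measurable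
  have "emeasure ?L A = (\<integral>\<^sup>+u. \<integral>\<^sup>+v. h u v \<partial>gamma_distr a \<theta> \<partial>gamma_distr a \<theta>)"
    unfolding h_def using \<open>A \<in> sets ?L\<close> by (rule \<mu>.emeasure_pair_measure)
  also have "\<dots> = (\<integral>\<^sup>+u. \<integral>\<^sup>+v. \<rho> u * (\<rho> v * h u v) \<partial>lborel \<partial>lborel)"
    unfolding gamma_distr_eq \<rho>_def[symmetric]
    by (subst (1 2) nn_integral_density) (auto simp: nn_integral_cmult)
  also have "\<dots> = (\<integral>\<^sup>+u. \<integral>\<^sup>+e. \<rho> u * (\<rho> (e - u) * h u (e - u)) \<partial>lborel \<partial>lborel)"
  proof (rule nn_integral_cong)
    fix u :: real
    show "(\<integral>\<^sup>+v. \<rho> u * (\<rho> v * h u v) \<partial>lborel) = (\<integral>\<^sup>+e. \<rho> u * (\<rho> (e - u) * h u (e - u)) \<partial>lborel)"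
      by (subst nn_integral_real_affine[where c = 1 and t = "- u"]) auto
  qed
  also have "\<dots> = (\<integral>\<^sup>+e. \<integral>\<^sup>+u. \<rho> u * (\<rho> (e - u) * h u (e - u)) \<partial>lborel \<partial>lborel)"
    by (rule lborel_pair.Fubini') measurable
  also have "\<dots> = (\<integral>\<^sup>+e. \<integral>\<^sup>+p. ennreal (gamma_density (2 * a) \<theta> e) * (ennreal (kmp_beta a p) * h (e * p) (e - e * p)) \<partial>lborel \<partial>lborel)"
  proof (rule nn_integral_cong_AE)
    \<comment> \<open>The substitution u = e p degenerates at e = 0, a null set.\<close>
    have "AE e in lborel. e \<noteq> (0 :: real)" by (rule AE_lborel_singleton)
    then show "AE e in lborel. (\<integral>\<^sup>+u. \<rho> u * (\<rho> (e - u) * h u (e - u)) \<partial>lborel) =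
      (\<integral>\<^sup>+p. ennreal (gamma_density (2 * a) \<theta> e) * (ennreal (kmp_beta a p) * h (e * p) (e - e * p)) \<partial>lborel)"
    proof (rule AE_mp, intro AE_I2 impI)
      fix e :: real assume e: "e \<noteq> 0"
      have "(\<integral>\<^sup>+u. \<rho> u * (\<rho> (e - u) * h u (e - u)) \<partial>lborel) =
        (\<integral>\<^sup>+p. ennreal \<bar>e\<bar> * (\<rho> (e * p) * (\<rho> (e - e * p) * h (e * p) (e - e * p))) \<partial>lborel)"
        using e by (subst nn_integral_real_affine[where c = e and t = 0]) (auto simp: nn_integral_cmult)
      also have "\<dots> = (\<integral>\<^sup>+p. ennreal (gamma_density (2 * a) \<theta> e) * (ennreal (kmp_beta a p) * h (e * p) (e - e * p)) \<partial>lborel)"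
      proof (rule nn_integral_cong)
        fix p
        have "ennreal \<bar>e\<bar> * (\<rho> (e * p) * \<rho> (e - e * p)) = ennreal (gamma_density (2 * a) \<theta> e) * ennreal (kmp_beta a p)"
          using arg_cong[OF gamma_density_split[OF a \<theta>, of e p], of ennreal]
          by (simp add: \<rho>_def ennreal_mult' gamma_density_nonneg[OF a] gamma_density_nonneg[OF a2])
        then show "ennreal \<bar>e\<bar> * (\<rho> (e * p) * (\<rho> (e - e * p) * h (e * p) (e - e * p))) =
          ennreal (gamma_density (2 * a) \<theta> e) * (ennreal (kmp_beta a p) * h (e * p) (e - e * p))"
          by (metis mult.assoc)
      qed
      finally show "(\<integral>\<^sup>+u. \<rho> u * (\<rho> (e - u) * h u (e - u)) \<partial>lborel) =
        (\<integral>\<^sup>+p. ennreal (gamma_density (2 * a) \<theta> e) * (ennreal (kmp_beta a p) * h (e * p) (e - e * p)) \<partial>lborel)" .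
    qed
  qed
  also have "\<dots> = (\<integral>\<^sup>+e. \<integral>\<^sup>+p. h (e * p) (e - e * p) \<partial>beta_distr a \<partial>gamma_distr (2 * a) \<theta>)"
    unfolding gamma_distr_eq beta_distr_def
    by (subst (1 2) nn_integral_density) (auto simp: nn_integral_cmult)
  also have "\<dots> = (\<integral>\<^sup>+z. indicator A (?T z) \<partial>?Q)"
    by (subst \<beta>.nn_integral_fst[symmetric]) (auto simp: h_def)
  also have "\<dots> = emeasure (distr ?Q (borel \<Otimes>\<^sub>M borel) ?T) A"
    by (subst nn_integral_distr[symmetric, OF T]) auto
  finally show "emeasure ?L A = emeasure (distr ?Q (borel \<Otimes>\<^sub>M borel) ?T) A" .
qed

text \<open>The redistributed pair depends on (u, v) through the sum only. By
  \<open>gamma_pair_eq_distr\<close>, (u, v) itself has the law of an independent Gamma sum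
  redistributed by a Beta share, so drawing a fresh share changes nothing.\<close>

lemma kmp_two_site:
  fixes h :: "real \<Rightarrow> real \<Rightarrow> real"
  assumes a: "0 < a" and \<theta>: "0 < \<theta>"
    and h: "(\<lambda>(u, v). h u v) \<in> borel_measurable (borel \<Otimes>\<^sub>M borel)" and B: "\<And>u v. \<bar>h u v\<bar> \<le> B"
  shows "(\<integral>v. \<integral>u. (\<integral>p. h ((u + v) * p) ((u + v) - (u + v) * p) \<partial>beta_distr a) \<partial>gamma_distr a \<theta> \<partial>gamma_distr a \<theta>)
    = (\<integral>v. \<integral>u. h u v \<partial>gamma_distr a \<theta> \<partial>gamma_distr a \<theta>)"
proof -
  have a2: "0 < 2 * a" using a by simp
  interpret \<mu>: prob_space "gamma_distr a \<theta>" using a \<theta> by (rule prob_space_gamma_distr)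
  interpret \<mu>2: prob_space "gamma_distr (2 * a) \<theta>" using a2 \<theta> by (rule prob_space_gamma_distr)
  interpret \<beta>: prob_space "beta_distr a" using a by (rule prob_space_beta_distr)
  interpret \<mu>\<mu>: pair_prob_space "gamma_distr a \<theta>" "gamma_distr a \<theta>" ..
  interpret Q: pair_prob_space "gamma_distr (2 * a) \<theta>" "beta_distr a" ..
  let ?L = "gamma_distr a \<theta> \<Otimes>\<^sub>M gamma_distr a \<theta>" and ?Q = "gamma_distr (2 * a) \<theta> \<Otimes>\<^sub>M beta_distr a"
  let ?T = "\<lambda>(e :: real, p). (e * p, e - e * p)"
  have T [measurable]: "?T \<in> measurable ?Q (borel \<Otimes>\<^sub>M borel)" by measurable
  have h' [measurable (raw)]: "(\<lambda>x. h (f x) (g x)) \<in> borel_measurable M"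
    if [measurable]: "f \<in> borel_measurable M" "g \<in> borel_measurable M" for f g and M :: "'x measure"
    using measurable_compose[OF measurable_Pair[OF that] h] by simp
  define H where "H e = (\<integral>p. h (e * p) (e - e * p) \<partial>beta_distr a)" for e
  have H [measurable]: "H \<in> borel_measurable borel"
    unfolding H_def by (rule \<beta>.borel_measurable_lebesgue_integral) measurable
  have HB: "\<bar>H e\<bar> \<le> B" for e
  proof -
    have int: "integrable (beta_distr a) (\<lambda>p. h (e * p) (e - e * p))"
      by (rule \<beta>.integrable_const_bound[of _ B]) (auto simp: B)
    have "\<bar>H e\<bar> \<le> (\<integral>p. \<bar>h (e * p) (e - e * p)\<bar> \<partial>beta_distr a)"
      unfolding H_def by (rule integral_abs_bound)
    also have "\<dots> \<le> (\<integral>p. B \<partial>beta_distr a)"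
      by (intro integral_mono integrable_abs int) (auto simp: B)
    finally show ?thesis by (simp add: \<beta>.prob_space)
  qed
  have i1: "integrable ?L (\<lambda>(u, v). H (u + v))"
    by (rule \<mu>\<mu>.P.integrable_const_bound[of _ B]) (auto simp: HB)
  have i2: "integrable ?L (\<lambda>(u, v). h u v)"
    by (rule \<mu>\<mu>.P.integrable_const_bound[of _ B]) (auto simp: B)
  have i3: "integrable ?Q (\<lambda>(e, p). h (e * p) (e - e * p))"
    by (rule Q.P.integrable_const_bound[of _ B]) (auto simp: B)
  have i4: "integrable ?Q (\<lambda>(e, p). H e)"
    by (rule Q.P.integrable_const_bound[of _ B]) (auto simp: HB)
  have "(\<integral>v. \<integral>u. H (u + v) \<partial>gamma_distr a \<theta> \<partial>gamma_distr a \<theta>) = (\<integral>z. (case z of (u, v) \<Rightarrow> H (u + v)) \<partial>?L)"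
    by (rule \<mu>\<mu>.integral_snd[OF i1])
  \<comment> \<open>Since e p + (e - e p) = e, in the new coordinates H is a function of e
    alone.\<close>
  also have "\<dots> = (\<integral>z. (case z of (e, p) \<Rightarrow> H e) \<partial>?Q)"
    unfolding gamma_pair_eq_distr[OF a \<theta>]
    by (subst integral_distr[OF T]) (auto simp: case_prod_beta' algebra_simps)
  also have "\<dots> = (\<integral>e. \<integral>p. H e \<partial>beta_distr a \<partial>gamma_distr (2 * a) \<theta>)"
    using Q.integral_fst'[OF i4] by simp
  also have "\<dots> = (\<integral>e. \<integral>p. h (e * p) (e - e * p) \<partial>beta_distr a \<partial>gamma_distr (2 * a) \<theta>)"
    by (simp add: \<beta>.prob_space H_def)
  also have "\<dots> = (\<integral>z. (case z of (e, p) \<Rightarrow> h (e * p) (e - e * p)) \<partial>?Q)"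
    using Q.integral_fst'[OF i3] by simp
  also have "\<dots> = (\<integral>z. (case z of (u, v) \<Rightarrow> h u v) \<partial>?L)"
    unfolding gamma_pair_eq_distr[OF a \<theta>]
    by (subst integral_distr[OF T]) (auto simp: case_prod_beta')
  also have "\<dots> = (\<integral>v. \<integral>u. h u v \<partial>gamma_distr a \<theta> \<partial>gamma_distr a \<theta>)"
    by (rule \<mu>\<mu>.integral_snd[OF i2, symmetric])
  finally show ?thesis unfolding H_def .
qed

text \<open>F averages g over the update of one edge, and the edge term of the generator is F - g.
  Resampling the coordinates i and l reduces equality of the two integrals to
  \<open>kmp_two_site\<close> with the other sites frozen.\<close>

lemma stationary_kmp:
  assumes G: "pair_graph G" "pverts G = {1..N}" and k: "0 < k" and \<theta>: "0 < \<theta>"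
  shows "stationary (kmp_gen k G) ({1..N} \<rightarrow>\<^sub>E {0..}) (bounded_borel_functions N ({1..N} \<rightarrow>\<^sub>E {0..}))
    (\<Pi>\<^sub>M i\<in>{1..N}. gamma_distr (2 * k) \<theta>)"
proof -
  define a where "a = 2 * k"
  have a: "0 < a" using k by (simp add: a_def)
  define \<mu> where "\<mu> = gamma_distr a \<theta>"
  define \<Omega> :: "(nat \<Rightarrow> real) set" where "\<Omega> = {1..N} \<rightarrow>\<^sub>E {0..}"
  define P where "P = (\<Pi>\<^sub>M i\<in>{1..N}. \<mu>)"
  define upd where "upd i l x p = x(i := p * (x i + x l), l := (1 - p) * (x i + x l))"
    for i l :: nat and x :: "nat \<Rightarrow> real" and p
  interpret \<mu>: prob_space \<mu> unfolding \<mu>_def using a \<theta> by (rule prob_space_gamma_distr)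
  interpret \<beta>: prob_space "beta_distr a" using a by (rule prob_space_beta_distr)
  interpret P: prob_space P unfolding P_def by (rule prob_space_PiM) (rule \<mu>.prob_space_axioms)
  have sets_\<mu> [measurable_cong]: "sets \<mu> = sets borel" by (simp add: \<mu>_def sets_gamma_distr)
  have sets_P [measurable_cong]: "sets P = sets (Pi\<^sub>M {1..N} (\<lambda>_. borel))"
    unfolding P_def by (intro sets_PiM_cong refl sets_\<mu>)
  have \<Omega>: "\<Omega> \<in> sets (Pi\<^sub>M {1..N} (\<lambda>_. borel))"
    unfolding \<Omega>_def by (intro sets_PiM_I_finite) auto
  have "stationary (\<lambda>f x. \<Sum>(i, l)\<in>edges G.
      LINT p:{0..1}|lborel. (f (upd i l x p) - f x) * kmp_density a p) ({1..N} \<rightarrow>\<^sub>E {0..})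
      (bounded_borel_functions N ({1..N} \<rightarrow>\<^sub>E {0..})) (\<Pi>\<^sub>M i\<in>{1..N}. \<mu>)"
  proof (rule stationary_sumI[OF finite_edges[OF G(1)] _ \<mu>.prob_space_axioms], goal_cases)
    case 3
    show ?case
      unfolding \<mu>_def gamma_distr_eq
      by (subst AE_density) (auto intro!: AE_I2 simp: gamma_density_def)
  next
    case (4 f i l)
    have il: "i \<in> {1..N}" "l \<in> {1..N}" "i \<noteq> l" using edges_subset[OF G 4(2)] by auto
    have f: "f \<in> borel_measurable (restrict_space (Pi\<^sub>M {1..N} (\<lambda>_. borel)) \<Omega>)" "bounded (f ` \<Omega>)"
      using 4(1) by (simp_all add: bounded_borel_functions_def \<Omega>_def)
    define g where "g x = indicator \<Omega> x * f x" for x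
    have g [measurable]: "g \<in> borel_measurable (Pi\<^sub>M {1..N} (\<lambda>_. borel))"
      using f(1) \<Omega> unfolding g_def[abs_def]
      by (subst (asm) borel_measurable_restrict_space_iff) (auto simp: space_PiM)
    have "\<exists>B. \<forall>x\<in>\<Omega>. \<bar>f x\<bar> \<le> B" using f(2) unfolding bounded_iff by simp
    then obtain B where "\<forall>x\<in>\<Omega>. \<bar>f x\<bar> \<le> B" ..
    then have B: "\<bar>g x\<bar> \<le> \<bar>B\<bar>" for x
      by (cases "x \<in> \<Omega>") (auto simp: g_def)
    define F where "F x = (\<integral>p. g (upd i l x p) \<partial>beta_distr a)" for x
    have upd_meas: "(\<lambda>(x, p). upd i l x p) \<in> measurable (Pi\<^sub>M {1..N} (\<lambda>_. borel) \<Otimes>\<^sub>M beta_distr a) (Pi\<^sub>M {1..N} (\<lambda>_. borel))"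
    proof (rule measurable_PiM_single', goal_cases)
      case (1 j)
      have [measurable]: "(\<lambda>z. fst z j) \<in> borel_measurable (Pi\<^sub>M {1..N} (\<lambda>_. borel) \<Otimes>\<^sub>M beta_distr a)"
        if "j \<in> {1..N}" for j
        using measurable_compose[OF measurable_fst measurable_component_singleton[OF that]] .
      show ?case
        using 1 il by (auto simp: upd_def case_prod_beta' fun_upd_def)
    next
      case 2
      then show ?case
        using il by (auto simp: upd_def space_pair_measure space_PiM PiE_iff extensional_def)
    qed
    have space: "x \<in> space (Pi\<^sub>M {1..N} (\<lambda>_. borel :: real measure)) \<longleftrightarrow> x \<in> extensional {1..N}"
      for x :: "nat \<Rightarrow> real"
      by (simp add: space_PiM PiE_def)
    have g_upd: "(\<lambda>(x, p). g (upd i l x p)) \<in> borel_measurable (Pi\<^sub>M {1..N} (\<lambda>_. borel) \<Otimes>\<^sub>M beta_distr a)"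
      using measurable_compose[OF upd_meas g] by (simp add: case_prod_beta')
    have g_upd_x: "(\<lambda>p. g (upd i l x p)) \<in> borel_measurable (beta_distr a)" if "x \<in> extensional {1..N}" for x
      using measurable_compose[OF measurable_Pair1'[of x] g_upd] that by (simp add: space del: One_nat_def)
    have F [measurable]: "F \<in> borel_measurable (Pi\<^sub>M {1..N} (\<lambda>_. borel))"
      unfolding F_def[abs_def] by (rule \<beta>.borel_measurable_lebesgue_integral[OF g_upd])
    have int_upd: "integrable (beta_distr a) (\<lambda>p. g (upd i l x p))" if "x \<in> extensional {1..N}" for x
      by (rule \<beta>.integrable_const_bound[of _ "\<bar>B\<bar>"]) (simp_all add: B g_upd_x[OF that])
    have FB: "\<bar>F x\<bar> \<le> \<bar>B\<bar>" if "x \<in> extensional {1..N}" for x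
    proof -
      have "\<bar>F x\<bar> \<le> (\<integral>p. \<bar>g (upd i l x p)\<bar> \<partial>beta_distr a)"
        unfolding F_def by (rule integral_abs_bound)
      also have "\<dots> \<le> (\<integral>p. \<bar>B\<bar> \<partial>beta_distr a)"
        by (intro integral_mono integrable_abs int_upd that) (auto simp: B)
      finally show ?thesis by (simp add: \<beta>.prob_space)
    qed
    have spaceP: "x \<in> space P \<longleftrightarrow> x \<in> extensional {1..N}" for x
      using sets_eq_imp_space_eq[OF sets_P] space by simp
    have bounded_int: "integrable P \<Phi>" if "\<Phi> \<in> borel_measurable (Pi\<^sub>M {1..N} (\<lambda>_. borel))"
      "\<And>x. x \<in> extensional {1..N} \<Longrightarrow> \<bar>\<Phi> x\<bar> \<le> \<bar>B\<bar>" for \<Phi>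
      by (rule P.integrable_const_bound[of _ "\<bar>B\<bar>"])
         (use that spaceP in \<open>auto intro!: AE_I2 simp: measurable_cong_sets[OF sets_P refl]\<close>)
    have resample: "integral\<^sup>L P \<Phi> = (\<integral>x. \<integral>v. \<integral>u. \<Phi> (x(l := v, i := u)) \<partial>\<mu> \<partial>\<mu> \<partial>P)"
      if \<Phi> [measurable]: "\<Phi> \<in> borel_measurable (Pi\<^sub>M {1..N} (\<lambda>_. borel))"
        and \<Phi>B: "\<And>x. x \<in> extensional {1..N} \<Longrightarrow> \<bar>\<Phi> x\<bar> \<le> \<bar>B\<bar>" for \<Phi>
    proof -
      have "(\<lambda>z. (fst z)(i := snd z)) \<in> measurable (Pi\<^sub>M {1..N} (\<lambda>_. borel) \<Otimes>\<^sub>M \<mu>) (Pi\<^sub>M {1..N} (\<lambda>_. borel))"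
        by (rule measurable_fun_upd[where J = "{1..N}"]) (use il in auto)
      from measurable_compose[OF this \<Phi>]
      have m: "(\<lambda>(x, u). \<Phi> (x(i := u))) \<in> borel_measurable (Pi\<^sub>M {1..N} (\<lambda>_. borel) \<Otimes>\<^sub>M \<mu>)"
        by (simp add: case_prod_beta')
      have m1: "(\<lambda>x. \<integral>u. \<Phi> (x(i := u)) \<partial>\<mu>) \<in> borel_measurable (Pi\<^sub>M {1..N} (\<lambda>_. borel))"
        by (rule \<mu>.borel_measurable_lebesgue_integral[OF m])
      have b1: "\<bar>\<integral>u. \<Phi> (x(i := u)) \<partial>\<mu>\<bar> \<le> \<bar>B\<bar>" if x: "x \<in> extensional {1..N}" for x
      proof -
        have ub: "\<bar>\<Phi> (x(i := u))\<bar> \<le> \<bar>B\<bar>" for u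
          using x il by (intro \<Phi>B) (auto simp: extensional_def)
        have "(\<lambda>u. \<Phi> (x(i := u))) \<in> borel_measurable \<mu>"
          using measurable_compose[OF measurable_Pair1'[of x] m] x by (simp add: space del: One_nat_def)
        then have "integrable \<mu> (\<lambda>u. \<Phi> (x(i := u)))"
          by (intro \<mu>.integrable_const_bound[of _ "\<bar>B\<bar>"]) (simp_all add: ub)
        then have "(\<integral>u. \<bar>\<Phi> (x(i := u))\<bar> \<partial>\<mu>) \<le> (\<integral>u. \<bar>B\<bar> \<partial>\<mu>)"
          by (intro integral_mono integrable_abs) (auto simp: ub)
        from order_trans[OF integral_abs_bound this] show ?thesis by (simp add: \<mu>.prob_space)
      qed
      have "integral\<^sup>L P \<Phi> = (\<integral>x. \<integral>u. \<Phi> (x(i := u)) \<partial>\<mu> \<partial>P)"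
        unfolding P_def
        by (rule integral_PiM_resample) (use il bounded_int[OF \<Phi> \<Phi>B] \<mu>.prob_space_axioms in \<open>simp_all add: P_def\<close>)
      also have "\<dots> = (\<integral>x. \<integral>v. \<integral>u. \<Phi> (x(l := v, i := u)) \<partial>\<mu> \<partial>\<mu> \<partial>P)"
        unfolding P_def
        by (rule integral_PiM_resample) (use il bounded_int[OF m1 b1] \<mu>.prob_space_axioms in \<open>simp_all add: P_def\<close>)
      finally show ?thesis .
    qed
    have "integral\<^sup>L P F = (\<integral>x. \<integral>v. \<integral>u. F (x(l := v, i := u)) \<partial>\<mu> \<partial>\<mu> \<partial>P)"
      by (rule resample[OF F FB])
    also have "\<dots> = (\<integral>x. \<integral>v. \<integral>u. g (x(l := v, i := u)) \<partial>\<mu> \<partial>\<mu> \<partial>P)"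
    proof (rule Bochner_Integration.integral_cong[OF refl])
      fix x assume "x \<in> space P"
      then have x: "x \<in> space (Pi\<^sub>M {1..N} (\<lambda>_. borel :: real measure))" by (simp add: spaceP space del: One_nat_def)
      have "(\<lambda>z. x(l := snd z, i := fst z)) \<in> measurable (borel \<Otimes>\<^sub>M borel) (Pi\<^sub>M {1..N} (\<lambda>_. borel))"
        by (intro measurable_fun_upd[where J = "{1..N}"]) (use il x in auto)
      from measurable_compose[OF this g]
      have h: "(\<lambda>(u, v). g (x(l := v, i := u))) \<in> borel_measurable (borel \<Otimes>\<^sub>M borel)"
        by (simp add: case_prod_beta')
      have "upd i l (x(l := v, i := u)) p = x(l := (u + v) - (u + v) * p, i := (u + v) * p)" for u v p
        using il(3) by (auto simp: upd_def fun_eq_iff algebra_simps)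
      then show "(\<integral>v. \<integral>u. F (x(l := v, i := u)) \<partial>\<mu> \<partial>\<mu>) = (\<integral>v. \<integral>u. g (x(l := v, i := u)) \<partial>\<mu> \<partial>\<mu>)"
        unfolding F_def \<mu>_def using kmp_two_site[OF a \<theta> h B] by simp
    qed
    also have "\<dots> = integral\<^sup>L P g"
      by (rule resample[OF g B, symmetric])
    finally have eq: "integral\<^sup>L P F = integral\<^sup>L P g" .
    have int: "integrable P F" by (rule bounded_int[OF F FB])
    have int': "integrable P g" by (rule bounded_int[OF g B])
    have "(LINT p:{0..1}|lborel. (f (upd i l x p) - f x) * kmp_density a p) = F x - g x" if x: "x \<in> \<Omega>" for x
    proof -
      have ext: "x \<in> extensional {1..N}" using x by (simp add: \<Omega>_def PiE_def)
      have pos: "0 \<le> x i" "0 \<le> x l" using x il by (auto simp: \<Omega>_def PiE_iff)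
      have "upd i l x p \<in> \<Omega>" if "p \<in> {0..1}" for p
        using x il that pos unfolding \<Omega>_def upd_def PiE_iff extensional_def by simp
      \<comment> \<open>For p in the unit interval the update stays in the state space, where f and
        its extension g agree; other p are cut off on both sides.\<close>
      then have pt: "indicator {0..1} p *\<^sub>R ((f (upd i l x p) - f x) * kmp_density a p)
          = kmp_beta a p *\<^sub>R (g (upd i l x p) - g x)" for p
        using x by (simp add: g_def kmp_beta_def split: split_indicator)
      have "(\<integral>p. g (upd i l x p) - g x \<partial>beta_distr a) = F x - g x"
        unfolding F_def using int_upd[OF ext] by (simp add: \<beta>.prob_space)
      moreover have "(\<integral>p. g (upd i l x p) - g x \<partial>beta_distr a) = (\<integral>p. kmp_beta a p *\<^sub>R (g (upd i l x p) - g x) \<partial>lborel)"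
        unfolding beta_distr_def
        by (rule integral_density)
           (use g_upd_x[OF ext] kmp_beta_nonneg[OF a] in \<open>simp_all add: beta_distr_def\<close>)
      ultimately show ?thesis unfolding set_lebesgue_integral_def pt by simp
    qed
    moreover have "integrable P (\<lambda>x. F x - g x)" "(\<integral>x. F x - g x \<partial>P) = 0"
      using int int' eq by simp_all
    ultimately show ?case
      unfolding \<Omega>_def P_def by (intro exI[of _ "\<lambda>x. F x - g x"]) simp
  qed simp_all
  then show ?thesis by (simp add: kmp_gen_def[abs_def] upd_def a_def \<mu>_def)
qed

theorem theorem1p4:
  fixes G :: "nat pair_pre_digraph" and N :: nat
  assumes "pair_graph G"
    and "Digraph_Component.connected (with_proj G)"
    and "pverts G = {1..N}"
  shows
    "(\<forall>(twoj::nat) (p::real). 1 \<le> twoj \<and> 0 < p \<and> p < 1 \<longrightarrow>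
        stationary (sep_gen twoj G) ({1..N} \<rightarrow>\<^sub>E {0..twoj})
          (bounded_functions ({1..N} \<rightarrow>\<^sub>E {0..twoj}))
          (\<Pi>\<^sub>M i\<in>{1..N}. measure_pmf (binomial_pmf twoj p)) \<and>
        self_dual (sep_gen twoj G) ({1..N} \<rightarrow>\<^sub>E {0..twoj})
          (\<lambda>x n. \<Prod>i = 1..N. krawtchouk twoj p (n i) (real (x i)) / real (twoj choose n i)))
   \<and> (\<forall>(k::real) (p::real). 0 < k \<and> 0 < p \<and> p < 1 \<longrightarrow>
        stationary (sip_gen k G) ({1..N} \<rightarrow>\<^sub>E UNIV)
          (bounded_functions ({1..N} \<rightarrow>\<^sub>E UNIV))
          (\<Pi>\<^sub>M i\<in>{1..N}. neg_binomial_distr (2 * k) p) \<and>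
        self_dual (sip_gen k G) ({1..N} \<rightarrow>\<^sub>E UNIV)
          (\<lambda>x n. \<Prod>i = 1..N.
             Gamma (2 * k) / Gamma (2 * k + real (n i)) * meixner (2 * k) p (n i) (real (x i))))
   \<and> (\<forall>c::real. 0 < c \<longrightarrow>
        stationary (irw_gen G) ({1..N} \<rightarrow>\<^sub>E UNIV)
          (bounded_functions ({1..N} \<rightarrow>\<^sub>E UNIV))
          (\<Pi>\<^sub>M i\<in>{1..N}. measure_pmf (poisson_pmf c)) \<and>
        self_dual (irw_gen G) ({1..N} \<rightarrow>\<^sub>E UNIV)
          (\<lambda>x n. \<Prod>i = 1..N. charlier c (n i) (real (x i))))
   \<and> ((\<forall>\<sigma>::real. 0 < \<sigma> \<longrightarrow>
          stationary (bmp_gen G) ({1..N} \<rightarrow>\<^sub>E UNIV) (C2_compact N UNIV)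
            (\<Pi>\<^sub>M i\<in>{1..N}. density lborel (normal_density 0 \<sigma>))) \<and>
        dual (bmp_gen G) ({1..N} \<rightarrow>\<^sub>E UNIV)
          (\<lambda>f n. 4 * sip_gen (1 / 4) G f n) ({1..N} \<rightarrow>\<^sub>E UNIV)
          (\<lambda>x n. \<Prod>i = 1..N. 1 / odd_double_fact (n i) * hermite (2 * n i) (x i)))
   \<and> (\<forall>k::real. 0 < k \<longrightarrow>
        (\<forall>\<theta>::real. 0 < \<theta> \<longrightarrow>
          stationary (bep_gen k G) ({1..N} \<rightarrow>\<^sub>E {0..}) (C2_compact N {0..})
            (\<Pi>\<^sub>M i\<in>{1..N}. gamma_distr (2 * k) \<theta>)) \<and>
        dual (bep_gen k G) ({1..N} \<rightarrow>\<^sub>E {0..})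
          (sip_gen k G) ({1..N} \<rightarrow>\<^sub>E UNIV)
          (\<lambda>x n. \<Prod>i = 1..N.
             fact (n i) * Gamma (2 * k) / Gamma (2 * k + real (n i)) * laguerre (2 * k) (n i) (x i)))
   \<and> (\<forall>k::real. 0 < k \<longrightarrow>
        (\<forall>\<theta>::real. 0 < \<theta> \<longrightarrow>
          stationary (kmp_gen k G) ({1..N} \<rightarrow>\<^sub>E {0..})
            (bounded_borel_functions N ({1..N} \<rightarrow>\<^sub>E {0..}))
            (\<Pi>\<^sub>M i\<in>{1..N}. gamma_distr (2 * k) \<theta>)) \<and>
        dual (kmp_gen k G) ({1..N} \<rightarrow>\<^sub>E {0..})
          (dual_kmp_gen k G) ({1..N} \<rightarrow>\<^sub>E UNIV)
          (\<lambda>x n. \<Prod>i = 1..N.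
             fact (n i) * Gamma (2 * k) / Gamma (2 * k + real (n i)) * laguerre (2 * k) (n i) (x i)))"
proof -
  note G = assms(1,3)
  show ?thesis
    by (intro conjI allI impI; (elim conjE)?;
      rule stationary_sep[OF G] self_dual_sep[OF G] stationary_sip[OF G] self_dual_sip[OF G]
        stationary_irw[OF G] self_dual_irw[OF G] stationary_bmp[OF G] dual_bmp[OF G]
        stationary_bep[OF G] dual_bep[OF G] stationary_kmp[OF G] dual_kmp[OF G]; assumption)
qed

end
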